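(* Let "algebra" mean either "MV-algebra" or "unital $\ell$-group". Under each of these two readings, each of the following three classes contains a hopfian member and a non-hopfian member: ($\bar{\rm a}$bc) non-semisimple, finitely generated algebras whose maximal ideals of finite rank are dense in the maximal spectral space; (a$\bar{\rm b}$c) semisimple, not finitely generated algebras whose maximal ideals of finite rank are dense in the maximal spectral space; (ab$\bar{\rm c}$) semisimple, finitely generated algebras whose maximal ideals of finite rank are not dense in the maximal spectral space.
   Context: An MV-algebra is an abelian monoid $(A,0,\oplus)$ with a unary operation $\neg$ satisfying $\neg\neg x=x$, $x\oplus\neg 0=\neg 0$ and $\neg(\neg x\oplus y)\oplus y=\neg(\neg y\oplus x)\oplus x$. A unital $\ell$-group $(G,u)$ is an abelian group with a translation-invariant lattice order and a distinguished unit $u\ge 0$ such that every $0\le x\in G$ is dominated by some integer multiple of $u$; homomorphisms preserve the group structure, the lattice structure and the unit. All MV-algebras and unital $\ell$-groups are assumed nontrivial. In both cases an ideal is the kernel (preimage of $0$) of a homomorphism, assumed proper; the maximal spectral space is the set of maximal ideals with the hull-kernel topology, a basis of closed sets being given by the sets $\{\mathfrak m\mid a\in\mathfrak m\}$ for $a$ an element of the algebra; the algebra is semisimple if the intersection of its maximal ideals is $\{0\}$. A maximal ideal $\mathfrak m$ of an MV-algebra $A$ has finite rank if $A/\mathfrak m$ is finite; a maximal ideal $\mathfrak m$ of $(G,u)$ has finite rank if $G/\mathfrak m$ is isomorphic to the additive group $\mathbb Z$ with its natural order (the unit being some integer $v>0$). An algebra is hopfian if every homomorphism of it onto itself is an automorphism.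 *)

theory Defs
  imports
    Complex_Main
    "HOL-Algebra.Elementary_Groups"
    "HOL-Algebra.Lattice"
    "HOL-Analysis.Abstract_Topology"
begin

text \<open>
  Both kinds of algebra extend the library's (multiplicatively written) monoid record: in an
  MV-algebra or unital l-group, \<open>\<one>\<close> is the zero element and \<open>\<otimes>\<close> is the addition (\<open>\<oplus>\<close> or \<open>+\<close>).
\<close>

section \<open>Maximal spectral spaces\<close>

definition maximal_members :: "'a set set \<Rightarrow> 'a set set" where
  "maximal_members \<I> = {m \<in> \<I>. \<forall>i\<in>\<I>. m \<subseteq> i \<longrightarrow> i = m}"

text \<open>
  The basic open sets are the complements of the basic closed sets \<open>{m \<in> M. a \<in> m}\<close>.
\<close>

definition hull_kernel_topology :: "'a set \<Rightarrow> 'a set set \<Rightarrow> 'a set topology" where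
  "hull_kernel_topology X M = topology_generated_by ((\<lambda>a. {m \<in> M. a \<notin> m}) ` X)"


section \<open>MV-algebras\<close>

record 'a mv = "'a monoid" +
  mv_neg :: "'a \<Rightarrow> 'a"

locale mv_algebra = comm_monoid A for A :: "'a mv" (structure) +
  assumes neg_closed: "x \<in> carrier A \<Longrightarrow> mv_neg A x \<in> carrier A"
    and neg_neg: "x \<in> carrier A \<Longrightarrow> mv_neg A (mv_neg A x) = x"
    and plus_neg_zero: "x \<in> carrier A \<Longrightarrow> x \<otimes> mv_neg A \<one> = mv_neg A \<one>"
    and lukasiewicz: "\<lbrakk>x \<in> carrier A; y \<in> carrier A\<rbrakk> \<Longrightarrow>
      mv_neg A (mv_neg A x \<otimes> y) \<otimes> y = mv_neg A (mv_neg A y \<otimes> x) \<otimes> x"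
    and nontrivial: "carrier A \<noteq> {\<one>}"

definition mv_hom :: "'a mv \<Rightarrow> 'b mv \<Rightarrow> ('a \<Rightarrow> 'b) set" where
  "mv_hom A B = {f \<in> hom A B. f \<one>\<^bsub>A\<^esub> = \<one>\<^bsub>B\<^esub> \<and>
     (\<forall>x\<in>carrier A. f (mv_neg A x) = mv_neg B (f x))}"

text \<open>
  Kernels of homomorphisms. Targets with carrier in the type \<open>'a set\<close> suffice, since every
  homomorphic image of \<open>A\<close> is isomorphic to an algebra of congruence classes of \<open>A\<close>.
\<close>

definition mv_ideal :: "'a mv \<Rightarrow> 'a set \<Rightarrow> bool" where
  "mv_ideal A I \<longleftrightarrow>
     (\<exists>(B :: 'a set mv) f. mv_algebra B \<and> f \<in> mv_hom A B \<and> I = kernel A B f) \<and> I \<noteq> carrier A"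

definition mv_maximal_ideals :: "'a mv \<Rightarrow> 'a set set" where
  "mv_maximal_ideals A = maximal_members {I. mv_ideal A I}"

definition mv_spectral_space :: "'a mv \<Rightarrow> 'a set topology" where
  "mv_spectral_space A = hull_kernel_topology (carrier A) (mv_maximal_ideals A)"

definition mv_semisimple :: "'a mv \<Rightarrow> bool" where
  "mv_semisimple A \<longleftrightarrow> \<Inter> (mv_maximal_ideals A) = {\<one>\<^bsub>A\<^esub>}"

text \<open>
  The congruence of an ideal: the distance \<open>(x \<ominus> y) \<oplus> (y \<ominus> x)\<close>, where
  \<open>x \<ominus> y = \<not> (\<not> x \<oplus> y)\<close>, lies in the ideal.
\<close>

definition mv_cong :: "'a mv \<Rightarrow> 'a set \<Rightarrow> ('a \<times> 'a) set" where
  "mv_cong A I = {(x, y) \<in> carrier A \<times> carrier A.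
     mv_neg A (mv_neg A x \<otimes>\<^bsub>A\<^esub> y) \<otimes>\<^bsub>A\<^esub> mv_neg A (mv_neg A y \<otimes>\<^bsub>A\<^esub> x) \<in> I}"

definition mv_finite_rank :: "'a mv \<Rightarrow> 'a set \<Rightarrow> bool" where
  "mv_finite_rank A m \<longleftrightarrow> finite (carrier A // mv_cong A m)"

definition mv_finite_rank_dense :: "'a mv \<Rightarrow> bool" where
  "mv_finite_rank_dense A \<longleftrightarrow>
     mv_spectral_space A closure_of {m \<in> mv_maximal_ideals A. mv_finite_rank A m}
       = topspace (mv_spectral_space A)"

definition mv_subalgebra :: "'a mv \<Rightarrow> 'a set \<Rightarrow> bool" where
  "mv_subalgebra A B \<longleftrightarrow> submonoid B A \<and> (\<forall>x\<in>B. mv_neg A x \<in> B)"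

definition mv_finitely_generated :: "'a mv \<Rightarrow> bool" where
  "mv_finitely_generated A \<longleftrightarrow>
     (\<exists>S. finite S \<and> S \<subseteq> carrier A \<and> mv_subalgebra A hull S = carrier A)"

text \<open>A bijective homomorphism is an automorphism, its inverse being a homomorphism as well.\<close>

definition mv_hopfian :: "'a mv \<Rightarrow> bool" where
  "mv_hopfian A \<longleftrightarrow>
     (\<forall>f\<in>mv_hom A A. f ` carrier A = carrier A \<longrightarrow> bij_betw f (carrier A) (carrier A))"


section \<open>Unital l-groups\<close>

record 'a ulgroup = "'a monoid" +
  ul_le :: "'a \<Rightarrow> 'a \<Rightarrow> bool"
  ul_unit :: "'a"

definition ul_order :: "'a ulgroup \<Rightarrow> 'a gorder" where
  "ul_order G = \<lparr>carrier = carrier G, eq = (=), le = ul_le G\<rparr>"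

locale unital_lgroup = comm_group G for G :: "'a ulgroup" (structure) +
  assumes lattice_order: "lattice (ul_order G)"
    and translation: "\<lbrakk>x \<in> carrier G; y \<in> carrier G; z \<in> carrier G; ul_le G x y\<rbrakk> \<Longrightarrow>
      ul_le G (z \<otimes> x) (z \<otimes> y)"
    and unit_closed: "ul_unit G \<in> carrier G"
    and unit_nonneg: "ul_le G \<one> (ul_unit G)"
    and unit_dominates: "\<lbrakk>x \<in> carrier G; ul_le G \<one> x\<rbrakk> \<Longrightarrow> \<exists>n::int. ul_le G x (ul_unit G [^] n)"
    and nontrivial: "carrier G \<noteq> {\<one>}"

definition ul_hom :: "'a ulgroup \<Rightarrow> 'b ulgroup \<Rightarrow> ('a \<Rightarrow> 'b) set" where
  "ul_hom G H = {f \<in> hom G H. f (ul_unit G) = ul_unit H \<and>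
     (\<forall>x\<in>carrier G. \<forall>y\<in>carrier G.
        f (x \<squnion>\<^bsub>ul_order G\<^esub> y) = f x \<squnion>\<^bsub>ul_order H\<^esub> f y \<and>
        f (x \<sqinter>\<^bsub>ul_order G\<^esub> y) = f x \<sqinter>\<^bsub>ul_order H\<^esub> f y)}"

definition ul_ideal :: "'a ulgroup \<Rightarrow> 'a set \<Rightarrow> bool" where
  "ul_ideal G I \<longleftrightarrow>
     (\<exists>(H :: 'a set ulgroup) f. unital_lgroup H \<and> f \<in> ul_hom G H \<and> I = kernel G H f) \<and>
     I \<noteq> carrier G"

definition ul_maximal_ideals :: "'a ulgroup \<Rightarrow> 'a set set" where
  "ul_maximal_ideals G = maximal_members {I. ul_ideal G I}"

definition ul_spectral_space :: "'a ulgroup \<Rightarrow> 'a set topology" where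
  "ul_spectral_space G = hull_kernel_topology (carrier G) (ul_maximal_ideals G)"

definition ul_semisimple :: "'a ulgroup \<Rightarrow> bool" where
  "ul_semisimple G \<longleftrightarrow> \<Inter> (ul_maximal_ideals G) = {\<one>\<^bsub>G\<^esub>}"

text \<open>
  On cosets of an ideal \<open>m\<close> this is the order of the quotient \<open>G / m\<close>: as \<open>m\<close> is a convex
  sublattice subgroup, comparability of some representatives defines a lattice order.
\<close>

definition ul_coset_le :: "'a ulgroup \<Rightarrow> 'a set \<Rightarrow> 'a set \<Rightarrow> bool" where
  "ul_coset_le G X Y \<longleftrightarrow> (\<exists>x\<in>X. \<exists>y\<in>Y. ul_le G x y)"

definition ul_finite_rank :: "'a ulgroup \<Rightarrow> 'a set \<Rightarrow> bool" where
  "ul_finite_rank G m \<longleftrightarrow>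
     (\<exists>\<phi> \<in> iso (G Mod m) integer_group.
        (\<forall>X\<in>carrier (G Mod m). \<forall>Y\<in>carrier (G Mod m). ul_coset_le G X Y \<longleftrightarrow> \<phi> X \<le> \<phi> Y) \<and>
        \<phi> (m #>\<^bsub>G\<^esub> ul_unit G) > 0)"

definition ul_finite_rank_dense :: "'a ulgroup \<Rightarrow> bool" where
  "ul_finite_rank_dense G \<longleftrightarrow>
     ul_spectral_space G closure_of {m \<in> ul_maximal_ideals G. ul_finite_rank G m}
       = topspace (ul_spectral_space G)"

text \<open>The unit is a constant of the signature, so it belongs to every subalgebra.\<close>

definition ul_subalgebra :: "'a ulgroup \<Rightarrow> 'a set \<Rightarrow> bool" where
  "ul_subalgebra G H \<longleftrightarrow> subgroup H G \<and> ul_unit G \<in> H \<and>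
     (\<forall>x\<in>H. \<forall>y\<in>H. x \<squnion>\<^bsub>ul_order G\<^esub> y \<in> H \<and> x \<sqinter>\<^bsub>ul_order G\<^esub> y \<in> H)"

definition ul_finitely_generated :: "'a ulgroup \<Rightarrow> bool" where
  "ul_finitely_generated G \<longleftrightarrow>
     (\<exists>S. finite S \<and> S \<subseteq> carrier G \<and> ul_subalgebra G hull S = carrier G)"

definition ul_hopfian :: "'a ulgroup \<Rightarrow> bool" where
  "ul_hopfian G \<longleftrightarrow>
     (\<forall>f\<in>ul_hom G G. f ` carrier G = carrier G \<longrightarrow> bij_betw f (carrier G) (carrier G))"


section \<open>The universe of carriers\<close>

text \<open>
  HOL cannot quantify over types inside a proposition, so an existence claim has to fix a type
  from which carriers are drawn (an algebra's carrier may be any subset of it). This one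
  has cardinality \<open>2^(2^\<aleph>\<^sub>0)\<close>; in particular it contains a copy of every countable algebra, hence
  of every finitely generated one.
\<close>

type_synonym universe = "(nat \<Rightarrow> real) \<Rightarrow> real"

end

theory Submission
  imports Defs "HOL-Library.Function_Algebras" "HOL-Library.Lattice_Algebras"
begin

text \<open>
  Every witness for unital l-groups is a group \<open>S\<close> with unit \<open>u\<close>, and the witness for MV-algebras is
  its unit interval \<open>\<Gamma> = S \<inter> [0, u]\<close>. Hopficity passes from \<open>\<Gamma>\<close> to \<open>S\<close>, non-hopficity from \<open>S\<close>
  to \<open>\<Gamma>\<close>, finite generation from \<open>\<Gamma>\<close> to \<open>S\<close>, and ideals of either kind are controlled by their traces
  on \<open>\<Gamma>\<close>; hence each property is checked only once. No quotient is ever formed: all maximal ideals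
  that matter are kernels of unital homomorphisms \<open>S \<rightarrow> \<real>\<close>.

  Not semisimple: \<open>\<int>\<close> extended lexicographically by an l-group \<open>L\<close> of infinitesimals has one maximal
  ideal, with quotient \<open>\<int>\<close>. Taking \<open>L = \<int>\<close> (Chang's algebra) gives a hopfian algebra; the l-group \<open>L\<close>
  of eventually affine integer sequences has the shift as a surjection that kills \<open>(1, 0, 0, \<dots>)\<close>.

  Not finitely generated: eventually constant sequences whose \<open>n\<close>-th entry lies in \<open>(1 / k n) \<int>\<close>
  and whose limit lies in \<open>\<int>\<close>. With \<open>k = 1\<close> the shift is again a non-injective surjection, while for
  \<open>k\<close> injective with values at least \<open>2\<close> the ranks tell the points apart, so a surjective endomorphism
  is the identity.

  Finite rank not dense: \<open>\<int>[\<surd>2]\<close> is simple, hence hopfian. For the non-hopfian case put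
  \<open>\<theta> = \<surd>2 - 1\<close>, a unit of \<open>\<int>[\<surd>2]\<close>: the sequences \<open>(\<theta>\<^sup>n)\<close> and \<open>(\<theta>\<^sup>n\<^sup>+\<^sup>1)\<close> generate
  an algebra on which the shift is onto because \<open>\<theta>\<close> is invertible, and not injective.
\<close>

section \<open>Subgroups of lattice-ordered groups as unital l-groups and MV-algebras\<close>

text \<open>Identifying endomorphisms of \<Gamma> with unital endomorphisms of \<open>S\<close>
  would require extending maps from \<Gamma> to \<open>S\<close>. The direction of the transfers
  avoids this: hopficity is proved for all endomorphisms of \<Gamma>, non-hopficity is witnessed by
  a map on \<open>S\<close>, and so maps are only ever restricted. Maximal ideals are governed by
  \<open>isolating h e\<close>: if \<open>e\<close> is the least element of \<Gamma> at which the
  state \<open>h\<close> is 1, the kernel of \<open>h\<close> is an isolated point of the spectrum.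
  One such state with infinitely many values on \<Gamma> refutes density. In the dense examples
  every maximal ideal has finite rank, so no closure has to be computed. Finite generation is at
  odds with a non-injective shift: the algebra contains every unit vector, which finitely many
  eventually constant sequences cannot produce. The remedy in both cases is a generator with
  pairwise distinct entries, the identity sequence among the infinitesimals and \<theta>^n among the
  bounded sequences. The companion \<theta>^(n+1) is there because 1 and \<theta> form a basis of
  the ring of coefficients.\<close>

hide_const (open) Lattice.sup Lattice.inf

instance "fun" :: (type, ordered_ab_group_add) ordered_ab_group_add
  by standard (simp add: le_fun_def)

instance "fun" :: (type, lattice_ab_group_add) lattice_ab_group_add ..

text \<open>\<open>E\<close> transports the structure into the prescribed type of carriers;
  computation itself takes place in the ambient lattice-ordered group, after decoding by
  \<open>the_inv E\<close>.\<close>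

definition enc_ulgroup :: "'a::lattice_ab_group_add set \<Rightarrow> 'a \<Rightarrow> ('a \<Rightarrow> 'b) \<Rightarrow> 'b ulgroup" where
  "enc_ulgroup S u E =
     \<lparr>carrier = E ` S, mult = (\<lambda>x y. E (the_inv E x + the_inv E y)), one = E 0,
      ul_le = (\<lambda>x y. the_inv E x \<le> the_inv E y), ul_unit = E u\<rparr>"

text \<open>Mundici's functor \<Gamma>, transported along \<open>E\<close>.\<close>

definition enc_mv :: "'a::lattice_ab_group_add set \<Rightarrow> 'a \<Rightarrow> ('a \<Rightarrow> 'b) \<Rightarrow> 'b mv" where
  "enc_mv S u E =
     \<lparr>carrier = E ` (S \<inter> {0..u}), mult = (\<lambda>x y. E (inf (the_inv E x + the_inv E y) u)),
      one = E 0, mv_neg = (\<lambda>x. E (u - the_inv E x))\<rparr>"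

text \<open>Closure under differences and suprema suffices: negatives and sums are differences, and
  \<open>inf x y\<close> is \<open>- sup (- x) (- y)\<close>.\<close>

locale encoded =
  fixes S :: "'a::lattice_ab_group_add set" and u :: 'a and E :: "'a \<Rightarrow> 'b"
  assumes inj_E: "inj E"
    and zero_mem [simp, intro]: "0 \<in> S"
    and diff_mem [simp, intro]: "\<lbrakk>x \<in> S; y \<in> S\<rbrakk> \<Longrightarrow> x - y \<in> S"
    and sup_mem [simp, intro]: "\<lbrakk>x \<in> S; y \<in> S\<rbrakk> \<Longrightarrow> sup x y \<in> S"
    and unit_mem [simp, intro]: "u \<in> S"
    and unit_nonneg [simp, intro]: "0 \<le> u"
    and unit_nonzero: "u \<noteq> 0"
    and dominated: "x \<in> S \<Longrightarrow> \<exists>n. x \<le> ((+) u ^^ n) 0"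
begin

abbreviation D where "D \<equiv> the_inv E"
abbreviation G where "G \<equiv> enc_ulgroup S u E"
abbreviation A where "A \<equiv> enc_mv S u E"
abbreviation \<Gamma> where "\<Gamma> \<equiv> S \<inter> {0..u}"
abbreviation oplus (infixl "\<boxplus>" 65) where "x \<boxplus> y \<equiv> inf (x + y) u"

lemma D_E [simp]: "D (E x) = x"
  by (rule the_inv_f_f[OF inj_E])

lemma E_eq_iff [simp]: "E x = E y \<longleftrightarrow> x = y"
  using inj_E by (auto dest: injD)

lemma E_mem_iff [simp]: "E x \<in> E ` X \<longleftrightarrow> x \<in> X"
  by auto

lemma uminus_mem [simp, intro]: "x \<in> S \<Longrightarrow> - x \<in> S"
  using diff_mem[OF zero_mem] by simp

lemma add_mem [simp, intro]: "\<lbrakk>x \<in> S; y \<in> S\<rbrakk> \<Longrightarrow> x + y \<in> S"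
  using diff_mem[of x "- y"] by simp

lemma inf_mem [simp, intro]: "\<lbrakk>x \<in> S; y \<in> S\<rbrakk> \<Longrightarrow> inf x y \<in> S"
  unfolding inf_eq_neg_sup by (intro uminus_mem sup_mem)

lemma multiple_nonneg [simp]: "0 \<le> ((+) u ^^ n) 0"
  by (induction n) auto

lemma G_simps [simp]:
  "carrier G = E ` S" "mult G x y = E (D x + D y)" "one G = E 0"
  "ul_le G x y \<longleftrightarrow> D x \<le> D y" "ul_unit G = E u"
  by (simp_all add: enc_ulgroup_def)

lemma A_simps [simp]:
  "carrier A = E ` \<Gamma>" "mult A x y = E (D x \<boxplus> D y)" "one A = E 0" "mv_neg A x = E (u - D x)"
  by (simp_all add: enc_mv_def)

lemma order_simps [simp]:
  "carrier (ul_order G) = E ` S" "le (ul_order G) x y \<longleftrightarrow> D x \<le> D y" "eq (ul_order G) = (=)"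
  by (simp_all add: ul_order_def)

lemma partial_order_G: "partial_order (ul_order G)"
  by unfold_locales auto

lemma least_G:
  assumes "x \<in> S" "y \<in> S"
  shows "least (ul_order G) (E (sup x y)) (Upper (ul_order G) {E x, E y})"
  using assms by (auto simp: least_def Upper_def)

lemma greatest_G:
  assumes "x \<in> S" "y \<in> S"
  shows "greatest (ul_order G) (E (inf x y)) (Lower (ul_order G) {E x, E y})"
  using assms by (auto simp: greatest_def Lower_def)

lemma join_G [simp]:
  assumes "x \<in> S" "y \<in> S"
  shows "E x \<squnion>\<^bsub>ul_order G\<^esub> E y = E (sup x y)"
  unfolding join_def Lattice.sup_def
  by (rule some_equality, rule least_G[OF assms])
    (rule partial_order.least_unique[OF partial_order_G _ least_G[OF assms]])

lemma meet_G [simp]: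
  assumes "x \<in> S" "y \<in> S"
  shows "E x \<sqinter>\<^bsub>ul_order G\<^esub> E y = E (inf x y)"
  unfolding meet_def Lattice.inf_def
  by (rule some_equality, rule greatest_G[OF assms])
    (rule partial_order.greatest_unique[OF partial_order_G _ greatest_G[OF assms]])

lemma lattice_G: "lattice (ul_order G)"
proof -
  interpret partial_order "ul_order G" by (rule partial_order_G)
  show ?thesis
    by unfold_locales (use least_G greatest_G in fastforce)+
qed

lemma comm_group_G: "comm_group G"
proof (rule comm_groupI)
  fix x assume "x \<in> carrier G"
  then obtain a where "a \<in> S" "x = E a" by auto
  then show "\<exists>y\<in>carrier G. y \<otimes>\<^bsub>G\<^esub> x = \<one>\<^bsub>G\<^esub>"
    by (intro bexI[of _ "E (- a)"]) auto
qed (auto simp: algebra_simps)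

lemma nat_pow_unit: "E u [^]\<^bsub>G\<^esub> n = E (((+) u ^^ n) 0)"
  by (induction n) (simp_all add: add.commute)

lemma unital_lgroup_G: "unital_lgroup G"
proof (intro unital_lgroup.intro unital_lgroup_axioms.intro)
  interpret comm_group G by (rule comm_group_G)
  fix x assume "x \<in> carrier G"
  then obtain n where "D x \<le> ((+) u ^^ n) 0" using dominated[of "D x"] by auto
  then have "ul_le G x (ul_unit G [^]\<^bsub>G\<^esub> (int n))"
    by (simp add: int_pow_int nat_pow_unit)
  then show "\<exists>n::int. ul_le G x (ul_unit G [^]\<^bsub>G\<^esub> n)" ..
next
  have "E u \<in> carrier G" "E u \<noteq> \<one>\<^bsub>G\<^esub>" using unit_nonzero by auto
  then show "carrier G \<noteq> {\<one>\<^bsub>G\<^esub>}" by blast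
qed (use comm_group_G lattice_G in auto)

section \<open>The truncated sum and the axioms of MV-algebras\<close>

lemma oplus_mem [simp, intro]: "\<lbrakk>x \<in> \<Gamma>; y \<in> \<Gamma>\<rbrakk> \<Longrightarrow> x \<boxplus> y \<in> \<Gamma>"
  by auto

text \<open>Both sides truncate \<open>x + y + z\<close> at \<open>u\<close>. Truncating an inner
  sum early changes nothing, because adding a nonnegative element to \<open>u\<close> gives at least
  \<open>u\<close>.\<close>

lemma oplus_assoc:
  assumes "0 \<le> x" "0 \<le> z"
  shows "x \<boxplus> y \<boxplus> z = x \<boxplus> (y \<boxplus> z)"
proof -
  have "x \<boxplus> y \<boxplus> z = inf (inf (x + y + z) (u + z)) u"
    by (simp add: add_inf_distrib_right)
  also have "\<dots> = inf (x + y + z) u"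
    using assms by (simp add: inf.absorb2 inf_assoc)
  also have "\<dots> = inf (inf (x + y + z) (x + u)) u"
    using assms by (simp add: inf.absorb2 inf_assoc)
  also have "\<dots> = x \<boxplus> (y \<boxplus> z)"
    by (simp add: add_inf_distrib_left add.assoc)
  finally show ?thesis .
qed

text \<open>The MV-difference is the positive part of the group difference. Adding \<open>y\<close>
  back gives the supremum, so the Lukasiewicz axiom becomes commutativity of
  \<open>sup\<close>.\<close>

lemma neg_oplus: "u - (u - x \<boxplus> y) = sup (x - y) 0"
  by (simp add: diff_inf_eq_sup add_sup_distrib_left algebra_simps)

lemma neg_oplus_oplus: "\<lbrakk>x \<le> u; y \<le> u\<rbrakk> \<Longrightarrow> (u - (u - x \<boxplus> y)) \<boxplus> y = sup x y"
  unfolding neg_oplus by (simp add: add_sup_distrib_right inf.absorb1)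

lemma mv_algebra_A: "mv_algebra A"
proof (intro mv_algebra.intro mv_algebra_axioms.intro comm_monoidI)
  fix x y z assume "x \<in> carrier A" "y \<in> carrier A" "z \<in> carrier A"
  then show "x \<otimes>\<^bsub>A\<^esub> y \<otimes>\<^bsub>A\<^esub> z = x \<otimes>\<^bsub>A\<^esub> (y \<otimes>\<^bsub>A\<^esub> z)"
    by (auto simp: oplus_assoc)
next
  fix x y assume "x \<in> carrier A" "y \<in> carrier A"
  then obtain a b where ab: "x = E a" "y = E b" "a \<le> u" "b \<le> u" by auto
  show "mv_neg A (mv_neg A x \<otimes>\<^bsub>A\<^esub> y) \<otimes>\<^bsub>A\<^esub> y = mv_neg A (mv_neg A y \<otimes>\<^bsub>A\<^esub> x) \<otimes>\<^bsub>A\<^esub> x"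
    unfolding ab(1,2) A_simps D_E neg_oplus_oplus[OF ab(3,4)] neg_oplus_oplus[OF ab(4,3)]
    by (simp add: sup_commute)
next
  have "E u \<in> carrier A" "E u \<noteq> \<one>\<^bsub>A\<^esub>" using unit_nonzero by auto
  then show "carrier A \<noteq> {\<one>\<^bsub>A\<^esub>}" by blast
qed (auto simp: inf.absorb1 inf.absorb2 add.commute)

end

section \<open>Unital homomorphisms\<close>

context encoded
begin

text \<open>Induction on the number of copies of \<open>u\<close> that dominate \<open>x\<close>:
  splitting off \<open>inf x u\<close>, an element of \<Gamma>, leaves the positive part of
  \<open>x - u\<close>, which one copy fewer dominates.\<close>

lemma gamma_induct [consumes 2, case_names zero step]:
  assumes "x \<in> S" "0 \<le> x"
    and zero: "P 0"
    and step: "\<And>x. \<lbrakk>x \<in> S; 0 \<le> x; P (x - inf x u)\<rbrakk> \<Longrightarrow> P x"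
  shows "P x"
proof -
  obtain n where "x \<le> ((+) u ^^ n) 0" using dominated \<open>x \<in> S\<close> by blast
  with assms(1,2) show ?thesis
  proof (induction n arbitrary: x)
    case 0
    then show ?case using zero by simp
  next
    case (Suc n)
    have "x - inf x u = sup 0 (x - u)"
      by (simp add: diff_inf_eq_sup add_sup_distrib_left)
    moreover have "x - u \<le> ((+) u ^^ n) 0"
      using Suc.prems(3) by (simp add: diff_le_eq add.commute[of "((+) u ^^ n) 0"])
    ultimately have "0 \<le> x - inf x u" "x - inf x u \<le> ((+) u ^^ n) 0"
      by simp_all
    then have "P (x - inf x u)" using Suc by auto
    then show ?case using step Suc.prems by blast
  qed
qed

text \<open>Nonnegative elements are finite sums of elements of \<Gamma>, and every element is the
  difference of its positive and negative parts.\<close>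

lemma gamma_generates:
  assumes "\<Gamma> \<subseteq> H" and diff: "\<And>x y. \<lbrakk>x \<in> H; y \<in> H\<rbrakk> \<Longrightarrow> x - y \<in> H"
  shows "S \<subseteq> H"
proof
  have zero: "0 \<in> H" using assms(1) by auto
  have add: "x + y \<in> H" if "x \<in> H" "y \<in> H" for x y
    using diff[OF that(1) diff[OF zero that(2)]] by simp
  have nonneg: "x \<in> H" if "x \<in> S" "0 \<le> x" for x
    using that
  proof (induction rule: gamma_induct)
    case (step x)
    then have "inf x u \<in> H" using assms(1) by auto
    then have "x - inf x u + inf x u \<in> H" using step by (intro add)
    then show ?case by (simp only: diff_add_cancel)
  qed (rule zero)
  fix x assume "x \<in> S"
  then have "sup x 0 - sup (- x) 0 \<in> H" by (intro diff nonneg) auto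
  moreover have "x = sup x 0 - sup (- x) 0"
    by (simp add: diff_sup_eq_inf flip: add_eq_inf_sup)
  ultimately show "x \<in> H" by simp
qed

end

text \<open>Zero, sums and infima are preserved as a consequence. \<open>F\<close> is a total
  function, but only its values on \<open>S\<close> are constrained.\<close>

definition unital_hom ::
  "'a::lattice_ab_group_add set \<Rightarrow> 'a \<Rightarrow> 'b::lattice_ab_group_add set \<Rightarrow> 'b \<Rightarrow> ('a \<Rightarrow> 'b) \<Rightarrow> bool" where
  "unital_hom S u S' u' F \<longleftrightarrow> F ` S \<subseteq> S' \<and> F u = u' \<and>
     (\<forall>x\<in>S. \<forall>y\<in>S. F (x - y) = F x - F y \<and> F (sup x y) = sup (F x) (F y))"

locale encoded_pair = dom: encoded S u E + cod: encoded S' u' E' for S u E S' u' E'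
begin

context
  fixes F
  assumes F: "unital_hom S u S' u' F"
begin

lemma hom_mem: "x \<in> S \<Longrightarrow> F x \<in> S'"
  using F by (auto simp: unital_hom_def)

lemma hom_unit: "F u = u'"
  using F by (auto simp: unital_hom_def)

lemma hom_diff: "\<lbrakk>x \<in> S; y \<in> S\<rbrakk> \<Longrightarrow> F (x - y) = F x - F y"
  using F by (auto simp: unital_hom_def)

lemma hom_sup: "\<lbrakk>x \<in> S; y \<in> S\<rbrakk> \<Longrightarrow> F (sup x y) = sup (F x) (F y)"
  using F by (auto simp: unital_hom_def)

lemma hom_zero: "F 0 = 0"
  using hom_diff[of 0 0] by simp

lemma hom_uminus: "x \<in> S \<Longrightarrow> F (- x) = - F x"
  using hom_diff[of 0 x] by (simp add: hom_zero)

lemma hom_add: "\<lbrakk>x \<in> S; y \<in> S\<rbrakk> \<Longrightarrow> F (x + y) = F x + F y"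
  using hom_diff[of x "- y"] by (simp add: hom_uminus)

lemma hom_inf: "\<lbrakk>x \<in> S; y \<in> S\<rbrakk> \<Longrightarrow> F (inf x y) = inf (F x) (F y)"
  unfolding inf_eq_neg_sup[of x] inf_eq_neg_sup[of "F x"]
  by (simp only: hom_uminus hom_sup dom.uminus_mem dom.sup_mem)

lemma hom_mono: "\<lbrakk>x \<in> S; y \<in> S; x \<le> y\<rbrakk> \<Longrightarrow> F x \<le> F y"
  using hom_sup[of x y] by (metis sup.absorb2 sup.orderI sup_commute)

lemma hom_gamma: "x \<in> dom.\<Gamma> \<Longrightarrow> F x \<in> cod.\<Gamma>"
  using hom_mono[of 0 x] hom_mono[of x u] hom_mem[of x] by (auto simp: hom_zero hom_unit)

lemma ul_hom_encode: "(\<lambda>x. E' (F (dom.D x))) \<in> ul_hom dom.G cod.G"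
  using hom_mem by (auto simp: ul_hom_def hom_def hom_unit hom_add hom_sup hom_inf)

lemma mv_hom_encode: "(\<lambda>x. E' (F (dom.D x))) \<in> mv_hom dom.A cod.A"
  using hom_gamma
  by (auto simp: mv_hom_def hom_def hom_zero hom_unit hom_add hom_inf hom_diff)

lemma hom_surj_gamma:
  assumes "F ` S = S'"
  shows "F ` dom.\<Gamma> = cod.\<Gamma>"
proof (rule antisym)
  show "F ` dom.\<Gamma> \<subseteq> cod.\<Gamma>" using hom_gamma by blast
  show "cod.\<Gamma> \<subseteq> F ` dom.\<Gamma>"
  proof
    fix y assume y: "y \<in> cod.\<Gamma>"
    then obtain x where x: "x \<in> S" "y = F x" using assms by auto
    \<comment> \<open>The preimage \<open>x\<close> may lie outside \<Gamma>; clamping it to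
      \<open>[0, u]\<close> keeps its image, which already lies in \<open>[0, u']\<close>.\<close>
    then have "F (inf (sup x 0) u) = y"
      using y by (simp add: hom_inf hom_sup hom_zero hom_unit sup.absorb1 inf.absorb1)
    then show "y \<in> F ` dom.\<Gamma>"
      using x by (intro image_eqI[of _ _ "inf (sup x 0) u"]) auto
  qed
qed

lemma hom_inj:
  assumes "inj_on F dom.\<Gamma>"
  shows "inj_on F S"
proof -
  have pos: "F x = 0 \<longrightarrow> x = 0" if "x \<in> S" "0 \<le> x" for x
    using that
  proof (induction rule: dom.gamma_induct)
    case (step x)
    show ?case
    proof
      assume "F x = 0"
      then have "F (inf x u) = F 0"
        using step cod.unit_nonneg by (simp add: hom_inf hom_zero hom_unit inf.absorb1)
      then have "inf x u = 0"
        using step by (intro inj_onD[OF assms]) auto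
      \<comment> \<open>With \<open>inf x u = 0\<close> the induction hypothesis, which speaks of
        \<open>x - inf x u\<close>, speaks of \<open>x\<close> itself.\<close>
      then show "x = 0" using step \<open>F x = 0\<close> by simp
    qed
  qed simp
  show ?thesis
  proof (rule inj_onI)
    fix x y assume xy: "x \<in> S" "y \<in> S" "F x = F y"
    then have "sup (x - y) 0 = 0" "sup (y - x) 0 = 0"
      by (intro pos[rule_format]; simp add: hom_sup hom_diff hom_zero)+
    then show "x = y" by (simp add: sup.absorb_iff2[symmetric] antisym)
  qed
qed

end

end

section \<open>Hopficity and generation\<close>

context encoded
begin

lemma encoded_pair_self: "encoded_pair S u E S u E"
  by (simp add: encoded_pair_def encoded_axioms)

lemma unital_hom_decode:
  assumes f: "f \<in> ul_hom G G"
  shows "unital_hom S u S u (\<lambda>x. D (f (E x)))"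
proof -
  have mem: "\<exists>b\<in>S. f (E a) = E b" if "a \<in> S" for a
    using f that by (fastforce simp: ul_hom_def hom_def)
  have diff: "D (f (E (x - y))) = D (f (E x)) - D (f (E y))" if "x \<in> S" "y \<in> S" for x y
  proof -
    have "f (E (x - y) \<otimes>\<^bsub>G\<^esub> E y) = f (E (x - y)) \<otimes>\<^bsub>G\<^esub> f (E y)"
      using f that by (intro hom_mult) (auto simp: ul_hom_def)
    moreover obtain a where "f (E x) = E a" using mem \<open>x \<in> S\<close> by blast
    ultimately show ?thesis by simp
  qed
  have sup: "D (f (E (sup x y))) = sup (D (f (E x))) (D (f (E y)))" if "x \<in> S" "y \<in> S" for x y
  proof -
    obtain a b where ab: "a \<in> S" "b \<in> S" "f (E x) = E a" "f (E y) = E b"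
      using mem \<open>x \<in> S\<close> \<open>y \<in> S\<close> by meson
    have "f (E x \<squnion>\<^bsub>ul_order G\<^esub> E y) = f (E x) \<squnion>\<^bsub>ul_order G\<^esub> f (E y)"
      using f that by (auto simp: ul_hom_def)
    then show ?thesis using that ab by simp
  qed
  have "f (E u) = E u" using f by (simp add: ul_hom_def)
  then show ?thesis
    using diff sup mem by (fastforce simp: unital_hom_def)
qed

text \<open>MV-endomorphisms and restrictions of unital endomorphisms of \<open>S\<close> both take
  this form, so one argument serves both kinds of algebra.\<close>

definition gamma_endo :: "('a \<Rightarrow> 'a) \<Rightarrow> bool" where
  "gamma_endo F \<longleftrightarrow> F ` \<Gamma> \<subseteq> \<Gamma> \<and> (\<forall>x\<in>\<Gamma>. F (u - x) = u - F x) \<and>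
     (\<forall>x\<in>\<Gamma>. \<forall>y\<in>\<Gamma>. F (x \<boxplus> y) = F x \<boxplus> F y) \<and> F 0 = 0"

lemma gamma_endo_decode:
  assumes f: "f \<in> mv_hom A A"
  shows "gamma_endo (\<lambda>x. D (f (E x)))"
proof -
  have mem: "\<exists>b\<in>\<Gamma>. f (E a) = E b" if "a \<in> \<Gamma>" for a
  proof -
    have "f (E a) \<in> E ` \<Gamma>" using f that by (auto simp: mv_hom_def hom_def)
    then show ?thesis by blast
  qed
  have "D (f (E (x \<boxplus> y))) = D (f (E x)) \<boxplus> D (f (E y))" if "x \<in> \<Gamma>" "y \<in> \<Gamma>" for x y
  proof -
    have "f (E x \<otimes>\<^bsub>A\<^esub> E y) = f (E x) \<otimes>\<^bsub>A\<^esub> f (E y)"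
      using f that by (intro hom_mult) (auto simp: mv_hom_def)
    then show ?thesis by simp
  qed
  moreover have "D (f (E (u - x))) = u - D (f (E x))" if "x \<in> \<Gamma>" for x
  proof -
    have "f (mv_neg A (E x)) = mv_neg A (f (E x))"
      using f that by (auto simp: mv_hom_def)
    then show ?thesis by simp
  qed
  moreover have "f (E 0) = E 0" using f by (simp add: mv_hom_def)
  moreover have "D (f (E x)) \<in> \<Gamma>" if "x \<in> \<Gamma>" for x using mem[OF that] by fastforce
  ultimately show ?thesis
    unfolding gamma_endo_def by (intro conjI ballI image_subsetI) simp_all
qed

text \<open>The MV-operations see only truncated sums, so it must be shown that
  \<open>F x + F y\<close> is not truncated either. The condition \<open>x + y \<le> u\<close> is
  expressible as \<open>(u - x) \<boxplus> (u - y) = u\<close>, an equation that \<open>F\<close>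
  preserves.\<close>

lemma gamma_endo_add:
  assumes F: "gamma_endo F" and x: "x \<in> \<Gamma>" and y: "y \<in> \<Gamma>" and le: "x + y \<le> u"
  shows "F (x + y) = F x + F y"
proof -
  have neg: "u - x \<in> \<Gamma>" "u - y \<in> \<Gamma>" "0 \<in> \<Gamma>" using x y by auto
  have F0: "F 0 = 0" using F by (simp add: gamma_endo_def)
  have "F (u - 0) = u - F 0" using F neg(3) unfolding gamma_endo_def by blast
  then have Fu: "F u = u" by (simp add: F0)
  have "(u - x) \<boxplus> (u - y) = u"
  proof (rule inf.absorb2)
    have "u + (x + y) \<le> u + u" using le by (rule add_left_mono)
    then show "u \<le> (u - x) + (u - y)" by (simp add: algebra_simps)
  qed
  then have "u = F ((u - x) \<boxplus> (u - y))" using Fu by simp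
  also have "\<dots> = (u - F x) \<boxplus> (u - F y)"
    using F x y neg unfolding gamma_endo_def by simp
  finally have "u \<le> (u - F x) + (u - F y)" by (metis inf.cobounded1)
  then have "u + (F x + F y) \<le> u + u" by (simp add: algebra_simps)
  then have "F x + F y \<le> u" by (simp only: add_le_cancel_left)
  moreover have "F (x \<boxplus> y) = F x \<boxplus> F y"
    using F x y unfolding gamma_endo_def by blast
  ultimately show ?thesis using le by (simp add: inf.absorb1)
qed

lemma gamma_endo_unital_hom:
  assumes "unital_hom S u S u F"
  shows "gamma_endo F"
proof -
  interpret encoded_pair S u E S u E by (rule encoded_pair_self)
  show ?thesis
    unfolding gamma_endo_def using hom_gamma[OF assms]
    by (simp add: image_subset_iff hom_diff[OF assms] hom_unit[OF assms] hom_zero[OF assms]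
        hom_inf[OF assms] hom_add[OF assms])
qed

text \<open>A surjective unital endomorphism of \<open>S\<close> restricts to a surjection of
  \<Gamma>, and injectivity on \<Gamma> propagates back to \<open>S\<close>.\<close>

lemma hopfianI:
  assumes inj: "\<And>F. \<lbrakk>gamma_endo F; F ` \<Gamma> = \<Gamma>\<rbrakk> \<Longrightarrow> inj_on F \<Gamma>"
  shows "mv_hopfian A" "ul_hopfian G"
proof -
  show "mv_hopfian A"
    unfolding mv_hopfian_def
  proof (intro ballI impI)
    fix f assume f: "f \<in> mv_hom A A" and onto: "f ` carrier A = carrier A"
    let ?F = "\<lambda>x. D (f (E x))"
    have "D ` f ` E ` \<Gamma> = D ` E ` \<Gamma>" using onto by (simp del: image_Int)
    then have "?F ` \<Gamma> = \<Gamma>" by (simp add: image_image)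
    then have "inj_on ?F \<Gamma>" by (intro inj gamma_endo_decode f)
    then have "inj_on f (carrier A)" by (force simp: inj_on_def)
    then show "bij_betw f (carrier A) (carrier A)" using onto by (simp add: bij_betw_def)
  qed
  show "ul_hopfian G"
    unfolding ul_hopfian_def
  proof (intro ballI impI)
    fix f assume f: "f \<in> ul_hom G G" and onto: "f ` carrier G = carrier G"
    let ?F = "\<lambda>x. D (f (E x))"
    interpret encoded_pair S u E S u E by (rule encoded_pair_self)
    have F: "unital_hom S u S u ?F" by (rule unital_hom_decode[OF f])
    have "D ` f ` E ` S = D ` E ` S" using onto by simp
    then have "?F ` S = S" by (simp add: image_image)
    then have "inj_on ?F \<Gamma>"
      by (intro inj gamma_endo_unital_hom F hom_surj_gamma[OF F])
    then have "inj_on ?F S" by (rule hom_inj[OF F])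
    then have "inj_on f (carrier G)" by (force simp: inj_on_def)
    then show "bij_betw f (carrier G) (carrier G)" using onto by (simp add: bij_betw_def)
  qed
qed

lemma not_hopfianI:
  assumes F: "unital_hom S u S u F" and onto: "F ` S = S" and not_inj: "\<not> inj_on F S"
  shows "\<not> mv_hopfian A" "\<not> ul_hopfian G"
proof -
  interpret encoded_pair S u E S u E by (rule encoded_pair_self)
  let ?f = "\<lambda>x. E (F (D x))"
  have img: "?f ` E ` X = E ` F ` X" for X by (simp add: image_image)
  have inj: "inj_on F X" if "inj_on ?f (E ` X)" for X
    using that by (simp add: inj_on_def)
  have "\<not> inj_on F \<Gamma>" using hom_inj[OF F] not_inj by blast
  then have "\<not> bij_betw ?f (carrier A) (carrier A)"
    using inj by (auto simp: bij_betw_def)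
  moreover have "?f ` carrier A = carrier A"
    by (simp only: A_simps img hom_surj_gamma[OF F onto])
  ultimately show "\<not> mv_hopfian A"
    using mv_hom_encode[OF F] unfolding mv_hopfian_def by blast
  have "\<not> bij_betw ?f (carrier G) (carrier G)"
    using inj not_inj by (auto simp: bij_betw_def)
  moreover have "?f ` carrier G = carrier G"
    by (simp only: G_simps img onto)
  ultimately show "\<not> ul_hopfian G"
    using ul_hom_encode[OF F] unfolding ul_hopfian_def by blast
qed

section \<open>Subalgebras and finite generation\<close>

lemma mv_subalgebra_encode:
  assumes "B \<subseteq> \<Gamma>" "0 \<in> B" "\<And>x y. \<lbrakk>x \<in> B; y \<in> B\<rbrakk> \<Longrightarrow> x \<boxplus> y \<in> B" "\<And>x. x \<in> B \<Longrightarrow> u - x \<in> B"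
  shows "mv_subalgebra A (E ` B)"
proof -
  have "x \<in> \<Gamma>" if "x \<in> B" for x using that assms(1) by blast
  then show ?thesis
    using assms unfolding mv_subalgebra_def by (auto intro!: submonoid.intro)
qed

lemma ul_subalgebra_encode:
  assumes "H \<subseteq> S" "u \<in> H" "\<And>x y. \<lbrakk>x \<in> H; y \<in> H\<rbrakk> \<Longrightarrow> x - y \<in> H"
    "\<And>x y. \<lbrakk>x \<in> H; y \<in> H\<rbrakk> \<Longrightarrow> sup x y \<in> H"
  shows "ul_subalgebra G (E ` H)"
proof -
  have zero: "0 \<in> H" using assms(3)[OF assms(2,2)] by simp
  have uminus: "- x \<in> H" if "x \<in> H" for x using assms(3)[OF zero that] by simp
  have inf: "inf x y \<in> H" if "x \<in> H" "y \<in> H" for x y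
    unfolding inf_eq_neg_sup by (intro uminus assms(4) that)
  have add: "x + y \<in> H" if "x \<in> H" "y \<in> H" for x y
    using assms(3)[OF that(1) uminus[OF that(2)]] by simp
  have subset: "x \<in> S" if "x \<in> H" for x using that assms(1) by blast
  interpret comm_group G by (rule comm_group_G)
  have "inv\<^bsub>G\<^esub> (E x) = E (- x)" if "x \<in> S" for x
    using that by (intro inv_equality) auto
  then have "subgroup (E ` H) G"
    using zero uminus add assms(1) subset by (intro subgroupI) auto
  then show ?thesis
    using assms(2,4) inf subset by (auto simp: ul_subalgebra_def)
qed

lemma finitely_generatedI:
  assumes "finite X" "X \<subseteq> \<Gamma>"
    and gen: "\<And>B. \<lbrakk>X \<subseteq> B; B \<subseteq> \<Gamma>; 0 \<in> B; \<And>x y. \<lbrakk>x \<in> B; y \<in> B\<rbrakk> \<Longrightarrow> x \<boxplus> y \<in> B;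
      \<And>x. x \<in> B \<Longrightarrow> u - x \<in> B\<rbrakk> \<Longrightarrow> \<Gamma> \<subseteq> B"
  shows "mv_finitely_generated A" "ul_finitely_generated G"
proof -
  have "E ` \<Gamma> \<subseteq> T" if T: "mv_subalgebra A T" "E ` X \<subseteq> T" for T
  proof -
    interpret submonoid T A using T(1) by (simp add: mv_subalgebra_def)
    let ?B = "{x \<in> \<Gamma>. E x \<in> T}"
    have "\<Gamma> \<subseteq> ?B"
    proof (rule gen)
      fix x y assume "x \<in> ?B" "y \<in> ?B"
      then have "E x \<otimes>\<^bsub>A\<^esub> E y \<in> T" by (intro m_closed) auto
      then show "x \<boxplus> y \<in> ?B" using \<open>x \<in> ?B\<close> \<open>y \<in> ?B\<close> by auto
    next
      fix x assume "x \<in> ?B"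
      moreover have "mv_neg A (E x) \<in> T" using T(1) \<open>x \<in> ?B\<close> by (auto simp: mv_subalgebra_def)
      ultimately show "u - x \<in> ?B" by auto
    qed (use assms(2) T one_closed in auto)
    then show ?thesis by blast
  qed
  moreover have "mv_subalgebra A (E ` \<Gamma>)" by (rule mv_subalgebra_encode) auto
  ultimately have "mv_subalgebra A hull (E ` X) = carrier A"
    using assms(2) unfolding hull_def A_simps by blast
  then show "mv_finitely_generated A"
    using assms(1,2) unfolding mv_finitely_generated_def A_simps
    by (intro exI[of _ "E ` X"]) blast
  have "E ` S \<subseteq> T" if T: "ul_subalgebra G T" "E ` X \<subseteq> T" for T
  proof -
    interpret comm_group G by (rule comm_group_G)
    have sub: "subgroup T G" using T(1) by (simp add: ul_subalgebra_def)
    let ?H = "{x \<in> S. E x \<in> T}"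
    have unit: "u \<in> ?H" using T(1) by (simp add: ul_subalgebra_def)
    have zero: "0 \<in> ?H" using subgroup.one_closed[OF sub] by simp
    have diff: "x - y \<in> ?H" if "x \<in> ?H" "y \<in> ?H" for x y
    proof -
      have "E x \<otimes>\<^bsub>G\<^esub> inv\<^bsub>G\<^esub> (E y) \<in> T"
        using that subgroup.m_closed[OF sub] subgroup.m_inv_closed[OF sub] by blast
      moreover have "inv\<^bsub>G\<^esub> (E y) = E (- y)"
        using that by (intro inv_equality) auto
      ultimately show ?thesis using that by auto
    qed
    have add: "x + y \<in> ?H" if "x \<in> ?H" "y \<in> ?H" for x y
      using diff[OF that(1) diff[OF zero that(2)]] by simp
    have inf: "inf x y \<in> ?H" if "x \<in> ?H" "y \<in> ?H" for x y
    proof -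
      have "E x \<sqinter>\<^bsub>ul_order G\<^esub> E y \<in> T" using T(1) that unfolding ul_subalgebra_def by blast
      then show ?thesis using that meet_G[of x y] by auto
    qed
    \<comment> \<open>The trace of a unital l-subgroup on \<Gamma> is an MV-subalgebra, so the
      generation hypothesis applies to it; \<Gamma> in turn generates \<open>S\<close> as a
      group.\<close>
    have "\<Gamma> \<subseteq> ?H \<inter> \<Gamma>"
    proof (rule gen)
      show "u - x \<in> ?H \<inter> \<Gamma>" if "x \<in> ?H \<inter> \<Gamma>" for x
        using that diff[OF unit, of x] by auto
      show "x \<boxplus> y \<in> ?H \<inter> \<Gamma>" if "x \<in> ?H \<inter> \<Gamma>" "y \<in> ?H \<inter> \<Gamma>" for x y
        using inf[OF add unit, of x y] that oplus_mem[of x y] by blast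
    qed (use assms(2) T zero in auto)
    then have "S \<subseteq> ?H" by (intro gamma_generates diff) auto
    then show ?thesis by blast
  qed
  moreover have "ul_subalgebra G (E ` S)" by (rule ul_subalgebra_encode) auto
  ultimately have "ul_subalgebra G hull (E ` X) = carrier G"
    using assms(2) unfolding hull_def G_simps by blast
  then show "ul_finitely_generated G"
    using assms(1,2) unfolding ul_finitely_generated_def G_simps
    by (intro exI[of _ "E ` X"]) blast
qed

lemma finite_subset_chain:
  fixes C :: "nat \<Rightarrow> 'c set"
  assumes "finite X" "X \<subseteq> (\<Union>n. C n)" "\<And>m n. m \<le> n \<Longrightarrow> C m \<subseteq> C n"
  shows "\<exists>n. X \<subseteq> C n"
  using assms(1,2)
proof (induction X rule: finite_induct)
  case (insert x X)
  then obtain m n where "X \<subseteq> C n" "x \<in> C m" by blast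
  then have "insert x X \<subseteq> C (max m n)"
    using assms(3)[of m "max m n"] assms(3)[of n "max m n"] by auto
  then show ?case ..
qed simp

text \<open>A finite set lies in one stage of an increasing chain of proper subalgebras. The traces
  on \<Gamma> are proper too, since a stage containing \<Gamma> would be all of
  \<open>S\<close>.\<close>

lemma not_finitely_generatedI:
  fixes C :: "nat \<Rightarrow> 'a set"
  assumes mono: "\<And>m n. m \<le> n \<Longrightarrow> C m \<subseteq> C n" and union: "S = (\<Union>n. C n)" and proper: "\<And>n. C n \<noteq> S"
    and unit: "\<And>n. u \<in> C n"
    and diff: "\<And>n x y. \<lbrakk>x \<in> C n; y \<in> C n\<rbrakk> \<Longrightarrow> x - y \<in> C n"
    and sup: "\<And>n x y. \<lbrakk>x \<in> C n; y \<in> C n\<rbrakk> \<Longrightarrow> sup x y \<in> C n"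
  shows "\<not> mv_finitely_generated A" "\<not> ul_finitely_generated G"
proof -
  have "ul_subalgebra G hull X \<noteq> E ` S" if X: "finite X" "X \<subseteq> E ` S" for X
  proof -
    have "X \<subseteq> (\<Union>n. E ` C n)" using X(2) union by blast
    then obtain n where "X \<subseteq> E ` C n"
      using finite_subset_chain[OF X(1), of "\<lambda>n. E ` C n"] mono by (meson image_mono)
    moreover have "ul_subalgebra G (E ` C n)"
      using union by (intro ul_subalgebra_encode unit diff sup) auto
    ultimately have "ul_subalgebra G hull X \<subseteq> E ` C n" by (rule hull_minimal)
    moreover have "\<not> E ` S \<subseteq> E ` C n"
      using proper union by (simp add: inj_image_subset_iff[OF inj_E]) blast
    ultimately show ?thesis by blast
  qed
  then show "\<not> ul_finitely_generated G"
    by (auto simp: ul_finitely_generated_def)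
  have "mv_subalgebra A hull X \<noteq> E ` \<Gamma>" if X: "finite X" "X \<subseteq> E ` \<Gamma>" for X
  proof -
    have "X \<subseteq> (\<Union>n. E ` (C n \<inter> \<Gamma>))"
    proof
      fix y assume "y \<in> X"
      then obtain x where x: "x \<in> \<Gamma>" "y = E x" using X(2) by blast
      then obtain n where "x \<in> C n" using union by auto
      then show "y \<in> (\<Union>n. E ` (C n \<inter> \<Gamma>))" using x by blast
    qed
    moreover have "E ` (C m \<inter> \<Gamma>) \<subseteq> E ` (C n \<inter> \<Gamma>)" if "m \<le> n" for m n
      using mono[OF that] by blast
    ultimately obtain n where n: "X \<subseteq> E ` (C n \<inter> \<Gamma>)"
      using finite_subset_chain[OF X(1), of "\<lambda>n. E ` (C n \<inter> \<Gamma>)"] by blast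
    have zero: "0 \<in> C n" using diff[OF unit unit, of n] by simp
    have uminus: "- x \<in> C n" if "x \<in> C n" for x using diff[OF zero that] by simp
    have inf: "inf x y \<in> C n" if "x \<in> C n" "y \<in> C n" for x y
      unfolding inf_eq_neg_sup by (intro uminus sup that)
    have add: "x + y \<in> C n" if "x \<in> C n" "y \<in> C n" for x y
      using diff[OF that(1) uminus[OF that(2)]] by simp
    have "mv_subalgebra A (E ` (C n \<inter> \<Gamma>))"
    proof (rule mv_subalgebra_encode)
      show "x \<boxplus> y \<in> C n \<inter> \<Gamma>" if "x \<in> C n \<inter> \<Gamma>" "y \<in> C n \<inter> \<Gamma>" for x y
        using inf[OF add unit, of x y] that oplus_mem[of x y] by blast
      show "u - x \<in> C n \<inter> \<Gamma>" if "x \<in> C n \<inter> \<Gamma>" for x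
        using that diff[OF unit, of x] by auto
    qed (use zero in auto)
    then have "mv_subalgebra A hull X \<subseteq> E ` (C n \<inter> \<Gamma>)" using n by (intro hull_minimal)
    moreover have "\<not> \<Gamma> \<subseteq> C n"
      using gamma_generates[OF _ diff[of _ n]] proper[of n] union by auto
    then have "\<not> E ` \<Gamma> \<subseteq> E ` (C n \<inter> \<Gamma>)"
      by (simp only: inj_image_subset_iff[OF inj_E]) blast
    ultimately show ?thesis by blast
  qed
  then show "\<not> mv_finitely_generated A"
    unfolding mv_finitely_generated_def A_simps by blast
qed

end

section \<open>Ideals and spectral topologies\<close>

text \<open>For ideals the conclusion says that the basic open set of \<open>e\<close> is
  \<open>{M}\<close>, so \<open>M\<close> is an isolated point of the maximal spectral
  space.\<close>

lemma maximal_members_pointI: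
  assumes "M \<in> \<I>" "\<And>J. \<lbrakk>J \<in> \<I>; e \<notin> J\<rbrakk> \<Longrightarrow> J \<subseteq> M" "\<And>J. \<lbrakk>J \<in> \<I>; M \<subseteq> J\<rbrakk> \<Longrightarrow> e \<notin> J"
  shows "M \<in> maximal_members \<I>" "{m \<in> maximal_members \<I>. e \<notin> m} = {M}"
proof -
  show "M \<in> maximal_members \<I>"
    using assms unfolding maximal_members_def by blast
  then show "{m \<in> maximal_members \<I>. e \<notin> m} = {M}"
    using assms unfolding maximal_members_def by blast
qed

lemma maximal_members_eqI:
  "\<lbrakk>m \<in> maximal_members \<I>; M \<in> \<I>; m \<subseteq> M\<rbrakk> \<Longrightarrow> m = M"
  by (auto simp: maximal_members_def)

lemma hull_kernel_isolated_not_dense: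
  assumes "e \<in> X" "{m \<in> \<M>. e \<notin> m} = {M}" "M \<notin> F"
  shows "hull_kernel_topology X \<M> closure_of F \<noteq> topspace (hull_kernel_topology X \<M>)"
proof -
  have op: "openin (hull_kernel_topology X \<M>) {M}"
    unfolding hull_kernel_topology_def assms(2)[symmetric]
    by (rule topology_generated_by_Basis) (use assms(1) in blast)
  then have "M \<in> topspace (hull_kernel_topology X \<M>)"
    using openin_subset by blast
  moreover have "M \<notin> hull_kernel_topology X \<M> closure_of F"
    using op assms(3) by (auto simp: in_closure_of)
  ultimately show ?thesis by blast
qed

lemma hull_kernel_closure_of_all:
  "hull_kernel_topology X \<M> closure_of \<M> = topspace (hull_kernel_topology X \<M>)"
proof (rule antisym)
  have "topspace (hull_kernel_topology X \<M>) \<subseteq> \<M>"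
    unfolding hull_kernel_topology_def topology_generated_by_topspace by blast
  then show "topspace (hull_kernel_topology X \<M>) \<subseteq> hull_kernel_topology X \<M> closure_of \<M>"
    using closure_of_subset_Int[of "hull_kernel_topology X \<M>" \<M>] by blast
qed (rule closure_of_subset_topspace)

lemma funpow_add_one: "((+) 1 ^^ n) 0 = real n"
  by (induction n) auto

lemma encoded_real: "inj R \<Longrightarrow> encoded UNIV (1::real) R"
proof (unfold_locales, goal_cases)
  case (8 x)
  then show ?case using real_arch_simple[of x] by (simp add: funpow_add_one)
qed auto

section \<open>Traces of ideals on the unit interval\<close>

context encoded
begin

text \<open>The order-theoretic form of a proper MV-ideal. Ideals of both kinds of algebra leave
  such a trace on \<Gamma> and can thus be treated together.\<close>

definition gamma_ideal :: "'a set \<Rightarrow> bool" where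
  "gamma_ideal J \<longleftrightarrow> J \<subseteq> \<Gamma> \<and> 0 \<in> J \<and> u \<notin> J \<and> (\<forall>x\<in>J. \<forall>y\<in>J. x \<boxplus> y \<in> J) \<and>
     (\<forall>x\<in>J. \<forall>y\<in>\<Gamma>. y \<le> x \<longrightarrow> y \<in> J)"

lemma mv_ideal_decode:
  assumes "mv_ideal A K"
  obtains J where "gamma_ideal J" "K = E ` J"
proof -
  obtain B :: "'b set mv" and f where B: "mv_algebra B" and f: "f \<in> mv_hom A B"
    and K: "K = kernel A B f" and proper: "K \<noteq> carrier A"
    using assms unfolding mv_ideal_def by blast
  interpret B: mv_algebra B by (rule B)
  define J where "J = {x \<in> \<Gamma>. f (E x) = \<one>\<^bsub>B\<^esub>}"
  have KJ: "K = E ` J" unfolding K J_def kernel_def by auto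
  have mult: "f (E (x \<boxplus> y)) = f (E x) \<otimes>\<^bsub>B\<^esub> f (E y)" if "x \<in> \<Gamma>" "y \<in> \<Gamma>" for x y
  proof -
    have "f (E x \<otimes>\<^bsub>A\<^esub> E y) = f (E x) \<otimes>\<^bsub>B\<^esub> f (E y)"
      using f that by (intro hom_mult) (auto simp: mv_hom_def)
    then show ?thesis by simp
  qed
  have neg: "f (E (u - x)) = mv_neg B (f (E x))" if "x \<in> \<Gamma>" for x
  proof -
    have "f (mv_neg A (E x)) = mv_neg B (f (E x))" using f that by (auto simp: mv_hom_def)
    then show ?thesis by simp
  qed
  have zero: "f (E 0) = \<one>\<^bsub>B\<^esub>" using f by (simp add: mv_hom_def)
  have mem: "f (E x) \<in> carrier B" if "x \<in> \<Gamma>" for x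
    using f that by (auto simp: mv_hom_def hom_def)
  have down: "y \<in> J" if x: "x \<in> J" and y: "y \<in> \<Gamma>" "y \<le> x" for x y
  proof -
    have uy: "u - y \<in> \<Gamma>" and x': "x \<in> \<Gamma>" using x y(1) by (auto simp: J_def)
    have "u \<le> u - y + x" using y(2) by (simp add: algebra_simps)
    \<comment> \<open>\<open>y \<le> x\<close> is turned into an equation that a homomorphism
      transports. The top element is written \<open>u - 0\<close> so that its image is computed as
      the negation of zero.\<close>
    then have "(u - y) \<boxplus> x = u - 0" by (simp add: inf.absorb2)
    then have "f (E (u - 0)) = mv_neg B (f (E y)) \<otimes>\<^bsub>B\<^esub> f (E x)"
      using mult[OF uy x'] neg[OF y(1)] by simp
    also have "\<dots> = mv_neg B (f (E y))"
      using x B.neg_closed[OF mem[OF y(1)]] by (simp add: J_def)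
    finally have "mv_neg B \<one>\<^bsub>B\<^esub> = mv_neg B (f (E y))"
      using neg[of 0] zero by simp
    then have "f (E y) = \<one>\<^bsub>B\<^esub>" using B.neg_neg mem[OF y(1)] by (metis B.one_closed)
    then show ?thesis using y by (simp add: J_def)
  qed
  have "u \<notin> J"
  proof
    assume "u \<in> J"
    then have "\<Gamma> \<subseteq> J" using down by auto
    then have "J = \<Gamma>" by (auto simp: J_def)
    then show False using proper KJ by simp
  qed
  moreover have "x \<boxplus> y \<in> J" if "x \<in> J" "y \<in> J" for x y
  proof -
    have "x \<in> \<Gamma>" "y \<in> \<Gamma>" using that by (auto simp: J_def)
    then show ?thesis using mult[of x y] that by (auto simp: J_def)
  qed
  moreover have "0 \<in> J" using zero by (simp add: J_def)
  ultimately have "gamma_ideal J"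
    unfolding gamma_ideal_def using down by (auto simp: J_def)
  with KJ show thesis using that by blast
qed

text \<open>The last conclusion replaces an element of \<open>K\<close> by its truncated absolute
  value, which lies in \<Gamma> and on which a state vanishes only if it vanishes on the element
  itself.\<close>

lemma ul_ideal_decode:
  assumes "ul_ideal G K"
  obtains J where "gamma_ideal J" "K \<subseteq> E ` S" "J = {x \<in> \<Gamma>. E x \<in> K}" "E 0 \<in> K"
    "\<And>x. \<lbrakk>x \<in> S; E x \<in> K\<rbrakk> \<Longrightarrow> inf (sup x (- x)) u \<in> J"
proof -
  obtain H :: "'b set ulgroup" and f where H: "unital_lgroup H" and f: "f \<in> ul_hom G H"
    and K: "K = kernel G H f" and proper: "K \<noteq> carrier G"
    using assms unfolding ul_ideal_def by blast
  interpret H: unital_lgroup H by (rule H)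
  interpret L: lattice "ul_order H" by (rule H.lattice_order)
  interpret G: comm_group G by (rule comm_group_G)
  interpret f: group_hom G H f
    using f by unfold_locales (simp add: ul_hom_def)
  define N where "N = {x \<in> S. f (E x) = \<one>\<^bsub>H\<^esub>}"
  have KN: "K = E ` N" unfolding K N_def kernel_def by auto
  have mem: "f (E x) \<in> carrier (ul_order H)" if "x \<in> S" for x
    using f.hom_closed[of "E x"] that by (simp add: ul_order_def)
  have one: "\<one>\<^bsub>H\<^esub> \<in> carrier (ul_order H)" by (simp add: ul_order_def)
  have zero: "f (E 0) = \<one>\<^bsub>H\<^esub>" using f.hom_one by simp
  have mult: "f (E (x + y)) = f (E x) \<otimes>\<^bsub>H\<^esub> f (E y)" if "x \<in> S" "y \<in> S" for x y
  proof -
    have "f (E x \<otimes>\<^bsub>G\<^esub> E y) = f (E x) \<otimes>\<^bsub>H\<^esub> f (E y)"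
      by (rule f.hom_mult) (use that in simp_all)
    then show ?thesis by simp
  qed
  have add: "x + y \<in> N" if "x \<in> N" "y \<in> N" for x y
    using that mult[of x y] unfolding N_def by simp
  have uminus: "- x \<in> N" if "x \<in> N" for x
  proof -
    have x: "x \<in> S" "- x \<in> S" "f (E x) = \<one>\<^bsub>H\<^esub>" using that by (auto simp: N_def)
    have "\<one>\<^bsub>H\<^esub> = f (E (- x))"
      using mult[OF x(2,1)] mem[OF x(2)] by (simp add: zero x(3) ul_order_def)
    then show ?thesis using x(2) by (simp add: N_def)
  qed
  have sup: "f (E (sup x y)) = f (E x) \<squnion>\<^bsub>ul_order H\<^esub> f (E y)" if "x \<in> S" "y \<in> S" for x y
  proof -
    have "f (E x \<squnion>\<^bsub>ul_order G\<^esub> E y) = f (E x) \<squnion>\<^bsub>ul_order H\<^esub> f (E y)"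
      using f that by (auto simp: ul_hom_def)
    then show ?thesis using join_G[OF that] by simp
  qed
  have inf: "f (E (inf x y)) = f (E x) \<sqinter>\<^bsub>ul_order H\<^esub> f (E y)" if "x \<in> S" "y \<in> S" for x y
  proof -
    have "f (E x \<sqinter>\<^bsub>ul_order G\<^esub> E y) = f (E x) \<sqinter>\<^bsub>ul_order H\<^esub> f (E y)"
      using f that by (auto simp: ul_hom_def)
    then show ?thesis using meet_G[OF that] by simp
  qed
  have down: "y \<in> N" if x: "x \<in> N" and y: "y \<in> S" "0 \<le> y" "y \<le> x" for x y
  proof -
    have x': "x \<in> S" using x by (simp add: N_def)
    have "f (E y) = f (E y) \<sqinter>\<^bsub>ul_order H\<^esub> \<one>\<^bsub>H\<^esub>"
      using inf[OF y(1) x'] x y(3) by (simp add: N_def inf.absorb1)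
    then have "f (E y) \<sqsubseteq>\<^bsub>ul_order H\<^esub> \<one>\<^bsub>H\<^esub>"
      using L.meet_right[OF mem[OF y(1)] one] by simp
    moreover have "f (E y) = f (E y) \<squnion>\<^bsub>ul_order H\<^esub> \<one>\<^bsub>H\<^esub>"
      using sup[OF y(1) zero_mem] y(2) zero by (simp add: sup.absorb1)
    then have "\<one>\<^bsub>H\<^esub> \<sqsubseteq>\<^bsub>ul_order H\<^esub> f (E y)"
      using L.join_right[OF mem[OF y(1)] one] by simp
    ultimately have "f (E y) = \<one>\<^bsub>H\<^esub>"
      using L.le_antisym mem[OF y(1)] one by blast
    then show ?thesis using y by (simp add: N_def)
  qed
  have sup_abs: "sup x (- x) \<in> N" if "x \<in> N" for x
  proof -
    have "f (E x) = \<one>\<^bsub>H\<^esub>" "f (E (- x)) = \<one>\<^bsub>H\<^esub>" "x \<in> S" "- x \<in> S"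
      using that uminus[OF that] by (auto simp: N_def)
    then show ?thesis
      using sup[of x "- x"] L.sup_of_singleton[OF one] by (simp add: N_def join_def)
  qed
  have abs_nonneg: "0 \<le> sup x (- x)" for x :: 'a
  proof -
    \<comment> \<open>The order need not be total, so there is no case distinction on the sign of
      \<open>x\<close>; instead twice the absolute value is bounded below by
      \<open>x + - x\<close>.\<close>
    have "0 = x + - x" by simp
    also have "\<dots> \<le> sup x (- x) + sup x (- x)" by (intro add_mono) auto
    finally show ?thesis by (simp only: zero_le_double_add_iff_zero_le_single_add)
  qed
  define J where "J = {x \<in> \<Gamma>. E x \<in> K}"
  have JN: "J = N \<inter> \<Gamma>" unfolding J_def KN by auto
  have "u \<notin> N"
  proof
    assume u: "u \<in> N"
    have "S \<subseteq> N"
    proof (rule gamma_generates)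
      show "\<Gamma> \<subseteq> N" using down[OF u] by auto
      show "x - y \<in> N" if "x \<in> N" "y \<in> N" for x y using add[OF that(1) uminus[OF that(2)]] by simp
    qed
    then have "N = S" by (auto simp: N_def)
    then show False using proper KN by simp
  qed
  moreover have "x \<boxplus> y \<in> J" if "x \<in> J" "y \<in> J" for x y
    using that down[of "x + y" "x \<boxplus> y"] add[of x y] oplus_mem[of x y] by (auto simp: JN)
  moreover have "y \<in> J" if "x \<in> J" "y \<in> \<Gamma>" "y \<le> x" for x y
    using that down[of x y] by (auto simp: JN)
  moreover have "0 \<in> J" using zero by (simp add: JN N_def)
  ultimately have "gamma_ideal J"
    unfolding gamma_ideal_def JN by auto
  moreover have "inf (sup x (- x)) u \<in> J" if "x \<in> S" "E x \<in> K" for x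
  proof -
    have "sup x (- x) \<in> N" using that by (intro sup_abs) (auto simp: KN)
    then show ?thesis
      using down[of "sup x (- x)" "inf (sup x (- x)) u"] abs_nonneg[of x] that(1) by (simp add: JN)
  qed
  moreover have "K \<subseteq> E ` S" unfolding KN N_def by blast
  moreover have "E 0 \<in> K" using zero by (simp add: KN N_def)
  ultimately show thesis using that J_def by blast
qed

end

section \<open>Real-valued states and finite rank\<close>

text \<open>Ideals are kernels into algebras with carrier in \<open>'b set\<close>. For the kernel
  of a real-valued state to count as one, the reals must embed into \<open>'b\<close>.\<close>

locale large_encoded = encoded +
  assumes real_embeds: "\<exists>R :: real \<Rightarrow> 'b. inj R"
begin

abbreviation state :: "('a \<Rightarrow> real) \<Rightarrow> bool" where
  "state \<equiv> unital_hom S u UNIV 1"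

lemma encoded_pair_real: "inj R \<Longrightarrow> encoded_pair S u E UNIV (1::real) R"
  by (simp add: encoded_pair_def encoded_axioms encoded_real)

context
  fixes h assumes h: "state h"
begin

interpretation st: encoded_pair S u E UNIV "1::real" id
  by (rule encoded_pair_real) simp

lemma state_simps:
  "h u = 1" "h 0 = 0"
  "x \<in> S \<Longrightarrow> h (- x) = - h x"
  "\<lbrakk>x \<in> S; y \<in> S\<rbrakk> \<Longrightarrow> h (x - y) = h x - h y"
  "\<lbrakk>x \<in> S; y \<in> S\<rbrakk> \<Longrightarrow> h (x + y) = h x + h y"
  "\<lbrakk>x \<in> S; y \<in> S\<rbrakk> \<Longrightarrow> h (sup x y) = max (h x) (h y)"
  "\<lbrakk>x \<in> S; y \<in> S\<rbrakk> \<Longrightarrow> h (inf x y) = min (h x) (h y)"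
  using st.hom_unit[OF h] st.hom_zero[OF h] st.hom_uminus[OF h] st.hom_diff[OF h] st.hom_add[OF h]
    st.hom_sup[OF h] st.hom_inf[OF h]
  by (simp_all add: sup_real_def inf_real_def)

lemma state_mono: "\<lbrakk>x \<in> S; y \<in> S; x \<le> y\<rbrakk> \<Longrightarrow> h x \<le> h y"
  by (rule st.hom_mono[OF h])

lemma state_gamma: "x \<in> \<Gamma> \<Longrightarrow> 0 \<le> h x \<and> h x \<le> 1"
  using st.hom_gamma[OF h, of x] by auto

lemma state_kernel_mv_ideal: "mv_ideal A (E ` {x \<in> \<Gamma>. h x = 0})"
proof -
  obtain R0 :: "real \<Rightarrow> 'b" where "inj R0" using real_embeds by blast
  \<comment> \<open>Singletons carry the embedded reals from \<open>'b\<close> to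
    \<open>'b set\<close>, the carrier type that \<open>mv_ideal\<close> prescribes.\<close>
  define R where "R = (\<lambda>c. {R0 c})"
  have R: "inj R" using \<open>inj R0\<close> by (auto simp: R_def inj_def)
  interpret R: encoded_pair S u E UNIV "1::real" R by (rule encoded_pair_real[OF R])
  let ?f = "\<lambda>x. R (h (D x))"
  have "mv_algebra R.cod.A" by (rule R.cod.mv_algebra_A)
  moreover have "?f \<in> mv_hom A R.cod.A" by (rule R.mv_hom_encode[OF h])
  moreover have "E ` {x \<in> \<Gamma>. h x = 0} = kernel A R.cod.A ?f"
    by (auto simp: kernel_def)
  moreover have "E u \<in> carrier A - E ` {x \<in> \<Gamma>. h x = 0}" by (auto simp: state_simps(1))
  ultimately show ?thesis unfolding mv_ideal_def by blast
qed

lemma state_kernel_ul_ideal: "ul_ideal G (E ` {x \<in> S. h x = 0})"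
proof -
  obtain R0 :: "real \<Rightarrow> 'b" where "inj R0" using real_embeds by blast
  define R where "R = (\<lambda>c. {R0 c})"
  have R: "inj R" using \<open>inj R0\<close> by (auto simp: R_def inj_def)
  interpret R: encoded_pair S u E UNIV "1::real" R by (rule encoded_pair_real[OF R])
  let ?f = "\<lambda>x. R (h (D x))"
  have "unital_lgroup R.cod.G" by (rule R.cod.unital_lgroup_G)
  moreover have "?f \<in> ul_hom G R.cod.G" by (rule R.ul_hom_encode[OF h])
  moreover have "E ` {x \<in> S. h x = 0} = kernel G R.cod.G ?f"
    by (auto simp: kernel_def)
  moreover have "E u \<in> carrier G - E ` {x \<in> S. h x = 0}" by (auto simp: state_simps(1))
  ultimately show ?thesis unfolding ul_ideal_def by blast
qed

lemma ul_ideal_subset_state_kernel: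
  assumes "ul_ideal G K" "\<And>x. \<lbrakk>x \<in> \<Gamma>; E x \<in> K\<rbrakk> \<Longrightarrow> h x = 0"
  shows "K \<subseteq> E ` {x \<in> S. h x = 0}"
proof
  fix y assume y: "y \<in> K"
  obtain J where J: "K \<subseteq> E ` S" "J = {x \<in> \<Gamma>. E x \<in> K}"
    "\<And>x. \<lbrakk>x \<in> S; E x \<in> K\<rbrakk> \<Longrightarrow> inf (sup x (- x)) u \<in> J"
    using ul_ideal_decode[OF assms(1)] by metis
  obtain x where x: "y = E x" "x \<in> S" using y J(1) by blast
  then have "h (inf (sup x (- x)) u) = 0" using J(2,3) assms(2) y by blast
  then have "h x = 0" using x(2) by (auto simp: state_simps min_def max_def split: if_splits)
  then show "y \<in> E ` {x \<in> S. h x = 0}" using x by blast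
qed

text \<open>The state sends the distance of \<open>x\<close> and \<open>y\<close> to the minimum of
  1 and the absolute value of \<open>h x - h y\<close>, so congruence classes are fibres of
  \<open>h\<close>.\<close>

lemma mv_cong_state_kernel:
  assumes "x \<in> \<Gamma>"
  shows "mv_cong A (E ` {x \<in> \<Gamma>. h x = 0}) `` {E x} = E ` {y \<in> \<Gamma>. h y = h x}"
proof -
  have "(E x, E y) \<in> mv_cong A (E ` {x \<in> \<Gamma>. h x = 0}) \<longleftrightarrow> h y = h x" if "y \<in> \<Gamma>" for y
  proof -
    let ?d = "sup (x - y) 0 \<boxplus> sup (y - x) 0"
    have "h ?d = min (max (h x - h y) 0 + max (h y - h x) 0) 1"
      using assms that by (simp add: state_simps)
    then have "h ?d = 0 \<longleftrightarrow> h y = h x" by (auto simp: min_def max_def)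
    moreover have "?d \<in> \<Gamma>" using assms that by auto
    moreover have "E x \<in> E ` \<Gamma>" "E y \<in> E ` \<Gamma>" using assms that by blast+
    then have "(E x, E y) \<in> mv_cong A (E ` {x \<in> \<Gamma>. h x = 0}) \<longleftrightarrow> E ?d \<in> E ` {x \<in> \<Gamma>. h x = 0}"
      unfolding mv_cong_def
      by (simp only: mem_Collect_eq case_prod_conv mem_Sigma_iff A_simps D_E neg_oplus simp_thms)
    ultimately show ?thesis by (simp only: E_mem_iff mem_Collect_eq simp_thms)
  qed
  moreover have "mv_cong A (E ` {x \<in> \<Gamma>. h x = 0}) \<subseteq> E ` \<Gamma> \<times> E ` \<Gamma>"
    by (auto simp: mv_cong_def)
  ultimately show ?thesis by blast
qed

lemma mv_finite_rank_state_kernel: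
  "mv_finite_rank A (E ` {x \<in> \<Gamma>. h x = 0}) \<longleftrightarrow> finite (h ` \<Gamma>)"
proof -
  let ?K = "E ` {x \<in> \<Gamma>. h x = 0}" and ?C = "\<lambda>c. E ` {y \<in> \<Gamma>. h y = c}"
  have "carrier A // mv_cong A ?K = (\<lambda>x. mv_cong A ?K `` {E x}) ` \<Gamma>"
    unfolding quotient_def A_simps by blast
  also have "\<dots> = (\<lambda>x. ?C (h x)) ` \<Gamma>"
    by (rule image_cong[OF refl mv_cong_state_kernel])
  also have "\<dots> = ?C ` h ` \<Gamma>" by (simp only: image_image)
  finally have eq: "carrier A // mv_cong A ?K = ?C ` h ` \<Gamma>" .
  have "inj_on ?C (h ` \<Gamma>)"
  proof (rule inj_onI)
    fix c d assume "c \<in> h ` \<Gamma>" and cd: "?C c = ?C d"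
    then obtain x where x: "x \<in> \<Gamma>" "h x = c" by blast
    then have "E x \<in> ?C d" using cd by blast
    then have "x \<in> {y \<in> \<Gamma>. h y = d}" unfolding E_mem_iff .
    then show "c = d" using x by simp
  qed
  then show ?thesis
    unfolding mv_finite_rank_def eq by (rule finite_image_iff)
qed

abbreviation level_set :: "real \<Rightarrow> 'b set" where
  "level_set c \<equiv> E ` {y \<in> S. h y = c}"

lemma r_coset_state_kernel:
  assumes "x \<in> S"
  shows "level_set 0 #>\<^bsub>G\<^esub> E x = level_set (h x)"
proof -
  have "level_set 0 #>\<^bsub>G\<^esub> E x = E ` (\<lambda>y. y + x) ` {y \<in> S. h y = 0}"
    unfolding r_coset_def by auto
  also have "(\<lambda>y. y + x) ` {y \<in> S. h y = 0} = {y \<in> S. h y = h x}"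
  proof (rule antisym)
    show "{y \<in> S. h y = h x} \<subseteq> (\<lambda>y. y + x) ` {y \<in> S. h y = 0}"
    proof
      fix y assume "y \<in> {y \<in> S. h y = h x}"
      then have "y - x \<in> {y \<in> S. h y = 0}" using assms by (simp add: state_simps)
      then show "y \<in> (\<lambda>y. y + x) ` {y \<in> S. h y = 0}" by (rule rev_image_eqI) simp
    qed
  qed (use assms in \<open>auto simp: state_simps\<close>)
  finally show ?thesis .
qed

lemma carrier_Mod_state_kernel: "carrier (G Mod level_set 0) = level_set ` h ` S"
proof -
  have "carrier (G Mod level_set 0) = (\<lambda>x. level_set 0 #>\<^bsub>G\<^esub> E x) ` S"
    unfolding FactGroup_def RCOSETS_def by auto
  also have "\<dots> = (\<lambda>x. level_set (h x)) ` S"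
    by (rule image_cong[OF refl r_coset_state_kernel])
  finally show ?thesis by (simp only: image_image)
qed

lemma mult_Mod_state_kernel:
  assumes "x \<in> S" "y \<in> S"
  shows "level_set (h x) \<otimes>\<^bsub>G Mod level_set 0\<^esub> level_set (h y) = level_set (h x + h y)"
proof -
  have "E ` {z \<in> S. h z = h x + h y} \<subseteq> level_set (h x) <#>\<^bsub>G\<^esub> level_set (h y)"
  proof clarify
    fix z assume z: "z \<in> S" "h z = h x + h y"
    have "E (z - y) \<in> level_set (h x)" "E y \<in> level_set (h y)"
      using z assms by (simp_all add: state_simps)
    moreover have "E z = E (z - y) \<otimes>\<^bsub>G\<^esub> E y" by simp
    ultimately show "E z \<in> level_set (h x) <#>\<^bsub>G\<^esub> level_set (h y)"
      unfolding set_mult_def by blast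
  qed
  moreover have "level_set (h x) <#>\<^bsub>G\<^esub> level_set (h y) \<subseteq> level_set (h x + h y)"
    unfolding set_mult_def by (auto simp: state_simps)
  ultimately show ?thesis by (simp add: FactGroup_def)
qed

lemma coset_le_state_kernel:
  assumes "x \<in> S" "y \<in> S"
  shows "ul_coset_le G (level_set (h x)) (level_set (h y)) \<longleftrightarrow> h x \<le> h y"
proof
  assume "ul_coset_le G (level_set (h x)) (level_set (h y))"
  then obtain x' y' where "x' \<in> S" "y' \<in> S" "h x' = h x" "h y' = h y" "x' \<le> y'"
    by (auto simp: ul_coset_le_def)
  then show "h x \<le> h y" using state_mono[of x' y'] by simp
next
  assume "h x \<le> h y"
  \<comment> \<open>\<open>y\<close> itself need not lie above \<open>x\<close>, but
    \<open>sup x y\<close> does, and it belongs to the coset of \<open>y\<close> because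
    \<open>max (h x) (h y) = h y\<close>.\<close>
  then have "E x \<in> level_set (h x)" "E (sup x y) \<in> level_set (h y)"
    using assms by (simp_all add: state_simps)
  moreover have "ul_le G (E x) (E (sup x y))" by simp
  ultimately show "ul_coset_le G (level_set (h x)) (level_set (h y))"
    unfolding ul_coset_le_def by blast
qed

text \<open>Multiplication by \<open>k\<close> turns the quotient, a copy of
  \<open>(1 / k) \<int>\<close>, into the integers and sends the unit to \<open>k\<close>.\<close>

lemma ul_finite_rank_state_kernel:
  fixes k :: nat
  assumes k: "k > 0" and range: "h ` S = range (\<lambda>j::int. j / k)"
  shows "ul_finite_rank G (level_set 0)"
proof -
  \<comment> \<open>All representatives of a coset have the same state value, so the choice is
    harmless; the floor merely changes the type of an integer-valued real.\<close>
  define \<phi> where "\<phi> X = \<lfloor>k * h (D (SOME x. x \<in> X))\<rfloor>" for X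
  have \<phi>: "\<phi> (level_set (j / k)) = j" for j :: int
  proof -
    have "j / k \<in> h ` S" using range by blast
    then have "\<exists>x. x \<in> level_set (j / k)" by auto
    then have "(SOME x. x \<in> level_set (j / k)) \<in> level_set (j / k)" by (rule someI_ex)
    then have "h (D (SOME x. x \<in> level_set (j / k))) = j / k" by auto
    then show ?thesis using k by (simp add: \<phi>_def)
  qed
  have carr: "carrier (G Mod level_set 0) = range (\<lambda>j::int. level_set (j / k))"
    unfolding carrier_Mod_state_kernel range by (simp add: image_image)
  have rep: "\<exists>x\<in>S. h x = j / k" for j :: int
  proof -
    have "j / k \<in> h ` S" unfolding range by blast
    then show ?thesis by auto
  qed
  have "\<phi> \<in> iso (G Mod level_set 0) integer_group"
  proof (rule isoI)
    show "\<phi> \<in> hom (G Mod level_set 0) integer_group"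
    proof (rule homI)
      fix X Y assume "X \<in> carrier (G Mod level_set 0)" "Y \<in> carrier (G Mod level_set 0)"
      then obtain i j :: int where ij: "X = level_set (i / k)" "Y = level_set (j / k)"
        unfolding carr by blast
      obtain x y where xy: "x \<in> S" "y \<in> S" "h x = i / k" "h y = j / k" using rep by metis
      have "X \<otimes>\<^bsub>G Mod level_set 0\<^esub> Y = level_set (real_of_int (i + j) / k)"
        using mult_Mod_state_kernel[OF xy(1,2)] by (simp add: ij xy add_divide_distrib)
      then show "\<phi> (X \<otimes>\<^bsub>G Mod level_set 0\<^esub> Y) = \<phi> X \<otimes>\<^bsub>integer_group\<^esub> \<phi> Y"
        by (simp only: ij \<phi>) simp
    qed simp
    show "bij_betw \<phi> (carrier (G Mod level_set 0)) (carrier integer_group)"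
      unfolding carr by (rule bij_betwI[where g = "\<lambda>j::int. level_set (j / k)"]) (auto simp: \<phi>)
  qed
  moreover have "ul_coset_le G X Y \<longleftrightarrow> \<phi> X \<le> \<phi> Y"
    if XY: "X \<in> carrier (G Mod level_set 0)" "Y \<in> carrier (G Mod level_set 0)" for X Y
  proof -
    obtain i j :: int where ij: "X = level_set (i / k)" "Y = level_set (j / k)"
      using XY unfolding carr by blast
    obtain x y where xy: "x \<in> S" "y \<in> S" "h x = i / k" "h y = j / k" using rep by metis
    have "ul_coset_le G X Y \<longleftrightarrow> i / k \<le> j / k"
      using coset_le_state_kernel[OF xy(1,2)] by (simp only: ij xy)
    also have "\<dots> \<longleftrightarrow> i \<le> j" using k by (simp add: divide_le_cancel)
    finally show ?thesis by (simp only: ij \<phi>)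
  qed
  moreover have "\<phi> (level_set 0 #>\<^bsub>G\<^esub> ul_unit G) > 0"
  proof -
    have "level_set 0 #>\<^bsub>G\<^esub> ul_unit G = level_set (real_of_int (int k) / k)"
      using r_coset_state_kernel[OF unit_mem] k by (simp add: state_simps)
    then show ?thesis using k by (simp only: \<phi> of_nat_0_less_iff)
  qed
  ultimately show ?thesis unfolding ul_finite_rank_def by blast
qed

text \<open>An order isomorphism with the integers would map the infinitely many values of
  \<open>h\<close> on \<Gamma> injectively into the finite interval between the images of zero and
  of the unit.\<close>

lemma not_ul_finite_rank_state_kernel:
  assumes "infinite (h ` \<Gamma>)"
  shows "\<not> ul_finite_rank G (level_set 0)"
proof
  assume "ul_finite_rank G (level_set 0)"
  then obtain \<phi> where iso: "\<phi> \<in> iso (G Mod level_set 0) integer_group"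
    and ord: "\<And>X Y. \<lbrakk>X \<in> carrier (G Mod level_set 0); Y \<in> carrier (G Mod level_set 0)\<rbrakk>
      \<Longrightarrow> ul_coset_le G X Y \<longleftrightarrow> \<phi> X \<le> \<phi> Y"
    unfolding ul_finite_rank_def by blast
  have carr: "level_set (h x) \<in> carrier (G Mod level_set 0)" if "x \<in> S" for x
    unfolding carrier_Mod_state_kernel using that by blast
  have ord': "\<phi> (level_set (h x)) \<le> \<phi> (level_set (h y)) \<longleftrightarrow> h x \<le> h y" if "x \<in> S" "y \<in> S" for x y
    using ord[OF carr carr] coset_le_state_kernel that by blast
  have "inj_on (\<lambda>c. \<phi> (level_set c)) (h ` \<Gamma>)"
  proof (rule inj_onI)
    fix c d assume "c \<in> h ` \<Gamma>" "d \<in> h ` \<Gamma>" and eq: "\<phi> (level_set c) = \<phi> (level_set d)"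
    then obtain x y where xy: "x \<in> S" "y \<in> S" "c = h x" "d = h y" by blast
    have "h x \<le> h y" "h y \<le> h x"
      using ord'[OF xy(1,2)] ord'[OF xy(2,1)] eq unfolding xy(3,4)
      by (simp_all only: order_refl simp_thms)
    then show "c = d" unfolding xy(3,4) by (rule antisym)
    qed
  moreover have "(\<lambda>c. \<phi> (level_set c)) ` h ` \<Gamma> \<subseteq> {\<phi> (level_set (h 0))..\<phi> (level_set (h u))}"
  proof clarify
    fix x assume "x \<in> S" "x \<in> {0..u}"
    then show "\<phi> (level_set (h x)) \<in> {\<phi> (level_set (h 0))..\<phi> (level_set (h u))}"
      using ord'[of 0 x] ord'[of x u] state_mono[of 0 x] state_mono[of x u]
      by (simp only: atLeastAtMost_iff zero_mem unit_mem unit_nonneg)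
  qed
  ultimately show False
    using assms by (meson finite_atLeastAtMost_int finite_imageD finite_subset)
qed

end

end

section \<open>Maximal ideals\<close>

context large_encoded
begin

lemma gamma_idealD:
  assumes "gamma_ideal J"
  shows "x \<in> J \<Longrightarrow> x \<in> \<Gamma>" "0 \<in> J" "u \<notin> J" "\<lbrakk>x \<in> J; y \<in> J\<rbrakk> \<Longrightarrow> x \<boxplus> y \<in> J"
    "\<lbrakk>x \<in> J; y \<in> \<Gamma>; y \<le> x\<rbrakk> \<Longrightarrow> y \<in> J"
proof -
  have *: "J \<subseteq> \<Gamma>" "0 \<in> J" "u \<notin> J" "\<forall>x\<in>J. \<forall>y\<in>J. x \<boxplus> y \<in> J"
    "\<forall>x\<in>J. \<forall>y\<in>\<Gamma>. y \<le> x \<longrightarrow> y \<in> J"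
    using assms unfolding gamma_ideal_def by - (elim conjE, assumption)+
  show "x \<in> J \<Longrightarrow> x \<in> \<Gamma>" by (rule subsetD[OF *(1)])
  show "0 \<in> J" "u \<notin> J" by (rule *)+
  show "\<lbrakk>x \<in> J; y \<in> J\<rbrakk> \<Longrightarrow> x \<boxplus> y \<in> J" by (rule *(4)[rule_format])
  show "\<lbrakk>x \<in> J; y \<in> \<Gamma>; y \<le> x\<rbrakk> \<Longrightarrow> y \<in> J" by (rule *(5)[rule_format])
qed

text \<open>Such an \<open>e\<close> makes the kernel of \<open>h\<close> an isolated point: for
  ideals, avoiding \<open>e\<close> is the same as being contained in that kernel.\<close>

definition isolating :: "('a \<Rightarrow> real) \<Rightarrow> 'a \<Rightarrow> bool" where
  "isolating h e \<longleftrightarrow> state h \<and> e \<in> \<Gamma> \<and> h e = 1 \<and> (\<forall>x\<in>\<Gamma>. h x = 1 \<longrightarrow> e \<le> x)"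

text \<open>If \<open>h x > 0\<close>, the Archimedean property makes some truncated multiple of
  \<open>x\<close> reach the value 1. This multiple lies in \<open>J\<close> and, by minimality of
  \<open>e\<close>, above \<open>e\<close>, so \<open>e\<close> would lie in
  \<open>J\<close>.\<close>

lemma isolating_gamma_ideal:
  assumes "isolating h e" and J: "gamma_ideal J" and "e \<notin> J" "x \<in> J"
  shows "h x = 0"
proof (rule ccontr)
  assume nz: "h x \<noteq> 0"
  have h: "state h" and e: "e \<in> \<Gamma>" "\<And>x. \<lbrakk>x \<in> \<Gamma>; h x = 1\<rbrakk> \<Longrightarrow> e \<le> x"
    using assms(1) by (auto simp: isolating_def)
  have x: "x \<in> \<Gamma>" by (rule gamma_idealD(1)[OF J \<open>x \<in> J\<close>])
  then have pos: "h x > 0" using state_gamma[OF h, of x] nz by linarith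
  have iter: "\<exists>z\<in>J. h z = min (real n * h x) 1" for n
  proof (induction n)
    case 0
    then show ?case using gamma_idealD(2)[OF J] state_simps(2)[OF h] by auto
  next
    case (Suc n)
    then obtain z where z: "z \<in> J" "h z = min (real n * h x) 1" by blast
    have "z \<boxplus> x \<in> J" "z \<in> \<Gamma>"
      by (rule gamma_idealD(4)[OF J z(1) \<open>x \<in> J\<close>], rule gamma_idealD(1)[OF J z(1)])
    moreover have "h (z \<boxplus> x) = min (real (Suc n) * h x) 1"
      using \<open>z \<in> \<Gamma>\<close> x z(2) pos by (simp add: state_simps[OF h] min_def algebra_simps)
    ultimately show ?case by blast
  qed
  obtain n :: nat where "1 \<le> real n * h x"
    using reals_Archimedean3[OF pos] by (metis less_eq_real_def)
  then obtain z where z: "z \<in> J" "h z = 1" using iter[of n] by auto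
  moreover have "z \<in> \<Gamma>" by (rule gamma_idealD(1)[OF J z(1)])
  ultimately have "e \<in> J" using gamma_idealD(5)[OF J z(1) e(1)] e(2) by blast
  with \<open>e \<notin> J\<close> show False ..
qed

text \<open>The complement \<open>u - e\<close> lies in the kernel of \<open>h\<close>, so an ideal
  above the kernel containing \<open>e\<close> as well would contain
  \<open>e \<boxplus> (u - e) = u\<close>.\<close>

lemma isolating_complement:
  assumes "isolating h e" and J: "gamma_ideal J" and sub: "{x \<in> \<Gamma>. h x = 0} \<subseteq> J"
  shows "e \<notin> J"
proof
  assume "e \<in> J"
  have h: "state h" and e: "e \<in> \<Gamma>" "h e = 1"
    using assms(1) by (auto simp: isolating_def)
  have "u - e \<in> J" using sub e by (auto simp: state_simps[OF h])
  then have "e \<boxplus> (u - e) \<in> J" by (rule gamma_idealD(4)[OF J \<open>e \<in> J\<close>])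
  moreover have "e \<boxplus> (u - e) = u" by simp
  ultimately show False using gamma_idealD(3)[OF J] by simp
qed

lemma isolating_maximal_mv:
  assumes he: "isolating h e"
  shows "E ` {x \<in> \<Gamma>. h x = 0} \<in> mv_maximal_ideals A"
    "{m \<in> mv_maximal_ideals A. E e \<notin> m} = {E ` {x \<in> \<Gamma>. h x = 0}}"
proof -
  have h: "state h" using he by (simp add: isolating_def)
  let ?M = "E ` {x \<in> \<Gamma>. h x = 0}"
  have 1: "?M \<in> {I. mv_ideal A I}" unfolding mem_Collect_eq by (rule state_kernel_mv_ideal[OF h])
  have 2: "K \<subseteq> ?M" if "K \<in> {I. mv_ideal A I}" "E e \<notin> K" for K
  proof -
    obtain J where J: "gamma_ideal J" "K = E ` J" using \<open>K \<in> _\<close> mv_ideal_decode by blast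
    then have "e \<notin> J" using \<open>E e \<notin> K\<close> by blast
    then have "J \<subseteq> {x \<in> \<Gamma>. h x = 0}"
      using isolating_gamma_ideal[OF he J(1)] gamma_idealD(1)[OF J(1)] by blast
    then show ?thesis using J(2) by blast
  qed
  have 3: "E e \<notin> K" if "K \<in> {I. mv_ideal A I}" "?M \<subseteq> K" for K
  proof -
    obtain J where J: "gamma_ideal J" "K = E ` J" using \<open>K \<in> _\<close> mv_ideal_decode by blast
    then have "{x \<in> \<Gamma>. h x = 0} \<subseteq> J"
      using \<open>?M \<subseteq> K\<close> by (simp only: inj_image_subset_iff[OF inj_E])
    then show ?thesis using isolating_complement[OF he J(1)] J(2) by (simp only: E_mem_iff) simp
  qed
  show "?M \<in> mv_maximal_ideals A" "{m \<in> mv_maximal_ideals A. E e \<notin> m} = {?M}"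
    unfolding mv_maximal_ideals_def by (rule maximal_members_pointI[OF 1 2 3]; assumption)+
qed

lemma isolating_maximal_ul:
  assumes he: "isolating h e"
  shows "E ` {x \<in> S. h x = 0} \<in> ul_maximal_ideals G"
    "{m \<in> ul_maximal_ideals G. E e \<notin> m} = {E ` {x \<in> S. h x = 0}}"
proof -
  have h: "state h" and e: "e \<in> \<Gamma>" using he by (auto simp: isolating_def)
  let ?M = "E ` {x \<in> S. h x = 0}"
  have 1: "?M \<in> {I. ul_ideal G I}" unfolding mem_Collect_eq by (rule state_kernel_ul_ideal[OF h])
  have 2: "K \<subseteq> ?M" if K: "K \<in> {I. ul_ideal G I}" "E e \<notin> K" for K
  proof (rule ul_ideal_subset_state_kernel[OF h])
    show "ul_ideal G K" using K(1) by simp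
    then obtain J where J: "gamma_ideal J" "J = {x \<in> \<Gamma>. E x \<in> K}" using ul_ideal_decode by metis
    fix x assume "x \<in> \<Gamma>" "E x \<in> K"
    then show "h x = 0"
      using isolating_gamma_ideal[OF he J(1), of x] K(2) unfolding J(2) by blast
  qed
  have 3: "E e \<notin> K" if K: "K \<in> {I. ul_ideal G I}" "?M \<subseteq> K" for K
  proof -
    have "ul_ideal G K" using K(1) by simp
    then obtain J where J: "gamma_ideal J" "J = {x \<in> \<Gamma>. E x \<in> K}" using ul_ideal_decode by metis
    have "{x \<in> \<Gamma>. h x = 0} \<subseteq> J" using K(2) unfolding J(2) by blast
    then show ?thesis using isolating_complement[OF he J(1)] e unfolding J(2) by blast
  qed
  show "?M \<in> ul_maximal_ideals G" "{m \<in> ul_maximal_ideals G. E e \<notin> m} = {?M}"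
    unfolding ul_maximal_ideals_def by (rule maximal_members_pointI[OF 1 2 3]; assumption)+
qed

lemma semisimpleI:
  assumes P: "P \<noteq> {}" "\<And>h e. (h, e) \<in> P \<Longrightarrow> isolating h e"
    and separating: "\<And>x. \<lbrakk>x \<in> S; \<And>h e. (h, e) \<in> P \<Longrightarrow> h x = 0\<rbrakk> \<Longrightarrow> x = 0"
  shows "mv_semisimple A" "ul_semisimple G"
proof -
  obtain h0 e0 where P0: "(h0, e0) \<in> P" using P(1) by auto
  have "E 0 \<in> m" if "m \<in> mv_maximal_ideals A" for m
  proof -
    have "mv_ideal A m" using that by (simp add: mv_maximal_ideals_def maximal_members_def)
    then show ?thesis by (rule mv_ideal_decode) (simp add: gamma_idealD(2))
  qed
  moreover have "y = E 0" if y: "\<And>m. m \<in> mv_maximal_ideals A \<Longrightarrow> y \<in> m" for y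
  proof -
    have mem: "y \<in> E ` {x \<in> \<Gamma>. h x = 0}" if "(h, e) \<in> P" for h e
      by (intro y isolating_maximal_mv(1)[of h e] P(2) that)
    obtain x where x: "y = E x" "x \<in> S" using mem[OF P0] by blast
    have "x = 0"
    proof (rule separating[OF x(2)])
      fix h e assume "(h, e) \<in> P"
      then have "x \<in> {x \<in> \<Gamma>. h x = 0}" using mem unfolding x(1) E_mem_iff by blast
      then show "h x = 0" by simp
    qed
    then show ?thesis using x by simp
  qed
  ultimately show "mv_semisimple A" unfolding mv_semisimple_def by auto
  have "E 0 \<in> m" if "m \<in> ul_maximal_ideals G" for m
  proof -
    have "ul_ideal G m" using that by (simp add: ul_maximal_ideals_def maximal_members_def)
    then show ?thesis by (rule ul_ideal_decode)
  qed
  moreover have "y = E 0" if y: "\<And>m. m \<in> ul_maximal_ideals G \<Longrightarrow> y \<in> m" for y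
  proof -
    have mem: "y \<in> E ` {x \<in> S. h x = 0}" if "(h, e) \<in> P" for h e
      by (intro y isolating_maximal_ul(1)[of h e] P(2) that)
    obtain x where x: "y = E x" "x \<in> S" using mem[OF P0] by blast
    have "x = 0"
    proof (rule separating[OF x(2)])
      fix h e assume "(h, e) \<in> P"
      then have "x \<in> {x \<in> S. h x = 0}" using mem unfolding x(1) E_mem_iff by blast
      then show "h x = 0" by simp
    qed
    then show ?thesis using x by simp
  qed
  ultimately show "ul_semisimple G" unfolding ul_semisimple_def by auto
qed

lemma finite_rank_not_denseI:
  assumes he: "isolating h e" and inf: "infinite (h ` \<Gamma>)"
  shows "\<not> mv_finite_rank_dense A" "\<not> ul_finite_rank_dense G"
proof -
  have h: "state h" and e: "e \<in> \<Gamma>" using he by (auto simp: isolating_def)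
  have "E ` {x \<in> \<Gamma>. h x = 0} \<notin> {m \<in> mv_maximal_ideals A. mv_finite_rank A m}"
    using mv_finite_rank_state_kernel[OF h] inf by blast
  then show "\<not> mv_finite_rank_dense A"
    unfolding mv_finite_rank_dense_def mv_spectral_space_def
    by (rule hull_kernel_isolated_not_dense[OF _ isolating_maximal_mv(2)[OF he], rotated])
      (use e in auto)
  have "E ` {x \<in> S. h x = 0} \<notin> {m \<in> ul_maximal_ideals G. ul_finite_rank G m}"
    using not_ul_finite_rank_state_kernel[OF h inf] by blast
  then show "\<not> ul_finite_rank_dense G"
    unfolding ul_finite_rank_dense_def ul_spectral_space_def
    by (rule hull_kernel_isolated_not_dense[OF _ isolating_maximal_ul(2)[OF he], rotated])
      (use e in auto)
qed

text \<open>By \<open>cover\<close> a maximal ideal lies inside the kernel of some state from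
  \<open>P\<close>; this kernel is again an ideal, and maximality turns the inclusion into an
  equality.\<close>

lemma maximal_ideal_state_kernel_mv:
  assumes "m \<in> mv_maximal_ideals A"
    and cover: "\<And>J. gamma_ideal J \<Longrightarrow> \<exists>h\<in>P. state h \<and> (\<forall>x\<in>J. h x = 0)"
  shows "\<exists>h\<in>P. state h \<and> m = E ` {x \<in> \<Gamma>. h x = 0}"
proof -
  have "mv_ideal A m" using assms(1) by (simp add: mv_maximal_ideals_def maximal_members_def)
  then obtain J where J: "gamma_ideal J" "m = E ` J" by (rule mv_ideal_decode)
  then obtain h where h: "h \<in> P" "state h" "\<forall>x\<in>J. h x = 0" using cover by blast
  have "m \<subseteq> E ` {x \<in> \<Gamma>. h x = 0}"
    using J(2) h(3) gamma_idealD(1)[OF J(1)] by blast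
  then have "m = E ` {x \<in> \<Gamma>. h x = 0}"
    using assms(1) state_kernel_mv_ideal[OF h(2)] maximal_members_eqI
    unfolding mv_maximal_ideals_def by blast
  then show ?thesis using h by blast
qed

lemma maximal_ideal_state_kernel_ul:
  assumes "m \<in> ul_maximal_ideals G"
    and cover: "\<And>J. gamma_ideal J \<Longrightarrow> \<exists>h\<in>P. state h \<and> (\<forall>x\<in>J. h x = 0)"
  shows "\<exists>h\<in>P. state h \<and> m = E ` {x \<in> S. h x = 0}"
proof -
  have m: "ul_ideal G m" using assms(1) by (simp add: ul_maximal_ideals_def maximal_members_def)
  then obtain J where J: "gamma_ideal J" "J = {x \<in> \<Gamma>. E x \<in> m}" using ul_ideal_decode by metis
  then obtain h where h: "h \<in> P" "state h" "\<forall>x\<in>J. h x = 0" using cover by blast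
  have "m \<subseteq> E ` {x \<in> S. h x = 0}"
    by (rule ul_ideal_subset_state_kernel[OF h(2) m]) (use h(3) J(2) in blast)
  then have "m = E ` {x \<in> S. h x = 0}"
    using assms(1) state_kernel_ul_ideal[OF h(2)] maximal_members_eqI
    unfolding ul_maximal_ideals_def by blast
  then show ?thesis using h by blast
qed

text \<open>The hypotheses give every maximal ideal finite rank, so the set to be shown dense is the
  whole space.\<close>

lemma finite_rank_denseI:
  assumes cover: "\<And>J. gamma_ideal J \<Longrightarrow> \<exists>h\<in>P. state h \<and> (\<forall>x\<in>J. h x = 0)"
    and rational: "\<And>h. h \<in> P \<Longrightarrow> \<exists>k::nat. k > 0 \<and> h ` S = range (\<lambda>j::int. j / k)"
  shows "mv_finite_rank_dense A" "ul_finite_rank_dense G"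
proof -
  have "mv_finite_rank A m" if m: "m \<in> mv_maximal_ideals A" for m
  proof -
    obtain h where h: "h \<in> P" "state h" "m = E ` {x \<in> \<Gamma>. h x = 0}"
      using maximal_ideal_state_kernel_mv[OF m cover] by blast
    obtain k :: nat where k: "k > 0" "h ` S = range (\<lambda>j::int. j / k)" using rational[OF h(1)] by blast
    have "h ` \<Gamma> \<subseteq> (\<lambda>j::int. j / k) ` {0..int k}"
    proof
      fix c assume "c \<in> h ` \<Gamma>"
      then obtain x where x: "x \<in> \<Gamma>" "c = h x" by blast
      have "c \<in> h ` S" using x by blast
      then obtain j :: int where j: "c = j / k" unfolding k(2) by blast
      have "0 \<le> c" "c \<le> 1" using state_gamma[OF h(2) x(1)] x(2) by auto
      then have "j \<in> {0..int k}" using k(1) by (simp add: j zero_le_divide_iff divide_le_eq)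
      then show "c \<in> (\<lambda>j::int. j / k) ` {0..int k}" using j by blast
    qed
    then have "finite (h ` \<Gamma>)" by (rule finite_subset) simp
    then show ?thesis unfolding h(3) by (rule mv_finite_rank_state_kernel[OF h(2), THEN iffD2])
  qed
  then have "{m \<in> mv_maximal_ideals A. mv_finite_rank A m} = mv_maximal_ideals A" by blast
  then show "mv_finite_rank_dense A"
    unfolding mv_finite_rank_dense_def mv_spectral_space_def
    by (simp only: hull_kernel_closure_of_all)
  have "ul_finite_rank G m" if m: "m \<in> ul_maximal_ideals G" for m
  proof -
    obtain h where h: "h \<in> P" "state h" "m = E ` {x \<in> S. h x = 0}"
      using maximal_ideal_state_kernel_ul[OF m cover] by blast
    obtain k :: nat where k: "k > 0" "h ` S = range (\<lambda>j::int. j / k)" using rational[OF h(1)] by blast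
    show ?thesis unfolding h(3) by (rule ul_finite_rank_state_kernel[OF h(2) k])
  qed
  then have "{m \<in> ul_maximal_ideals G. ul_finite_rank G m} = ul_maximal_ideals G" by blast
  then show "ul_finite_rank_dense G"
    unfolding ul_finite_rank_dense_def ul_spectral_space_def
    by (simp only: hull_kernel_closure_of_all)
qed

text \<open>When a single state covers all ideals, its kernel is the only possible maximal ideal,
  and the nonzero \<open>x\<close> lies in it.\<close>

lemma not_semisimpleI:
  assumes h: "state h" and cover: "\<And>J x. \<lbrakk>gamma_ideal J; x \<in> J\<rbrakk> \<Longrightarrow> h x = 0"
    and x: "x \<in> \<Gamma>" "h x = 0" "x \<noteq> 0"
  shows "\<not> mv_semisimple A" "\<not> ul_semisimple G"
proof -
  have cover': "\<exists>h'\<in>{h}. state h' \<and> (\<forall>x\<in>J. h' x = 0)" if "gamma_ideal J" for J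
    using h cover[OF that] by simp
  have "E x \<in> m" if "m \<in> mv_maximal_ideals A" for m
  proof -
    have "m = E ` {x \<in> \<Gamma>. h x = 0}"
      using maximal_ideal_state_kernel_mv[OF that cover'] by blast
    then show ?thesis using x by blast
  qed
  moreover have "E x \<noteq> E 0" using x(3) by simp
  ultimately show "\<not> mv_semisimple A"
    unfolding mv_semisimple_def A_simps by blast
  have "E x \<in> m" if "m \<in> ul_maximal_ideals G" for m
  proof -
    have "m = E ` {x \<in> S. h x = 0}"
      using maximal_ideal_state_kernel_ul[OF that cover'] by blast
    then show ?thesis using x by blast
  qed
  moreover have "E x \<noteq> E 0" using x(3) by simp
  ultimately show "\<not> ul_semisimple G"
    unfolding ul_semisimple_def G_simps by blast
qed

end

section \<open>Lexicographic extensions of the integers\<close>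

datatype 'l int_lex = Int_Lex (int_part: int) (tail: 'l)

instantiation int_lex :: (ab_group_add) ab_group_add
begin

definition "0 = Int_Lex 0 0"
definition "p + q = Int_Lex (int_part p + int_part q) (tail p + tail q)"
definition "p - q = Int_Lex (int_part p - int_part q) (tail p - tail q)"
definition "- p = Int_Lex (- int_part p) (- tail p)"

instance
  by standard
    (simp_all add: zero_int_lex_def plus_int_lex_def minus_int_lex_def uminus_int_lex_def
      algebra_simps int_lex.expand)

end

text \<open>The lexicographic order is a lattice order because the leading component ranges over a
  chain: tails have to be combined only for equal integer parts.\<close>

instantiation int_lex :: (lattice_ab_group_add) lattice_ab_group_add
begin

definition "p \<le> q \<longleftrightarrow> int_part p < int_part q \<or> int_part p = int_part q \<and> tail p \<le> tail q"
definition "(p :: 'a int_lex) < q \<longleftrightarrow> p \<le> q \<and> \<not> q \<le> p"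
definition "sup p q = (if int_part p < int_part q then q else if int_part q < int_part p then p
  else Int_Lex (int_part p) (sup (tail p) (tail q)))"
definition "inf p q = (if int_part p < int_part q then p else if int_part q < int_part p then q
  else Int_Lex (int_part p) (inf (tail p) (tail q)))"

instance
  by standard
    (auto simp: less_eq_int_lex_def less_int_lex_def sup_int_lex_def inf_int_lex_def
      plus_int_lex_def int_lex.expand)

end

lemma int_lex_simps [simp]:
  "int_part 0 = 0" "tail 0 = 0"
  "int_part (p + q) = int_part p + int_part q" "tail (p + q) = tail p + tail q"
  "int_part (p - q) = int_part p - int_part q" "tail (p - q) = tail p - tail q"
  "int_part (- p) = - int_part p" "tail (- p) = - tail p"
  by (simp_all add: zero_int_lex_def plus_int_lex_def minus_int_lex_def uminus_int_lex_def)

locale int_lex_algebra =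
  fixes L :: "'l::lattice_ab_group_add set" and E :: "'l int_lex \<Rightarrow> 'b"
  assumes inj_encoding: "inj E"
    and real_injection: "\<exists>R :: real \<Rightarrow> 'b. inj R"
    and zero: "0 \<in> L"
    and diff: "\<lbrakk>x \<in> L; y \<in> L\<rbrakk> \<Longrightarrow> x - y \<in> L"
    and sup: "\<lbrakk>x \<in> L; y \<in> L\<rbrakk> \<Longrightarrow> sup x y \<in> L"
begin

lemma int_part_multiple: "int_part (((+) (Int_Lex 1 0) ^^ n) 0) = int n"
  by (induction n) auto

sublocale large_encoded "{p. tail p \<in> L}" "Int_Lex 1 0" E
proof
  fix p assume "p \<in> {p. tail p \<in> L}"
  \<comment> \<open>One unit more than the integer part makes the inequality of integer parts
    strict, whatever the tail; for a negative integer part zero copies suffice.\<close>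
  have "p \<le> ((+) (Int_Lex 1 0) ^^ nat (int_part p + 1)) 0"
    by (cases "int_part p \<ge> 0") (simp_all add: less_eq_int_lex_def int_part_multiple)
  then show "\<exists>n. p \<le> ((+) (Int_Lex 1 0) ^^ n) 0" ..
next
  fix p q assume "p \<in> {p. tail p \<in> L}" "q \<in> {p. tail p \<in> L}"
  then show "sup p q \<in> {p. tail p \<in> L}" by (auto simp: sup_int_lex_def sup)
qed (auto simp: inj_encoding real_injection zero diff less_eq_int_lex_def zero_int_lex_def)

notation oplus (infixl "\<boxplus>" 65)

lemma gamma_int_lex_iff:
  "p \<in> \<Gamma> \<longleftrightarrow> tail p \<in> L \<and> (int_part p = 0 \<and> 0 \<le> tail p \<or> int_part p = 1 \<and> tail p \<le> 0)"
  by (auto simp: less_eq_int_lex_def)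

lemma state_int_part: "state (\<lambda>p. real_of_int (int_part p))"
  by (auto simp: unital_hom_def sup_int_lex_def sup_real_def)

lemma gamma_ideal_int_part:
  assumes J: "gamma_ideal J" and p: "p \<in> J"
  shows "int_part p = 0"
proof (rule ccontr)
  assume "int_part p \<noteq> 0"
  then have "int_part p = 1" using gamma_idealD(1)[OF J p] by (auto simp: gamma_int_lex_iff simp del: Int_iff)
  \<comment> \<open>The double has integer part 2, exceeds the unit and is truncated to it; a proper
    ideal therefore contains infinitesimals only.\<close>
  then have "p \<boxplus> p = Int_Lex 1 0" by (simp add: inf_int_lex_def)
  then show False using gamma_idealD(4)[OF J p p] gamma_idealD(3)[OF J] by simp
qed

lemma dense: "mv_finite_rank_dense A" "ul_finite_rank_dense G"
proof -
  have rational: "(\<lambda>p. real_of_int (int_part p)) ` {p. tail p \<in> L} = range (\<lambda>j::int. j / real 1)"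
  proof -
    have "int_part ` {p. tail p \<in> L} = UNIV"
    proof (intro equalityI subset_UNIV subsetI)
      fix j show "j \<in> int_part ` {p. tail p \<in> L}"
        using zero by (intro image_eqI[of _ _ "Int_Lex j 0"]) auto
    qed
    then have "real_of_int ` int_part ` {p. tail p \<in> L} = range real_of_int" by (rule arg_cong)
    then show ?thesis by (simp add: image_image)
  qed
  have cover: "\<exists>h\<in>{\<lambda>p. real_of_int (int_part p)}. state h \<and> (\<forall>x\<in>J. h x = 0)" if "gamma_ideal J" for J
    using state_int_part gamma_ideal_int_part[OF that] by simp
  show "mv_finite_rank_dense A" "ul_finite_rank_dense G"
    by (rule finite_rank_denseI[OF cover], assumption, use rational zero_less_one in blast)+
qed

lemma not_semisimple:
  assumes "x \<in> L" "0 \<le> x" "x \<noteq> 0"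
  shows "\<not> mv_semisimple A" "\<not> ul_semisimple G"
proof -
  have "Int_Lex 0 x \<in> \<Gamma>" using assms by (simp add: gamma_int_lex_iff del: Int_iff)
  moreover have "Int_Lex 0 x \<noteq> 0" using assms by (simp add: zero_int_lex_def)
  ultimately show "\<not> mv_semisimple A" "\<not> ul_semisimple G"
    using not_semisimpleI[OF state_int_part, of "Int_Lex 0 x"] gamma_ideal_int_part by simp_all
qed

text \<open>It suffices to generate the infinitesimals: every other element of \<open>\<Gamma>\<close> is \<open>u\<close> minus one of them.\<close>

lemma int_lex_finitely_generated:
  assumes "finite X" "X \<subseteq> L" "\<And>x. x \<in> X \<Longrightarrow> 0 \<le> x"
    and gen: "\<And>B. \<lbrakk>X \<subseteq> B; 0 \<in> B; \<And>x y. \<lbrakk>x \<in> B; y \<in> B\<rbrakk> \<Longrightarrow> x + y \<in> B;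
      \<And>x y. \<lbrakk>x \<in> B; y \<in> B\<rbrakk> \<Longrightarrow> sup (x - y) 0 \<in> B\<rbrakk> \<Longrightarrow> {x \<in> L. 0 \<le> x} \<subseteq> B"
  shows "mv_finitely_generated A" "ul_finitely_generated G"
proof -
  have "\<Gamma> \<subseteq> B"
    if B: "Int_Lex 0 ` X \<subseteq> B" "B \<subseteq> \<Gamma>" "0 \<in> B" "\<And>x y. \<lbrakk>x \<in> B; y \<in> B\<rbrakk> \<Longrightarrow> x \<boxplus> y \<in> B"
      "\<And>x. x \<in> B \<Longrightarrow> Int_Lex 1 0 - x \<in> B" for B
  proof -
    have inf: "{x \<in> L. 0 \<le> x} \<subseteq> {x. Int_Lex 0 x \<in> B}"
    proof (rule gen)
      fix x y assume "x \<in> {x. Int_Lex 0 x \<in> B}" "y \<in> {x. Int_Lex 0 x \<in> B}"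
      then have xy: "Int_Lex 0 x \<in> B" "Int_Lex 0 y \<in> B" by simp_all
      \<comment> \<open>Sums of infinitesimals stay below the unit, so truncation does not affect
        them.\<close>
      have "Int_Lex 0 x \<boxplus> Int_Lex 0 y = Int_Lex 0 (x + y)"
        by (simp add: inf_int_lex_def plus_int_lex_def)
      then show "x + y \<in> {x. Int_Lex 0 x \<in> B}" using B(4)[OF xy] by simp
      have "sup (Int_Lex 0 x - Int_Lex 0 y) 0 \<in> B"
        unfolding neg_oplus[symmetric] by (intro B(4,5) xy)
      moreover have "sup (Int_Lex 0 x - Int_Lex 0 y) 0 = Int_Lex 0 (sup (x - y) 0)"
        by (simp add: sup_int_lex_def)
      ultimately show "sup (x - y) 0 \<in> {x. Int_Lex 0 x \<in> B}" by simp
    qed (use B(1,3) in \<open>auto simp: zero_int_lex_def\<close>)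
    show ?thesis
    proof
      fix p assume "p \<in> \<Gamma>"
      then consider "tail p \<in> L" "int_part p = 0" "0 \<le> tail p" | "tail p \<in> L" "int_part p = 1" "tail p \<le> 0"
        unfolding gamma_int_lex_iff by blast
      then show "p \<in> B"
      proof cases
        case 1
        then have "Int_Lex 0 (tail p) \<in> B" using inf by blast
        then show ?thesis using 1 by (cases p) simp
      next
        case 2
        then have "- tail p \<in> {x \<in> L. 0 \<le> x}" using diff[OF zero, of "tail p"] by simp
        then have "Int_Lex 1 0 - Int_Lex 0 (- tail p) \<in> B" using inf by (intro B(5)) blast
        moreover have "Int_Lex 1 0 - Int_Lex 0 (- tail p) = p"
          using 2 by (cases p) (simp add: minus_int_lex_def)
        ultimately show ?thesis by simp
      qed
    qed
  qed
  moreover have "Int_Lex 0 ` X \<subseteq> \<Gamma>"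
    using assms(2,3) by (auto simp: less_eq_int_lex_def)
  ultimately show "mv_finitely_generated A" "ul_finitely_generated G"
    using finitely_generatedI[of "Int_Lex 0 ` X"] assms(1) by (simp_all only: finite_imageI)
qed

end

section \<open>The non-semisimple algebras\<close>

lemma universe_real_embeds: "\<exists>R :: real \<Rightarrow> universe. inj R"
  by (intro exI[of _ "\<lambda>c _. c"]) (auto simp: inj_def fun_eq_iff)

section \<open>Chang's algebra\<close>

definition encode_chang :: "int int_lex \<Rightarrow> universe" where
  "encode_chang p = (\<lambda>s. if s 0 < 0 then int_part p else tail p)"

lemma inj_encode_chang: "inj encode_chang"
proof (rule injI)
  fix p q assume eq: "encode_chang p = encode_chang q"
  have "int_part p = int_part q" using fun_cong[OF eq, of "\<lambda>_. -1"] by (simp add: encode_chang_def)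
  moreover have "tail p = tail q" using fun_cong[OF eq, of "\<lambda>_. 0"] by (simp add: encode_chang_def)
  ultimately show "p = q" by (rule int_lex.expand[OF conjI])
qed

interpretation chang: int_lex_algebra "UNIV :: int set" encode_chang
  by unfold_locales (simp_all add: inj_encode_chang universe_real_embeds)

lemma chang_finitely_generated:
  "mv_finitely_generated chang.A" "ul_finitely_generated chang.G"
proof -
  have gen: "{x \<in> UNIV. 0 \<le> x} \<subseteq> B" if B: "{1} \<subseteq> B" "0 \<in> B" "\<And>x y. \<lbrakk>x \<in> B; y \<in> B\<rbrakk> \<Longrightarrow> x + y \<in> B"
    for B :: "int set"
  proof -
    have "int n \<in> B" for n by (induction n) (use B in auto)
    then show ?thesis using nonneg_int_cases by blast
  qed
  show "mv_finitely_generated chang.A" "ul_finitely_generated chang.G"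
    by - (rule chang.int_lex_finitely_generated[of "{1}"], simp, simp, simp, (rule gen; assumption))+
qed

text \<open>An endomorphism multiplies infinitesimals by a fixed integer \<open>q\<close>.
  Surjectivity excludes \<open>q = 0\<close>, and multiplication by a nonzero integer is
  injective.\<close>

lemma chang_hopfian: "mv_hopfian chang.A" "ul_hopfian chang.G"
proof -
  have inj: "inj_on F chang.\<Gamma>" if F: "chang.gamma_endo F" and onto: "F ` chang.\<Gamma> = chang.\<Gamma>" for F
  proof -
    define w :: "int int_lex" where "w = Int_Lex 0 1"
    have mem: "p \<in> chang.\<Gamma> \<longleftrightarrow> int_part p = 0 \<and> 0 \<le> tail p \<or> int_part p = 1 \<and> tail p \<le> 0" for p
      using chang.gamma_int_lex_iff by simp
    have inf: "Int_Lex 0 n \<in> chang.\<Gamma>" if "0 \<le> n" for n using that unfolding mem by simp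
    have w: "w \<in> chang.\<Gamma>" unfolding w_def by (rule inf) simp
    have F0: "F 0 = 0" and Fneg: "\<And>p. p \<in> chang.\<Gamma> \<Longrightarrow> F (Int_Lex 1 0 - p) = Int_Lex 1 0 - F p"
      using F unfolding chang.gamma_endo_def by blast+
    have add: "F (Int_Lex 0 (m + n)) = F (Int_Lex 0 m) + F (Int_Lex 0 n)" if "0 \<le> m" "0 \<le> n" for m n
      using chang.gamma_endo_add[OF F inf[OF that(1)] inf[OF that(2)]]
      by (simp add: less_eq_int_lex_def plus_int_lex_def)
    have Fmem: "F p \<in> chang.\<Gamma>" if "p \<in> chang.\<Gamma>" for p using that onto by blast
    define q where "q = tail (F w)"
    \<comment> \<open>Twice the generator is still infinitesimal, so its image lies in \<Gamma> and
      has integer part at most 1; hence the integer part of \<open>F w\<close> cannot be 1.\<close>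
    have "F w + F w = F (Int_Lex 0 2)" using add[of 1 1] by (simp add: w_def)
    then have "int_part (F w) + int_part (F w) = int_part (F (Int_Lex 0 2))"
      by (metis int_lex_simps(3))
    then have "int_part (F w) = 0"
      using Fmem[OF w] Fmem[OF inf[of 2]] unfolding mem by auto
    then have Fw: "F w = Int_Lex 0 q" by (simp add: q_def int_lex.expand)
    have Fn: "F (Int_Lex 0 (int n)) = Int_Lex 0 (int n * q)" for n
    proof (induction n)
      case 0
      then show ?case using F0 by (simp add: zero_int_lex_def)
    next
      case (Suc n)
      have "F (Int_Lex 0 (int n + 1)) = F (Int_Lex 0 (int n)) + F w"
        using add[of "int n" 1] by (simp add: w_def)
      also have "\<dots> = Int_Lex 0 (int n * q + q)" by (simp add: Suc Fw plus_int_lex_def)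
      finally show ?case by (simp add: algebra_simps)
    qed
    have F_inf: "F p = Int_Lex 0 (tail p * q)" if "int_part p = 0" "0 \<le> tail p" for p
    proof -
      have "p = Int_Lex 0 (int (nat (tail p)))" using that by (simp add: int_lex.expand)
      then show ?thesis using Fn[of "nat (tail p)"] that by (metis int_nat_eq)
    qed
    have F_coinf: "F p = Int_Lex 1 (tail p * q)" if "int_part p = 1" "tail p \<le> 0" for p
    proof -
      have p: "p = Int_Lex 1 0 - Int_Lex 0 (- tail p)" using that by (simp add: int_lex.expand)
      have "F p = Int_Lex 1 0 - F (Int_Lex 0 (- tail p))"
        by (subst p, rule Fneg, rule inf) (use that in simp)
      then show ?thesis using F_inf[of "Int_Lex 0 (- tail p)"] that by (simp add: minus_int_lex_def)
    qed
    have "q \<noteq> 0"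
    proof
      assume "q = 0"
      then have zero: "tail (F p) = 0" if "p \<in> chang.\<Gamma>" for p
        using that F_inf[of p] F_coinf[of p] unfolding mem by auto
      have "w \<in> F ` chang.\<Gamma>" unfolding onto by (rule w)
      then obtain p where "p \<in> chang.\<Gamma>" "w = F p" by (rule imageE)
      then have "tail w = 0" using zero by simp
      then show False by (simp add: w_def)
    qed
    then have "p = p'" if "p \<in> chang.\<Gamma>" "p' \<in> chang.\<Gamma>" "F p = F p'" for p p'
      using that F_inf[of p] F_coinf[of p] F_inf[of p'] F_coinf[of p'] unfolding mem
      by (auto intro: int_lex.expand)
    then show ?thesis by (rule inj_onI)
  qed
  show "mv_hopfian chang.A" "ul_hopfian chang.G"
    by - (rule chang.hopfianI[OF inj]; assumption)+
qed

lemma chang_not_semisimple: "\<not> mv_semisimple chang.A" "\<not> ul_semisimple chang.G"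
  using chang.not_semisimple[of 1] by simp_all

section \<open>Eventually affine sequences as infinitesimals\<close>

definition ev_affine :: "(nat \<Rightarrow> int) set" where
  "ev_affine = {x. \<exists>p q. \<forall>\<^sub>F n in sequentially. x n = p + q * int n}"

lemma ev_affineI: "\<forall>\<^sub>F n in sequentially. x n = p + q * int n \<Longrightarrow> x \<in> ev_affine"
  by (auto simp: ev_affine_def)

text \<open>An eventual sign of the difference makes the supremum of two eventually affine sequences
  finally agree with one of them.\<close>

lemma affine_eventually_compare:
  fixes p q :: int
  shows "(\<forall>\<^sub>F n in sequentially. p + q * int n \<ge> 0) \<or> (\<forall>\<^sub>F n in sequentially. p + q * int n \<le> 0)"
proof (cases q "0::int" rule: linorder_cases)
  case less
  have "p + q * int n \<le> 0" if "n \<ge> nat p" for n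
    using that less mult_right_mono[of q "-1" "int n"] by simp
  then show ?thesis unfolding eventually_sequentially by blast
next
  case greater
  have "p + q * int n \<ge> 0" if "n \<ge> nat (- p)" for n
    using that greater mult_right_mono[of 1 q "int n"] by simp
  then show ?thesis unfolding eventually_sequentially by blast
qed (cases "p \<ge> 0"; simp)

text \<open>Only \<open>s 0\<close> is inspected: a negative value selects the integer part, a
  nonnegative one indexes the tail through its floor.\<close>

definition encode_ev_affine :: "(nat \<Rightarrow> int) int_lex \<Rightarrow> universe" where
  "encode_ev_affine p = (\<lambda>s. if s 0 < 0 then int_part p else tail p (nat \<lfloor>s 0\<rfloor>))"

lemma inj_encode_ev_affine: "inj encode_ev_affine"
proof (rule injI)
  fix p q assume eq: "encode_ev_affine p = encode_ev_affine q"
  have "int_part p = int_part q"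
    using fun_cong[OF eq, of "\<lambda>_. -1"] by (simp add: encode_ev_affine_def)
  moreover have "tail p = tail q"
  proof
    show "tail p n = tail q n" for n
      using fun_cong[OF eq, of "\<lambda>_. real n"] by (simp add: encode_ev_affine_def)
  qed
  ultimately show "p = q" by (rule int_lex.expand[OF conjI])
qed

interpretation affine: int_lex_algebra ev_affine encode_ev_affine
proof
  show "0 \<in> ev_affine" by (rule ev_affineI[of _ 0 0]) simp
  fix x y assume "x \<in> ev_affine" "y \<in> ev_affine"
  then obtain p q p' q' where
    x: "\<forall>\<^sub>F n in sequentially. x n = p + q * int n" and
    y: "\<forall>\<^sub>F n in sequentially. y n = p' + q' * int n"
    by (auto simp: ev_affine_def)
  from x y have "\<forall>\<^sub>F n in sequentially. (x - y) n = (p - p') + (q - q') * int n"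
    by eventually_elim (simp add: algebra_simps)
  then show "x - y \<in> ev_affine" by (rule ev_affineI)
  from affine_eventually_compare[of "p - p'" "q - q'"]
  consider "\<forall>\<^sub>F n in sequentially. (p - p') + (q - q') * int n \<ge> 0"
    | "\<forall>\<^sub>F n in sequentially. (p - p') + (q - q') * int n \<le> 0" by blast
  then show "sup x y \<in> ev_affine"
  proof cases
    case 1
    with x y have "\<forall>\<^sub>F n in sequentially. sup x y n = p + q * int n"
      by eventually_elim (simp add: algebra_simps sup_int_def)
    then show ?thesis by (rule ev_affineI)
  next
    case 2
    with x y have "\<forall>\<^sub>F n in sequentially. sup x y n = p' + q' * int n"
      by eventually_elim (simp add: algebra_simps sup_int_def)
    then show ?thesis by (rule ev_affineI)
  qed
qed (rule inj_encode_ev_affine universe_real_embeds)+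

lemma ev_affine_shift: "x \<in> ev_affine \<Longrightarrow> (\<lambda>n. x (Suc n)) \<in> ev_affine"
proof -
  assume "x \<in> ev_affine"
  then obtain p q where "\<forall>\<^sub>F n in sequentially. x n = p + q * int n" by (auto simp: ev_affine_def)
  then have "\<forall>\<^sub>F n in sequentially. x (Suc n) = p + q * int (Suc n)"
    by (rule eventually_sequentially_Suc[THEN iffD2])
  then have "\<forall>\<^sub>F n in sequentially. x (Suc n) = (p + q) + q * int n"
    by eventually_elim (simp add: algebra_simps)
  then show ?thesis by (rule ev_affineI)
qed

text \<open>This provides preimages under the shift: truncated subtraction repeats the entry at
  index 0, and the shift removes the extra copy.\<close>

lemma ev_affine_unshift: "x \<in> ev_affine \<Longrightarrow> (\<lambda>n. x (n - 1)) \<in> ev_affine"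
proof -
  assume "x \<in> ev_affine"
  then obtain p q where "\<forall>\<^sub>F n in sequentially. x n = p + q * int n" by (auto simp: ev_affine_def)
  then have "\<forall>\<^sub>F n in sequentially. x (Suc n - 1) = (p - q) + q * int (Suc n)"
    by eventually_elim (simp add: algebra_simps)
  then have "\<forall>\<^sub>F n in sequentially. x (n - 1) = (p - q) + q * int n"
    by (rule eventually_sequentially_Suc[THEN iffD1])
  then show ?thesis by (rule ev_affineI)
qed

lemma affine_not_hopfian: "\<not> mv_hopfian affine.A" "\<not> ul_hopfian affine.G"
proof -
  define F where "F p = Int_Lex (int_part p) (\<lambda>n. tail p (Suc n))" for p :: "(nat \<Rightarrow> int) int_lex"
  let ?S = "{p. tail p \<in> ev_affine}" and ?e = "\<lambda>n::nat. if n = 0 then 1 else 0 :: int"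
  have hom: "unital_hom ?S (Int_Lex 1 0) ?S (Int_Lex 1 0) F"
    by (auto simp: unital_hom_def F_def ev_affine_shift minus_int_lex_def sup_int_lex_def fun_eq_iff)
  have onto: "F ` ?S = ?S"
  proof (intro equalityI subsetI)
    fix p assume "p \<in> ?S"
    then have "Int_Lex (int_part p) (\<lambda>n. tail p (n - 1)) \<in> ?S" by (simp add: ev_affine_unshift del: One_nat_def)
    moreover have "p = F (Int_Lex (int_part p) (\<lambda>n. tail p (n - 1)))"
      by (simp add: F_def)
    ultimately show "p \<in> F ` ?S" by blast
  qed (auto simp: F_def ev_affine_shift)
  have e: "?e \<in> ev_affine"
    by (rule ev_affineI[of _ 0 0]) (auto simp: eventually_sequentially intro!: exI[of _ 1])
  have not_inj: "\<not> inj_on F ?S"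
  proof
    assume inj: "inj_on F ?S"
    have "Int_Lex 0 ?e = 0"
      by (rule inj_onD[OF inj]) (use e affine.zero in \<open>auto simp: F_def fun_eq_iff\<close>)
    then have "tail (Int_Lex 0 ?e) 0 = tail 0 (0::nat)" by (rule arg_cong[where f = "\<lambda>p. tail p 0"])
    then show False by simp
  qed
  show "\<not> mv_hopfian affine.A" "\<not> ul_hopfian affine.G"
    by - (rule affine.not_hopfianI[OF hom onto not_inj])+
qed

text \<open>Truncated subtraction produces ramps from the identity sequence, indicators of initial
  segments from ramps, and unit vectors from these indicators.\<close>

lemma affine_finitely_generated:
  "mv_finitely_generated affine.A" "ul_finitely_generated affine.G"
proof -
  have gen: "{x \<in> ev_affine. 0 \<le> x} \<subseteq> B"
    if B: "{\<lambda>_. 1, int} \<subseteq> B" "0 \<in> B" and add: "\<And>x y. \<lbrakk>x \<in> B; y \<in> B\<rbrakk> \<Longrightarrow> x + y \<in> B"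
      and monus: "\<And>x y. \<lbrakk>x \<in> B; y \<in> B\<rbrakk> \<Longrightarrow> sup (x - y) 0 \<in> B"
    for B :: "(nat \<Rightarrow> int) set"
  proof
    have monus': "(\<lambda>n. max (x n - y n) 0) \<in> B" if "x \<in> B" "y \<in> B" for x y
      using monus[OF that] by (simp add: sup_fun_def sup_int_def zero_fun_def)
    have mult: "(\<lambda>n. int m * x n) \<in> B" if "x \<in> B" for m x
    proof (induction m)
      case 0
      then show ?case using B(2) by (simp add: zero_fun_def)
    next
      case (Suc m)
      have "(\<lambda>n. int (Suc m) * x n) = (\<lambda>n. int m * x n) + x" by (auto simp: algebra_simps)
      then show ?case using add[OF Suc that] by simp
    qed
    have one: "(\<lambda>_. 1) \<in> B" and id: "int \<in> B" using B(1) by auto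
    have ramp: "(\<lambda>n. max (int n - int K) 0) \<in> B" for K
      using monus'[OF id mult[OF one, of K]] by simp
    have less: "(\<lambda>n. if n < K then 1 else 0) \<in> B" for K
    proof (cases K)
      case 0
      then show ?thesis using B(2) by (simp add: zero_fun_def)
    next
      case (Suc k)
      \<comment> \<open>The integer ramp starting at \<open>k\<close> is 0 up to \<open>k\<close>
        and at least 1 afterwards, so subtracting it from 1 leaves the indicator of
        \<open>n \<le> k\<close>, that is of \<open>n < K\<close>.\<close>
      have "(\<lambda>n. max (1 - max (int n - int k) 0) 0) = (\<lambda>n. if n < K then 1 else 0)"
        using Suc by auto
      then show ?thesis using monus'[OF one ramp[of k]] by simp
    qed
    have ge: "(\<lambda>n. if K \<le> n then 1 else 0) \<in> B" for K
    proof -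
      have "(\<lambda>n. max (1 - (if n < K then 1 else 0)) 0) = (\<lambda>n. if K \<le> n then 1 else (0::int))" by auto
      then show ?thesis using monus'[OF one less[of K]] by simp
    qed
    have single: "(\<lambda>n. if n = K then 1 else 0) \<in> B" for K
    proof -
      have "(\<lambda>n. max ((if n < Suc K then 1 else 0) - (if n < K then 1 else 0)) 0) =
        (\<lambda>n. if n = K then 1 else (0::int))" by auto
      then show ?thesis using monus'[OF less[of "Suc K"] less[of K]] by simp
    qed
    fix x assume "x \<in> {x \<in> ev_affine. 0 \<le> x}"
    then obtain p q N where N: "\<And>n. n \<ge> N \<Longrightarrow> x n = p + q * int n" and nonneg: "\<And>n. 0 \<le> x n"
      by (auto simp: ev_affine_def eventually_sequentially le_fun_def)
    have initial: "(\<lambda>n. if n < M then x n else 0) \<in> B" for M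
    proof (induction M)
      case 0
      then show ?case using B(2) by (simp add: zero_fun_def)
    next
      case (Suc M)
      have eq: "(\<lambda>n. if n < Suc M then x n else 0) =
        (\<lambda>n. if n < M then x n else 0) + (\<lambda>n. int (nat (x M)) * (if n = M then 1 else 0))"
        using nonneg by (auto simp: fun_eq_iff less_Suc_eq)
      show ?case unfolding eq by (rule add[OF Suc mult[OF single]])
    qed
    have "q \<ge> 0"
    proof (rule ccontr)
      assume "\<not> q \<ge> 0"
      \<comment> \<open>From \<open>N\<close> on the affine formula is valid, and beyond
        \<open>p\<close> a slope of at most -1 makes it negative.\<close>
      define M where "M = max N (nat p + 1)"
      have "N \<le> M" "p < int M" by (auto simp: M_def)
      moreover have "q * int M \<le> (-1) * int M"
        using \<open>\<not> q \<ge> 0\<close> by (intro mult_right_mono) auto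
      ultimately show False using N[of M] nonneg[of M] by linarith
    qed
    \<comment> \<open>From \<open>N\<close> on the sequence is its value at \<open>N\<close> plus
      \<open>q\<close> times the distance from \<open>N\<close>; \<open>nat\<close> is harmless as
      both coefficients are nonnegative.\<close>
    then have eq: "x = (\<lambda>n. if n < N then x n else 0) + (\<lambda>n. int (nat q) * max (int n - int N) 0) +
      (\<lambda>n. int (nat (x N)) * (if N \<le> n then 1 else 0))"
      using N nonneg[of N] by (auto simp: fun_eq_iff algebra_simps not_less)
    show "x \<in> B"
      by (subst eq) (rule add[OF add[OF initial mult[OF ramp]] mult[OF ge]])
  qed
  have mem: "{\<lambda>_. 1, int} \<subseteq> ev_affine"
    using ev_affineI[of "\<lambda>_. 1" 1 0] ev_affineI[of int 0 1] by simp
  have nonneg: "0 \<le> x" if "x \<in> {\<lambda>_. 1, int}" for x :: "nat \<Rightarrow> int"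
    using that by (auto simp: le_fun_def)
  show "mv_finitely_generated affine.A" "ul_finitely_generated affine.G"
    by - (rule affine.int_lex_finitely_generated[OF _ mem nonneg], simp, assumption, (rule gen; assumption))+
qed

lemma affine_not_semisimple: "\<not> mv_semisimple affine.A" "\<not> ul_semisimple affine.G"
proof -
  have *: "(\<lambda>_. 1) \<in> ev_affine" by (rule ev_affineI[of _ 1 0]) simp
  have **: "0 \<le> (\<lambda>_::nat. 1::int)" "(\<lambda>_::nat. 1::int) \<noteq> 0" by (auto simp: le_fun_def fun_eq_iff)
  show "\<not> mv_semisimple affine.A" "\<not> ul_semisimple affine.G"
    by - (rule affine.not_semisimple[OF * **])+
qed

section \<open>Algebras of bounded sequences\<close>

context encoded
begin

lemma gamma_endo_mono:
  assumes F: "gamma_endo F" and xy: "x \<in> \<Gamma>" "y \<in> \<Gamma>" "x \<le> y"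
  shows "F x \<le> F y"
proof -
  have d: "y - x \<in> \<Gamma>" using xy by (auto simp: diff_le_eq add_increasing2)
  have "F (x + (y - x)) = F x + F (y - x)"
    by (rule gamma_endo_add[OF F xy(1) d]) (use xy in simp)
  moreover have "F (y - x) \<in> \<Gamma>" using F d unfolding gamma_endo_def by blast
  ultimately show ?thesis by simp
qed

lemma gamma_endo_kernel:
  assumes F: "gamma_endo F"
  shows "gamma_ideal {x \<in> \<Gamma>. F x = 0}"
proof -
  have F0: "F 0 = 0" and neg: "\<And>x. x \<in> \<Gamma> \<Longrightarrow> F (u - x) = u - F x"
    and oplus: "\<And>x y. \<lbrakk>x \<in> \<Gamma>; y \<in> \<Gamma>\<rbrakk> \<Longrightarrow> F (x \<boxplus> y) = F x \<boxplus> F y" and mem: "\<And>x. x \<in> \<Gamma> \<Longrightarrow> F x \<in> \<Gamma>"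
    using F unfolding gamma_endo_def by blast+
  have zero: "0 \<in> \<Gamma>" by simp
  have "F u \<noteq> 0" using neg[OF zero] F0 unit_nonzero by simp
  moreover have "x \<boxplus> y \<in> {x \<in> \<Gamma>. F x = 0}" if "x \<in> {x \<in> \<Gamma>. F x = 0}" "y \<in> {x \<in> \<Gamma>. F x = 0}" for x y
    using that oplus[of x y] oplus_mem[of x y] by (simp add: inf.absorb1)
  moreover have "y \<in> {x \<in> \<Gamma>. F x = 0}" if "x \<in> {x \<in> \<Gamma>. F x = 0}" "y \<in> \<Gamma>" "y \<le> x" for x y
    using that mem[of y] gamma_endo_mono[OF F, of y x] by (auto intro: antisym)
  ultimately show ?thesis
    unfolding gamma_ideal_def using zero F0 by blast
qed

text \<open>Equal images make the images of both MV-differences of \<open>x\<close> and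
  \<open>y\<close> vanish; with a trivial kernel the differences themselves vanish, which gives both
  inequalities.\<close>

lemma gamma_endo_inj:
  assumes F: "gamma_endo F" and ker: "\<And>x. \<lbrakk>x \<in> \<Gamma>; F x = 0\<rbrakk> \<Longrightarrow> x = 0"
  shows "inj_on F \<Gamma>"
proof -
  have le: "x \<le> y" if xy: "x \<in> \<Gamma>" "y \<in> \<Gamma>" "F x = F y" for x y
  proof -
    have neg: "\<And>x. x \<in> \<Gamma> \<Longrightarrow> F (u - x) = u - F x"
      and oplus: "\<And>x y. \<lbrakk>x \<in> \<Gamma>; y \<in> \<Gamma>\<rbrakk> \<Longrightarrow> F (x \<boxplus> y) = F x \<boxplus> F y"
      using F unfolding gamma_endo_def by blast+
    have neg_mem: "u - z \<in> \<Gamma>" if "z \<in> \<Gamma>" for z using that by simp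
    have nx: "u - x \<in> \<Gamma>" by (rule neg_mem[OF xy(1)])
    have m: "(u - x) \<boxplus> y \<in> \<Gamma>" by (rule oplus_mem[OF nx xy(2)])
    then have mem: "u - ((u - x) \<boxplus> y) \<in> \<Gamma>" by (rule neg_mem)
    have "F (u - ((u - x) \<boxplus> y)) = u - ((u - F x) \<boxplus> F y)"
      using neg[OF m] oplus[OF nx xy(2)] neg[OF xy(1)] by (simp only:)
    also have "\<dots> = 0" using xy(3) by simp
    finally have "u - ((u - x) \<boxplus> y) = 0" by (rule ker[OF mem])
    then have "sup (x - y) 0 = 0" unfolding neg_oplus .
    then have "x - y \<le> 0" by (metis sup.cobounded1)
    then show ?thesis by simp
  qed
  show ?thesis
  proof (rule inj_onI)
    fix x y assume xy: "x \<in> \<Gamma>" "y \<in> \<Gamma>" "F x = F y"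
    show "x = y" by (rule antisym[OF le[OF xy] le[OF xy(2,1) xy(3)[symmetric]]])
  qed
qed

end

text \<open>When \<open>u\<close> itself is isolating, every proper ideal lies in the kernel of
  \<open>h\<close>, here zero. The kernel of an endomorphism is such an ideal, so all endomorphisms
  are injective.\<close>

lemma (in large_encoded) simple_hopfian:
  assumes h: "isolating h u" and inj: "\<And>x. \<lbrakk>x \<in> \<Gamma>; h x = 0\<rbrakk> \<Longrightarrow> x = 0"
  shows "mv_hopfian A" "ul_hopfian G"
proof -
  have *: "inj_on F \<Gamma>" if F: "gamma_endo F" for F
  proof (rule gamma_endo_inj[OF F])
    fix x assume x: "x \<in> \<Gamma>" "F x = 0"
    have "u \<notin> {x \<in> \<Gamma>. F x = 0}" by (rule gamma_idealD(3)[OF gamma_endo_kernel[OF F]])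
    then have "h x = 0"
      using isolating_gamma_ideal[OF h gamma_endo_kernel[OF F]] x by blast
    then show "x = 0" by (rule inj[OF x(1)])
  qed
  show "mv_hopfian A" "ul_hopfian G"
    by - (rule hopfianI, rule *, assumption)+
qed

section \<open>Sequences with the constant sequence 1 as unit\<close>

definition encode_seq :: "(nat \<Rightarrow> real) \<Rightarrow> universe" where
  "encode_seq x = (\<lambda>s. x (nat \<lfloor>s 0\<rfloor>))"

lemma inj_encode_seq: "inj encode_seq"
proof (rule injI, rule ext)
  fix x y n assume "encode_seq x = encode_seq y"
  from fun_cong[OF this, of "\<lambda>_. real n"] show "x n = y n" by (simp add: encode_seq_def)
qed

abbreviation single :: "nat \<Rightarrow> nat \<Rightarrow> real" where
  "single i \<equiv> \<lambda>n. if n = i then 1 else 0"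

locale seq_algebra =
  fixes S :: "(nat \<Rightarrow> real) set"
  assumes one: "1 \<in> S"
    and diff: "\<lbrakk>x \<in> S; y \<in> S\<rbrakk> \<Longrightarrow> x - y \<in> S"
    and sup: "\<lbrakk>x \<in> S; y \<in> S\<rbrakk> \<Longrightarrow> sup x y \<in> S"
    and bounded: "x \<in> S \<Longrightarrow> Bseq x"
begin

lemma one_multiple: "((+) 1 ^^ n) 0 = (\<lambda>_::nat. real n)"
  by (induction n) (auto simp: fun_eq_iff)

sublocale large_encoded S 1 encode_seq
proof
  show "0 \<in> S" using diff[OF one one] by simp
  fix x assume "x \<in> S"
  then obtain K where "\<And>n. norm (x n) \<le> K" using bounded by (meson BseqE)
  moreover obtain N :: nat where "K \<le> real N" using real_arch_simple by blast
  ultimately have "x n \<le> real N" for n by (smt (verit) real_norm_def)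
  then have "x \<le> ((+) 1 ^^ N) 0" unfolding one_multiple by (simp add: le_fun_def)
  then show "\<exists>n. x \<le> ((+) 1 ^^ n) 0" ..
qed (auto simp: inj_encode_seq universe_real_embeds one diff sup le_fun_def)

notation oplus (infixl "\<boxplus>" 65)

lemma gamma_seq_iff: "x \<in> \<Gamma> \<longleftrightarrow> x \<in> S \<and> (\<forall>n. 0 \<le> x n \<and> x n \<le> 1)"
  by (auto simp: le_fun_def)

lemma state_eval: "state (\<lambda>x. x i)"
  by (simp add: unital_hom_def sup_fun_def)

text \<open>Entries in \<Gamma> are nonnegative, so the unit vector is the least element with entry
  1 at \<open>i\<close>.\<close>

lemma isolating_single:
  assumes "single i \<in> S"
  shows "isolating (\<lambda>x. x i) (single i)"
proof -
  have "single i \<in> \<Gamma>" using assms by (simp add: gamma_seq_iff del: Int_iff)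
  moreover have "single i \<le> x" if "x \<in> \<Gamma>" "x i = 1" for x
    using that by (auto simp: le_fun_def)
  ultimately show ?thesis unfolding isolating_def using state_eval by simp
qed

lemma seq_semisimple:
  assumes "\<And>i. single i \<in> S"
  shows "mv_semisimple A" "ul_semisimple G"
  by - (rule semisimpleI[of "range (\<lambda>i. (\<lambda>x. x i, single i))"];
    use isolating_single[OF assms] in \<open>auto simp: fun_eq_iff\<close>)+

end

text \<open>The induction step rests on the identity
  \<open>clamp (t + z) = (clamp t \<oplus> z) \<odot> clamp (t + 1)\<close> for \<open>0 \<le> z \<le> 1\<close>.\<close>

lemma clamp_affine_mem:
  fixes B :: "(nat \<Rightarrow> real) set"
  assumes zero: "(\<lambda>_. 0) \<in> B"
    and oplus: "\<And>x y. \<lbrakk>x \<in> B; y \<in> B\<rbrakk> \<Longrightarrow> (\<lambda>n. min (x n + y n) 1) \<in> B"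
    and neg: "\<And>x. x \<in> B \<Longrightarrow> (\<lambda>n. 1 - x n) \<in> B"
    and bounds: "\<And>x n. x \<in> B \<Longrightarrow> 0 \<le> x n \<and> x n \<le> 1"
    and a: "a \<in> B" and b: "b \<in> B"
  shows "(\<lambda>n. min (max (of_int p + of_int q * a n + of_int r * b n) 0) 1) \<in> B"
proof -
  \<comment> \<open>All integer offsets are treated at once because the step at offset
    \<open>p\<close> uses the clamped sequences at \<open>p\<close> and at
    \<open>p + 1\<close>.\<close>
  define P where "P f \<longleftrightarrow> (\<forall>p::int. (\<lambda>n. min (max (of_int p + f n) 0) 1) \<in> B)" for f :: "nat \<Rightarrow> real"
  have add: "P (\<lambda>n. f n + z n)" if f: "P f" and z: "z \<in> B" for f z
    unfolding P_def
  proof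
    fix p :: int
    let ?x = "\<lambda>n. min (min (max (of_int p + f n) 0) 1 + z n) 1"
    let ?y = "\<lambda>n. min (max (of_int (p + 1) + f n) 0) 1"
    have f': "(\<lambda>n. min (max (of_int q + f n) 0) 1) \<in> B" for q :: int using f unfolding P_def by blast
    have xy: "?x \<in> B" "?y \<in> B" by (rule oplus[OF f' z], rule f')
    have mem: "(\<lambda>n. 1 - min ((1 - ?x n) + (1 - ?y n)) 1) \<in> B"
      by (rule neg[OF oplus[OF neg[OF xy(1)] neg[OF xy(2)]]])
    have eq: "1 - min ((1 - ?x n) + (1 - ?y n)) 1 = min (max (of_int p + (f n + z n)) 0) 1" for n
      using bounds[OF z, of n] by (auto simp: min_def max_def)
    show "(\<lambda>n. min (max (of_int p + (f n + z n)) 0) 1) \<in> B"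
      using mem unfolding eq .
  qed
  have uminus: "P (\<lambda>n. - f n)" if f: "P f" for f
    unfolding P_def
  proof
    fix p :: int
    \<comment> \<open>Reflection turns the clamp of \<open>t\<close> into the clamp of
      \<open>1 - t\<close>, so the offset \<open>1 - p\<close> is the one that yields
      \<open>p - f n\<close>.\<close>
    have mem: "(\<lambda>n. 1 - min (max (of_int (1 - p) + f n) 0) 1) \<in> B"
      by (rule neg[OF f[unfolded P_def, rule_format]])
    have eq: "1 - min (max (of_int (1 - p) + f n) 0) 1 = min (max (of_int p + - f n) 0) 1" for n
      by (auto simp: min_def max_def)
    show "(\<lambda>n. min (max (of_int p + - f n) 0) 1) \<in> B"
      using mem unfolding eq .
  qed
  have nat_mult: "P (\<lambda>n. f n + of_nat m * z n)" if "P f" "z \<in> B" for f z m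
  proof (induction m)
    case (Suc m)
    have eq: "(\<lambda>n. f n + of_nat m * z n + z n) = (\<lambda>n. f n + of_nat (Suc m) * z n)"
      by (auto simp: algebra_simps)
    show ?case using add[OF Suc \<open>z \<in> B\<close>] unfolding eq .
  qed (use that in simp)
  have mult: "P (\<lambda>n. f n + of_int m * z n)" if f: "P f" and z: "z \<in> B" for f z m
  proof (cases "m \<ge> 0")
    case True
    then show ?thesis using nat_mult[OF f z, of "nat m"] by simp
  next
    case False
    \<comment> \<open>Only nonnegative multiples of \<open>z\<close> can be added so far; a negative
      multiple is obtained by adding to \<open>- f\<close> and negating.\<close>
    then have "(\<lambda>n. - (- f n + of_nat (nat (- m)) * z n)) = (\<lambda>n. f n + of_int m * z n)" by auto
    then show ?thesis using uminus[OF nat_mult[OF uminus[OF f] z, of "nat (- m)"]] by simp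
  qed
  have one: "(\<lambda>_. 1) \<in> B" using neg[OF zero] by simp
  have "P (\<lambda>_. 0)"
    unfolding P_def
  proof
    fix p :: int
    have "p \<le> 0 \<or> p \<ge> 1" by linarith
    then show "(\<lambda>n::nat. min (max (of_int p + 0) 0) 1 :: real) \<in> B"
      using zero one by (auto simp: min_def max_def)
  qed
  from mult[OF mult[OF this a, of q] b, of r] show ?thesis
    unfolding P_def by (simp add: add.assoc)
qed

section \<open>The ring \<int>[\<surd>2] and its unit \<theta>\<close>

definition zsqrt2 :: "real set" where
  "zsqrt2 = {of_int p + of_int q * sqrt 2 |p q. True}"

lemma zsqrt2I: "of_int p + of_int q * sqrt 2 \<in> zsqrt2"
  by (auto simp: zsqrt2_def)

lemma zsqrt2_of_int [simp, intro]: "of_int p \<in> zsqrt2"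
  using zsqrt2I[of p 0] by simp

lemma zsqrt2_zero_one [simp, intro]: "0 \<in> zsqrt2" "1 \<in> zsqrt2"
  using zsqrt2_of_int[of 0] zsqrt2_of_int[of 1] by simp_all

lemma zsqrt2_diff [intro]: "\<lbrakk>x \<in> zsqrt2; y \<in> zsqrt2\<rbrakk> \<Longrightarrow> x - y \<in> zsqrt2"
proof -
  assume "x \<in> zsqrt2" "y \<in> zsqrt2"
  then obtain p q p' q' :: int where "x = p + q * sqrt 2" "y = p' + q' * sqrt 2"
    by (auto simp: zsqrt2_def)
  then have "x - y = of_int (p - p') + of_int (q - q') * sqrt 2" by (simp add: algebra_simps)
  then show ?thesis by (metis zsqrt2I)
qed

lemma zsqrt2_mult [intro]: "\<lbrakk>x \<in> zsqrt2; y \<in> zsqrt2\<rbrakk> \<Longrightarrow> x * y \<in> zsqrt2"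
proof -
  assume "x \<in> zsqrt2" "y \<in> zsqrt2"
  then obtain p q p' q' :: int where "x = p + q * sqrt 2" "y = p' + q' * sqrt 2"
    by (auto simp: zsqrt2_def)
  then have "x * y = of_int (p * p' + 2 * q * q') + of_int (p * q' + q * p') * sqrt 2"
    by (simp add: algebra_simps)
  then show ?thesis by (metis zsqrt2I)
qed

lemma zsqrt2_power [intro]: "x \<in> zsqrt2 \<Longrightarrow> x ^ n \<in> zsqrt2"
  by (induction n) auto

definition contraction :: real where "contraction = sqrt 2 - 1"

text \<open>By the second bound a power sequence scaled to the value 2 at some index is below 1 from
  the next index on, which lets clamping cut out initial segments.\<close>

lemma contraction_bounds: "0 < contraction" "2 * contraction < 1"
proof -
  have "sqrt 2 < sqrt ((3 / 2)\<^sup>2)" by (rule real_sqrt_less_mono) (simp add: power2_eq_square)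
  then show "2 * contraction < 1" by (simp add: contraction_def)
qed (simp add: contraction_def)

lemma contraction_less_one: "contraction < 1"
  using contraction_bounds by simp

lemma contraction_zsqrt2 [simp, intro]: "contraction \<in> zsqrt2" "1 / contraction \<in> zsqrt2"
proof -
  show "contraction \<in> zsqrt2" using zsqrt2I[of "-1" 1] by (simp add: contraction_def)
  have "1 / contraction = 1 + sqrt 2" using contraction_bounds
    by (simp add: field_simps contraction_def)
  then show "1 / contraction \<in> zsqrt2" using zsqrt2I[of 1 1] by simp
qed

text \<open>Unlike \<open>sqrt 2\<close>, the basis element \<open>contraction\<close> lies in
  \<open>[0, 1]\<close> and can serve as a generator in \<Gamma>.\<close>

lemma zsqrt2_contraction:
  assumes "c \<in> zsqrt2"
  obtains p q :: int where "c = p + q * contraction"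
proof -
  obtain p q :: int where "c = p + q * sqrt 2" using assms by (auto simp: zsqrt2_def)
  then have "c = of_int (p + q) + of_int q * contraction" by (simp add: contraction_def algebra_simps)
  then show thesis using that by blast
qed

lemma infinite_contraction_powers: "infinite (range (\<lambda>n. contraction ^ n))"
proof (rule range_inj_infinite, rule injI)
  fix m n assume "contraction ^ m = contraction ^ n"
  then show "m = n" using contraction_bounds contraction_less_one by (simp add: power_inject_exp')
qed

section \<open>The algebras in which finite rank is not dense\<close>

context seq_algebra
begin

lemma seq_finitely_generatedI:
  assumes X: "finite X" "X \<subseteq> \<Gamma>"
    and gen: "\<And>B. \<lbrakk>X \<subseteq> B; (\<lambda>_. 0) \<in> B; \<And>x y. \<lbrakk>x \<in> B; y \<in> B\<rbrakk> \<Longrightarrow> (\<lambda>n. min (x n + y n) 1) \<in> B;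
      \<And>x. x \<in> B \<Longrightarrow> (\<lambda>n. 1 - x n) \<in> B; \<And>x n. x \<in> B \<Longrightarrow> 0 \<le> x n \<and> x n \<le> 1\<rbrakk> \<Longrightarrow> \<Gamma> \<subseteq> B"
  shows "mv_finitely_generated A" "ul_finitely_generated G"
proof -
  have *: "\<Gamma> \<subseteq> B"
    if B: "X \<subseteq> B" "B \<subseteq> \<Gamma>" "0 \<in> B" "\<And>x y. \<lbrakk>x \<in> B; y \<in> B\<rbrakk> \<Longrightarrow> x \<boxplus> y \<in> B"
      "\<And>x. x \<in> B \<Longrightarrow> 1 - x \<in> B" for B
  proof (rule gen[OF B(1)])
    show "(\<lambda>_. 0) \<in> B" using B(3) by (simp add: zero_fun_def)
    show "(\<lambda>n. min (x n + y n) 1) \<in> B" if "x \<in> B" "y \<in> B" for x y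
      using B(4)[OF that] by (simp add: inf_fun_def inf_real_def)
    show "(\<lambda>n. 1 - x n) \<in> B" if "x \<in> B" for x
      using B(5)[OF that] by (simp add: fun_diff_def)
    show "0 \<le> x n \<and> x n \<le> 1" if "x \<in> B" for x n
    proof -
      have "x \<in> \<Gamma>" using B(2) that by (rule subsetD)
      then show ?thesis unfolding gamma_seq_iff by blast
    qed
  qed
  show "mv_finitely_generated A" "ul_finitely_generated G"
    by - (rule finitely_generatedI[OF X], rule *, assumption+)+
qed

lemma shift_not_hopfian:
  assumes "single 0 \<in> S" and shift: "\<And>x. x \<in> S \<Longrightarrow> (\<lambda>n. x (Suc n)) \<in> S"
    and unshift: "\<And>x. x \<in> S \<Longrightarrow> \<exists>y\<in>S. \<forall>n. y (Suc n) = x n"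
  shows "\<not> mv_hopfian A" "\<not> ul_hopfian G"
proof -
  define F :: "(nat \<Rightarrow> real) \<Rightarrow> nat \<Rightarrow> real" where "F x = (\<lambda>n. x (Suc n))" for x
  have hom: "unital_hom S 1 S 1 F"
    by (auto simp: unital_hom_def F_def shift sup_fun_def fun_eq_iff)
  have onto: "F ` S = S"
  proof (intro equalityI subsetI)
    fix x assume "x \<in> S"
    then obtain y where "y \<in> S" "\<forall>n. y (Suc n) = x n" using unshift by blast
    then show "x \<in> F ` S" by (intro image_eqI[of _ _ y]) (auto simp: F_def)
  qed (auto simp: F_def shift)
  have not_inj: "\<not> inj_on F S"
  proof
    assume inj: "inj_on F S"
    have "single 0 = 0"
      by (rule inj_onD[OF inj]) (use assms(1) zero_mem in \<open>auto simp: F_def\<close>)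
    from fun_cong[OF this, of 0] show False by simp
  qed
  show "\<not> mv_hopfian A" "\<not> ul_hopfian G"
    by - (rule not_hopfianI[OF hom onto not_inj])+
qed

end

section \<open>The simple algebra \<int>[\<surd>2] as constant sequences\<close>

definition const_zsqrt2 :: "(nat \<Rightarrow> real) set" where
  "const_zsqrt2 = (\<lambda>c _. c) ` zsqrt2"

interpretation const: seq_algebra const_zsqrt2
proof
  show "1 \<in> const_zsqrt2" by (auto simp: const_zsqrt2_def one_fun_def)
  fix x y assume "x \<in> const_zsqrt2" "y \<in> const_zsqrt2"
  then obtain c d where "c \<in> zsqrt2" "d \<in> zsqrt2" "x = (\<lambda>_. c)" "y = (\<lambda>_. d)"
    by (auto simp: const_zsqrt2_def)
  then show "x - y \<in> const_zsqrt2" "sup x y \<in> const_zsqrt2"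
    by (auto simp: const_zsqrt2_def fun_diff_def sup_fun_def sup_real_def max_def)
next
  fix x assume "x \<in> const_zsqrt2"
  then show "Bseq x" by (auto simp: const_zsqrt2_def)
qed

lemma const_isolating: "const.isolating (\<lambda>x. x 0) 1"
  unfolding const.isolating_def
proof (intro conjI ballI impI)
  fix x assume "x \<in> const.\<Gamma>" "x 0 = 1"
  then show "1 \<le> x" by (auto simp: const_zsqrt2_def le_fun_def)
qed (auto simp: const.state_eval const.one)

lemma const_eq_zero: "\<lbrakk>x \<in> const_zsqrt2; x 0 = 0\<rbrakk> \<Longrightarrow> x = 0"
  by (auto simp: const_zsqrt2_def)

lemma const_hopfian: "mv_hopfian const.A" "ul_hopfian const.G"
  by - (rule const.simple_hopfian[OF const_isolating], use const_eq_zero in blast)+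

lemma const_semisimple: "mv_semisimple const.A" "ul_semisimple const.G"
  by - (rule const.semisimpleI[of "{(\<lambda>x. x 0, 1)}"]; use const_isolating const_eq_zero in simp)+

lemma const_not_dense: "\<not> mv_finite_rank_dense const.A" "\<not> ul_finite_rank_dense const.G"
proof -
  have "range (\<lambda>n. contraction ^ n) \<subseteq> (\<lambda>x. x 0) ` const.\<Gamma>"
  proof
    fix c assume "c \<in> range (\<lambda>n. contraction ^ n)"
    then obtain n where c: "c = contraction ^ n" by blast
    have "0 \<le> c" "c \<le> 1" using contraction_bounds contraction_less_one
      by (simp_all add: c power_le_one)
    moreover have "c \<in> zsqrt2" unfolding c by blast
    ultimately have "(\<lambda>_. c) \<in> const.\<Gamma>" unfolding const.gamma_seq_iff by (simp add: const_zsqrt2_def)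
    then show "c \<in> (\<lambda>x. x 0) ` const.\<Gamma>" by (rule rev_image_eqI) simp
  qed
  then have *: "infinite ((\<lambda>x. x 0) ` const.\<Gamma>)"
    using infinite_contraction_powers infinite_super by blast
  show "\<not> mv_finite_rank_dense const.A" "\<not> ul_finite_rank_dense const.G"
    by - (rule const.finite_rank_not_denseI[OF const_isolating *])+
qed

lemma const_finitely_generated:
  "mv_finitely_generated const.A" "ul_finitely_generated const.G"
proof -
  let ?a = "\<lambda>_::nat. contraction"
  have gen: "const.\<Gamma> \<subseteq> B"
    if B: "{?a} \<subseteq> B" "(\<lambda>_. 0) \<in> B" "\<And>x y. \<lbrakk>x \<in> B; y \<in> B\<rbrakk> \<Longrightarrow> (\<lambda>n. min (x n + y n) 1) \<in> B"
      "\<And>x. x \<in> B \<Longrightarrow> (\<lambda>n. 1 - x n) \<in> B" "\<And>x n. x \<in> B \<Longrightarrow> 0 \<le> x n \<and> x n \<le> 1" for B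
  proof
    fix x assume "x \<in> const.\<Gamma>"
    then have x: "x \<in> const_zsqrt2" "\<And>n. 0 \<le> x n \<and> x n \<le> 1" unfolding const.gamma_seq_iff by blast+
    then obtain c where c: "c \<in> zsqrt2" "x = (\<lambda>_. c)" by (auto simp: const_zsqrt2_def)
    then obtain p q :: int where pq: "c = p + q * contraction" by (rule_tac zsqrt2_contraction)
    have a: "?a \<in> B" using B(1) by simp
    \<comment> \<open>There is one generator, so the second slot of the clamping lemma holds the
      same sequence with coefficient 0.\<close>
    have "(\<lambda>n. min (max (of_int p + of_int q * ?a n + of_int 0 * ?a n) 0) 1) \<in> B"
      by (rule clamp_affine_mem[where B = B and a = ?a and b = ?a])
        (erule (1) B(3) | erule B(4) | erule B(5) | rule B(2) a)+
    moreover have "(\<lambda>n. min (max (of_int p + of_int q * ?a n + of_int 0 * ?a n) 0) 1) = x"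
      using x(2) unfolding c(2) pq by simp
    ultimately show "x \<in> B" by simp
  qed
  have "?a \<in> const.\<Gamma>"
    unfolding const.gamma_seq_iff using contraction_bounds by (simp add: const_zsqrt2_def)
  then have X: "{?a} \<subseteq> const.\<Gamma>" by blast
  show "mv_finitely_generated const.A" "ul_finitely_generated const.G"
    by - (rule const.seq_finitely_generatedI[OF _ X], simp, (rule gen; assumption))+
qed

section \<open>Sequences that are eventually geometric up to an integer limit\<close>

definition geometric :: "(nat \<Rightarrow> real) set" where
  "geometric = {x. range x \<subseteq> zsqrt2 \<and>
     (\<exists>p::int. \<exists>c\<in>zsqrt2. \<forall>\<^sub>F n in sequentially. x n = p + c * contraction ^ n)}"

lemma geometricI:
  assumes "\<And>n. x n \<in> zsqrt2" "c \<in> zsqrt2" "\<forall>\<^sub>F n in sequentially. x n = of_int p + c * contraction ^ n"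
  shows "x \<in> geometric"
  using assms by (auto simp: geometric_def)

lemma geometricE:
  assumes "x \<in> geometric"
  obtains p :: int and c where "\<forall>n. x n \<in> zsqrt2" "c \<in> zsqrt2"
    "\<forall>\<^sub>F n in sequentially. x n = of_int p + c * contraction ^ n"
proof -
  obtain p :: int and c where "range x \<subseteq> zsqrt2" "c \<in> zsqrt2"
    "\<forall>\<^sub>F n in sequentially. x n = of_int p + c * contraction ^ n"
    using assms unfolding geometric_def by blast
  then show thesis by (intro that[of c p]) auto
qed

lemma tendsto_geometric: "(\<lambda>n. p + c * contraction ^ n) \<longlonglongrightarrow> p"
proof -
  have "(\<lambda>n. contraction ^ n) \<longlonglongrightarrow> 0"
    by (rule LIMSEQ_realpow_zero[OF less_imp_le[OF contraction_bounds(1)] contraction_less_one])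
  then have "(\<lambda>n. p + c * contraction ^ n) \<longlonglongrightarrow> p + c * 0"
    by (intro tendsto_add tendsto_mult tendsto_const)
  then show ?thesis by simp
qed

text \<open>A nonzero limit \<open>p\<close> decides the eventual sign; if \<open>p = 0\<close>, the
  sign of \<open>c\<close> does, since powers of \<theta> are positive.\<close>

lemma geometric_eventually_compare:
  "(\<forall>\<^sub>F n in sequentially. 0 \<le> p + c * contraction ^ n) \<or>
   (\<forall>\<^sub>F n in sequentially. p + c * contraction ^ n \<le> 0)"
proof (cases p "0::real" rule: linorder_cases)
  case less
  then have "\<forall>\<^sub>F n in sequentially. p + c * contraction ^ n < 0"
    by (rule order_tendstoD(2)[OF tendsto_geometric])
  then have "\<forall>\<^sub>F n in sequentially. p + c * contraction ^ n \<le> 0" by eventually_elim simp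
  then show ?thesis ..
next
  case equal
  have "0 \<le> contraction ^ n" for n using contraction_bounds by simp
  then show ?thesis using equal
    by (cases "0 \<le> c") (auto simp: mult_nonpos_nonneg)
next
  case greater
  then have "\<forall>\<^sub>F n in sequentially. 0 < p + c * contraction ^ n"
    by (rule order_tendstoD(1)[OF tendsto_geometric])
  then have "\<forall>\<^sub>F n in sequentially. 0 \<le> p + c * contraction ^ n" by eventually_elim simp
  then show ?thesis ..
qed

interpretation geometric: seq_algebra geometric
proof
  show "1 \<in> geometric" by (rule geometricI[of _ 0 1]) auto
  fix x y assume "x \<in> geometric" "y \<in> geometric"
  then obtain p c p' c' where
    x: "\<forall>n. x n \<in> zsqrt2" "c \<in> zsqrt2" "\<forall>\<^sub>F n in sequentially. x n = of_int p + c * contraction ^ n" and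
    y: "\<forall>n. y n \<in> zsqrt2" "c' \<in> zsqrt2" "\<forall>\<^sub>F n in sequentially. y n = of_int p' + c' * contraction ^ n"
    by (elim geometricE) blast
  have "\<forall>\<^sub>F n in sequentially. (x - y) n = of_int (p - p') + (c - c') * contraction ^ n"
    using x(3) y(3) by eventually_elim (simp add: algebra_simps)
  then show "x - y \<in> geometric" by (rule geometricI[rotated 2]) (use x y in auto)
  have mem: "sup x y n \<in> zsqrt2" for n
    using x(1)[rule_format, of n] y(1)[rule_format, of n] by (simp add: sup_fun_def sup_real_def max_def)
  from geometric_eventually_compare[of "of_int (p - p')" "c - c'"]
  show "sup x y \<in> geometric"
  proof
    assume "\<forall>\<^sub>F n in sequentially. 0 \<le> of_int (p - p') + (c - c') * contraction ^ n"
    with x(3) y(3) have "\<forall>\<^sub>F n in sequentially. sup x y n = of_int p + c * contraction ^ n"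
      by eventually_elim (simp add: algebra_simps sup_real_def)
    then show ?thesis by (rule geometricI[OF mem x(2)])
  next
    assume "\<forall>\<^sub>F n in sequentially. of_int (p - p') + (c - c') * contraction ^ n \<le> 0"
    with x(3) y(3) have "\<forall>\<^sub>F n in sequentially. sup x y n = of_int p' + c' * contraction ^ n"
      by eventually_elim (simp add: algebra_simps sup_real_def)
    then show ?thesis by (rule geometricI[OF mem y(2)])
  qed
next
  fix x assume "x \<in> geometric"
  then obtain p c where "\<forall>\<^sub>F n in sequentially. x n = of_int p + c * contraction ^ n"
    by (elim geometricE) blast
  then have "x \<longlonglongrightarrow> of_int p"
    using tendsto_geometric tendsto_cong by fast
  then show "Bseq x" by (intro convergent_imp_Bseq convergentI)
qed

lemma single_geometric: "v \<in> zsqrt2 \<Longrightarrow> (\<lambda>n. if n = i then v else 0) \<in> geometric"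
proof (rule geometricI[of _ 0 0])
  show "\<forall>\<^sub>F n in sequentially. (if n = i then v else 0) = of_int 0 + 0 * contraction ^ n"
    using eventually_gt_at_top[of i] by eventually_elim simp
qed auto

lemma geometric_not_hopfian: "\<not> mv_hopfian geometric.A" "\<not> ul_hopfian geometric.G"
proof -
  have shift: "(\<lambda>n. x (Suc n)) \<in> geometric" if "x \<in> geometric" for x
  proof -
    obtain p c where x: "\<forall>n. x n \<in> zsqrt2" "c \<in> zsqrt2"
      "\<forall>\<^sub>F n in sequentially. x n = of_int p + c * contraction ^ n"
      using \<open>x \<in> geometric\<close> by (elim geometricE) blast
    from x(3) have "\<forall>\<^sub>F n in sequentially. x (Suc n) = of_int p + c * contraction ^ Suc n"
      by (rule eventually_sequentially_Suc[THEN iffD2])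
    then have "\<forall>\<^sub>F n in sequentially. x (Suc n) = of_int p + (c * contraction) * contraction ^ n"
      by eventually_elim simp
    then show ?thesis by (rule geometricI[rotated 2]) (use x in auto)
  qed
  have unshift: "\<exists>y\<in>geometric. \<forall>n. y (Suc n) = x n" if "x \<in> geometric" for x
  proof -
    obtain p c where x: "\<forall>n. x n \<in> zsqrt2" "c \<in> zsqrt2"
      "\<forall>\<^sub>F n in sequentially. x n = of_int p + c * contraction ^ n"
      using \<open>x \<in> geometric\<close> by (elim geometricE) blast
    \<comment> \<open>Moving one index to the right costs a factor \<open>1 / contraction\<close> in
      the coefficient.\<close>
    from x(3) have "\<forall>\<^sub>F n in sequentially. x (Suc n - 1) = of_int p + (c * (1 / contraction)) * contraction ^ Suc n"
      by eventually_elim (use contraction_bounds in simp)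
    then have "\<forall>\<^sub>F n in sequentially. x (n - 1) = of_int p + (c * (1 / contraction)) * contraction ^ n"
      by (rule eventually_sequentially_Suc[THEN iffD1])
    then have "(\<lambda>n. x (n - 1)) \<in> geometric"
      by (rule geometricI[rotated 2]) (use x in blast)+
    then show ?thesis by (intro bexI[of _ "\<lambda>n. x (n - 1)"]) auto
  qed
  show "\<not> mv_hopfian geometric.A" "\<not> ul_hopfian geometric.G"
    by - (rule geometric.shift_not_hopfian[OF single_geometric[OF zsqrt2_zero_one(2)] shift unshift]; assumption)+
qed

lemma geometric_semisimple: "mv_semisimple geometric.A" "ul_semisimple geometric.G"
  by - (rule geometric.seq_semisimple, rule single_geometric[OF zsqrt2_zero_one(2)])+

lemma geometric_not_dense:
  "\<not> mv_finite_rank_dense geometric.A" "\<not> ul_finite_rank_dense geometric.G"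
proof -
  have "range (\<lambda>n. contraction ^ n) \<subseteq> (\<lambda>x. x 0) ` geometric.\<Gamma>"
  proof
    fix c assume "c \<in> range (\<lambda>n. contraction ^ n)"
    then obtain n where c: "c = contraction ^ n" by blast
    have "0 \<le> c" "c \<le> 1" using contraction_bounds contraction_less_one
      by (simp_all add: c power_le_one)
    moreover have "c \<in> zsqrt2" unfolding c by blast
    ultimately have "(\<lambda>n. if n = 0 then c else 0) \<in> geometric.\<Gamma>"
      unfolding geometric.gamma_seq_iff by (simp add: single_geometric)
    then show "c \<in> (\<lambda>x. x 0) ` geometric.\<Gamma>" by (rule rev_image_eqI) simp
  qed
  then have *: "infinite ((\<lambda>x. x 0) ` geometric.\<Gamma>)"
    using infinite_contraction_powers infinite_super by blast
  have "geometric.isolating (\<lambda>x. x 0) (single 0)"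
    by (rule geometric.isolating_single[OF single_geometric[OF zsqrt2_zero_one(2)]])
  from geometric.finite_rank_not_denseI[OF this *]
  show "\<not> mv_finite_rank_dense geometric.A" "\<not> ul_finite_rank_dense geometric.G" .
qed

text \<open>The generators tend to 0 and the unit is 1, so limits are integers while the
  coefficients of the power fill the ring. Clamped formulas with large coefficients yield unit
  vectors, which adjust the finitely many exceptional entries.\<close>

lemma geometric_finitely_generated:
  "mv_finitely_generated geometric.A" "ul_finitely_generated geometric.G"
proof -
  let ?a = "\<lambda>n. contraction ^ n" and ?b = "\<lambda>n. contraction ^ Suc n"
  note pos = contraction_bounds(1)
  have gen: "geometric.\<Gamma> \<subseteq> B"
    if X: "{?a, ?b} \<subseteq> B" and zero: "(\<lambda>_. 0) \<in> B"
      and oplus: "\<And>x y. \<lbrakk>x \<in> B; y \<in> B\<rbrakk> \<Longrightarrow> (\<lambda>n. min (x n + y n) 1) \<in> B"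
      and neg: "\<And>x. x \<in> B \<Longrightarrow> (\<lambda>n. 1 - x n) \<in> B"
      and bounds: "\<And>x n. x \<in> B \<Longrightarrow> 0 \<le> x n \<and> x n \<le> 1" for B
  proof
    have clamp: "(\<lambda>n. min (max (of_int p + c * contraction ^ n) 0) 1) \<in> B"
      if c: "c \<in> zsqrt2" for p :: int and c
    proof -
      obtain q r :: int where qr: "c = q + r * contraction" using c by (rule zsqrt2_contraction)
      have ab: "?a \<in> B" "?b \<in> B" using X by auto
      have "(\<lambda>n. min (max (of_int p + of_int q * ?a n + of_int r * ?b n) 0) 1) \<in> B"
        by (rule clamp_affine_mem[where B = B and a = ?a and b = ?b])
          (erule (1) oplus | erule neg | erule bounds | rule zero ab)+
      moreover have "(\<lambda>n. of_int p + of_int q * ?a n + of_int r * ?b n) = (\<lambda>n. of_int p + c * contraction ^ n)"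
        by (simp add: qr fun_eq_iff algebra_simps)
      ultimately show ?thesis by (simp only: fun_eq_iff)
    qed
    have monus: "(\<lambda>n. max (x n - y n) 0) \<in> B" if xy: "x \<in> B" "y \<in> B" for x y
    proof -
      have mem: "(\<lambda>n. 1 - min ((1 - x n) + y n) 1) \<in> B" by (rule neg[OF oplus[OF neg[OF xy(1)] xy(2)]])
      have eq: "1 - min ((1 - x n) + y n) 1 = max (x n - y n) 0" for n by (simp add: min_def max_def)
      show ?thesis using mem unfolding eq .
    qed
    have inf: "(\<lambda>n. min (x n) (y n)) \<in> B" if xy: "x \<in> B" "y \<in> B" for x y
    proof -
      have mem: "(\<lambda>n. max (x n - max (x n - y n) 0) 0) \<in> B" by (rule monus[OF xy(1) monus[OF xy]])
      have eq: "max (x n - max (x n - y n) 0) 0 = min (x n) (y n)" for n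
        using bounds[OF xy(1), of n] bounds[OF xy(2), of n] by (simp add: min_def max_def)
      show ?thesis using mem unfolding eq .
    qed
    have inv: "(1 / contraction) ^ K \<in> zsqrt2" for K by blast
    have less: "(\<lambda>n. if n < K then 1 else 0) \<in> B" for K
    proof (cases K)
      case 0
      then show ?thesis using zero by simp
    next
      case (Suc k)
      \<comment> \<open>The constant makes \<open>-1 + ?c * contraction ^ n\<close> equal to 1 at
        \<open>n = k\<close>, larger before and negative from \<open>k + 1\<close> on, so clamping
        yields the indicator of \<open>n < K\<close>.\<close>
      let ?c = "2 * (1 / contraction) ^ k"
      have "?c \<in> zsqrt2" using zsqrt2_mult[OF zsqrt2_of_int[of 2] inv] by simp
      from clamp[OF this, of "-1"]
      have mem: "(\<lambda>n. min (max (of_int (-1) + ?c * contraction ^ n) 0) 1) \<in> B" .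
      have eq: "min (max (of_int (-1) + ?c * contraction ^ n) 0) 1 = (if n < K then 1 else 0)" for n
      proof (cases "n \<le> k")
        case True
        then have "(1 / contraction) ^ k * contraction ^ n = (1 / contraction) ^ (k - n)"
          using pos by (simp add: power_diff power_divide)
        moreover have "1 \<le> (1 / contraction) ^ (k - n)"
          using pos contraction_less_one by (intro one_le_power) simp
        ultimately have "1 \<le> of_int (-1) + ?c * contraction ^ n" by simp
        then show ?thesis using True Suc by (simp add: min_def max_def)
      next
        case False
        then have "(1 / contraction) ^ k * contraction ^ n = contraction ^ (n - k)"
          using pos by (simp add: power_diff power_divide)
        moreover have "contraction ^ (n - k) \<le> contraction ^ 1"
          using False pos contraction_less_one by (intro power_decreasing) auto
        ultimately have "of_int (-1) + ?c * contraction ^ n \<le> 0" using contraction_bounds(2) by simp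
        then show ?thesis using False Suc by (simp add: min_def max_def)
      qed
      show ?thesis using mem unfolding eq .
    qed
    have ge: "(\<lambda>n. if K \<le> n then 1 else 0) \<in> B" for K
    proof -
      have "(\<lambda>n. 1 - (if n < K then 1 else 0)) = (\<lambda>n. if K \<le> n then 1 else (0::real))" by auto
      then show ?thesis using neg[OF less[of K]] by simp
    qed
    have single: "single K \<in> B" for K
    proof -
      have "(\<lambda>n. max ((if n < Suc K then 1 else 0) - (if n < K then 1 else 0)) 0) = single K" by auto
      then show ?thesis using monus[OF less[of "Suc K"] less[of K]] by simp
    qed
    have point: "(\<lambda>n. if n = K then v else 0) \<in> B" if v: "v \<in> zsqrt2" "0 \<le> v" "v \<le> 1" for K v
    proof -
      \<comment> \<open>The sequence \<open>d * contraction ^ n\<close> takes the value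
        \<open>v\<close> at index \<open>K\<close>; the minimum with the unit vector removes all
        other entries.\<close>
      define d where "d = v * (1 / contraction) ^ K"
      have "d \<in> zsqrt2" unfolding d_def by (rule zsqrt2_mult[OF v(1) inv])
      from clamp[OF this, of 0]
      have mem: "(\<lambda>n. min (single K n) (min (max (of_int 0 + d * contraction ^ n) 0) 1)) \<in> B"
        by (rule inf[OF single])
      have "d * contraction ^ K = v" using pos by (simp add: d_def power_divide)
      then have eq: "(\<lambda>n. min (single K n) (min (max (of_int 0 + d * contraction ^ n) 0) 1)) =
          (\<lambda>n. if n = K then v else 0)"
        using v(2,3) by (auto simp: fun_eq_iff)
      show ?thesis using mem unfolding eq .
    qed
    fix x assume "x \<in> geometric.\<Gamma>"
    then have x: "x \<in> geometric" "\<And>n. 0 \<le> x n \<and> x n \<le> 1" unfolding geometric.gamma_seq_iff by blast+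
    obtain p c where pc: "\<forall>n. x n \<in> zsqrt2" "c \<in> zsqrt2"
      "\<forall>\<^sub>F n in sequentially. x n = of_int p + c * contraction ^ n"
      using x(1) by (elim geometricE) blast
    obtain N where N: "\<And>n. n \<ge> N \<Longrightarrow> x n = of_int p + c * contraction ^ n"
      using pc(3) unfolding eventually_sequentially by blast
    have initial: "(\<lambda>n. if n < M then x n else 0) \<in> B" for M
    proof (induction M)
      case (Suc M)
      have mem: "(\<lambda>n. min ((if n < M then x n else 0) + (if n = M then x M else 0)) 1) \<in> B"
        by (rule oplus[OF Suc point]) (use pc(1) x(2) in blast)+
      have eq: "(\<lambda>n. min ((if n < M then x n else 0) + (if n = M then x M else 0)) 1) =
          (\<lambda>n. if n < Suc M then x n else 0)"
        using x(2) by (auto simp: fun_eq_iff less_Suc_eq)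
      show ?case using mem unfolding eq .
    qed (use zero in simp)
    \<comment> \<open>The entries before \<open>N\<close> and the clamped formula from
      \<open>N\<close> on have disjoint supports, so the truncated sum glues them together.\<close>
    have mem: "(\<lambda>n. min ((if n < N then x n else 0) +
        min (if N \<le> n then 1 else 0) (min (max (of_int p + c * contraction ^ n) 0) 1)) 1) \<in> B"
      by (rule oplus[OF initial inf[OF ge clamp[OF pc(2)]]])
    have eq: "(\<lambda>n. min ((if n < N then x n else 0) +
        min (if N \<le> n then 1 else 0) (min (max (of_int p + c * contraction ^ n) 0) 1)) 1) = x"
    proof
      fix n
      show "min ((if n < N then x n else 0) +
        min (if N \<le> n then 1 else 0) (min (max (of_int p + c * contraction ^ n) 0) 1)) 1 = x n"
        using x(2)[of n] N[of n] by (cases "n < N") (simp_all add: min_def max_def)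
    qed
    show "x \<in> B" using mem unfolding eq .
  qed
  have "?a \<in> geometric" by (rule geometricI[of _ 1 0]) auto
  moreover have "?b \<in> geometric" by (rule geometricI[of _ contraction 0]) auto
  moreover have "0 \<le> contraction ^ n \<and> contraction ^ n \<le> 1" for n
    using pos contraction_less_one by (simp add: power_le_one)
  ultimately have "?a \<in> geometric.\<Gamma>" "?b \<in> geometric.\<Gamma>"
    unfolding geometric.gamma_seq_iff by blast+
  then have X: "{?a, ?b} \<subseteq> geometric.\<Gamma>" by blast
  show "mv_finitely_generated geometric.A" "ul_finitely_generated geometric.G"
    by - (rule geometric.seq_finitely_generatedI[OF _ X], simp, (rule gen; assumption))+
qed

section \<open>The algebras that are not finitely generated\<close>

locale stationary_algebra =
  fixes k :: "nat \<Rightarrow> nat"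
  assumes k_pos: "0 < k n"
begin

text \<open>An integer limit gives the point at infinity the quotient \<int>, whatever
  \<open>k\<close> is.\<close>

definition T :: "(nat \<Rightarrow> real) set" where
  "T = {x. (\<forall>n. real (k n) * x n \<in> \<int>) \<and> (\<exists>c::int. \<forall>\<^sub>F n in sequentially. x n = c)}"

lemma T_I:
  "\<lbrakk>\<And>n. real (k n) * x n \<in> \<int>; \<forall>\<^sub>F n in sequentially. x n = of_int c\<rbrakk> \<Longrightarrow> x \<in> T"
  by (auto simp: T_def)

lemma T_E:
  assumes "x \<in> T"
  obtains c :: int where "\<forall>n. real (k n) * x n \<in> \<int>" "\<forall>\<^sub>F n in sequentially. x n = c"
  using assms by (auto simp: T_def)

lemma lim_eventually_const: "\<forall>\<^sub>F n in sequentially. x n = c \<Longrightarrow> lim x = (c :: real)"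
  by (intro limI tendsto_eventually)

sublocale seq_algebra T
proof
  show "1 \<in> T" by (rule T_I[of _ 1]) auto
  fix x y assume "x \<in> T" "y \<in> T"
  then obtain c d where
    x: "\<forall>n. real (k n) * x n \<in> \<int>" "\<forall>\<^sub>F n in sequentially. x n = of_int c" and
    y: "\<forall>n. real (k n) * y n \<in> \<int>" "\<forall>\<^sub>F n in sequentially. y n = of_int d"
    by (elim T_E) blast
  show "x - y \<in> T"
  proof (rule T_I)
    show "real (k n) * (x - y) n \<in> \<int>" for n using x(1) y(1) by (simp add: algebra_simps)
    show "\<forall>\<^sub>F n in sequentially. (x - y) n = of_int (c - d)"
      using x(2) y(2) by eventually_elim simp
  qed
  show "sup x y \<in> T"
  proof (rule T_I)
    show "real (k n) * sup x y n \<in> \<int>" for n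
      using x(1) y(1) by (simp add: sup_real_def max_def)
    show "\<forall>\<^sub>F n in sequentially. sup x y n = of_int (max c d)"
      using x(2) y(2) by eventually_elim (simp add: sup_real_def)
  qed
next
  fix x assume "x \<in> T"
  then obtain c where "\<forall>\<^sub>F n in sequentially. x n = of_int c" by (rule T_E)
  then have "x \<longlonglongrightarrow> of_int c" by (rule tendsto_eventually)
  then show "Bseq x" by (intro convergent_imp_Bseq convergentI)
qed

notation oplus (infixl "\<boxplus>" 65)

lemma point_mem: "real (k i) * v \<in> \<int> \<Longrightarrow> (\<lambda>n. if n = i then v else 0) \<in> T"
proof (rule T_I)
  show "\<forall>\<^sub>F n in sequentially. (if n = i then v else 0) = of_int 0"
    using eventually_gt_at_top[of i] by eventually_elim simp
qed auto

lemma single_mem: "single i \<in> T"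
  by (rule point_mem) simp

lemma semisimple: "mv_semisimple A" "ul_semisimple G"
  by - (rule seq_semisimple[OF single_mem])+

lemma state_lim: "state lim"
proof -
  have "lim 1 = (1::real)" by (rule lim_eventually_const) simp
  moreover have "lim (x - y) = lim x - lim y \<and> lim (sup x y) = sup (lim x) (lim y)"
    if xy: "x \<in> T" "y \<in> T" for x y
  proof -
    obtain c d where c: "\<forall>\<^sub>F n in sequentially. x n = of_int c" and
      d: "\<forall>\<^sub>F n in sequentially. y n = of_int d"
      using xy by (elim T_E) blast
    have "\<forall>\<^sub>F n in sequentially. (x - y) n = of_int c - of_int d"
      using c d by eventually_elim simp
    moreover have "\<forall>\<^sub>F n in sequentially. sup x y n = sup (of_int c) (of_int d)"
      using c d by eventually_elim simp
    ultimately show ?thesis using c d by (simp add: lim_eventually_const)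
  qed
  ultimately show ?thesis by (simp add: unital_hom_def)
qed

text \<open>If \<open>J\<close> avoids a unit vector, that coordinate vanishes on \<open>J\<close>.
  Otherwise \<open>J\<close> contains all indicators of initial segments, and one of them would
  complete an element with limit 1 to the unit; limits in \<Gamma> being 0 or 1, they all vanish on
  \<open>J\<close>.\<close>

lemma gamma_ideal_cover:
  assumes J: "gamma_ideal J"
  shows "\<exists>h\<in>insert lim (range (\<lambda>i x. x i)). state h \<and> (\<forall>x\<in>J. h x = 0)"
proof (cases "\<exists>i. single i \<notin> J")
  case True
  then obtain i where "single i \<notin> J" by blast
  then have "\<forall>x\<in>J. x i = 0"
    using isolating_gamma_ideal[OF isolating_single[OF single_mem] J] by blast
  then show ?thesis using state_eval by blast
next
  case False
  have initial: "(\<lambda>n. if n < M then 1 else 0) \<in> J" for M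
  proof (induction M)
    case 0
    then show ?case using gamma_idealD(2)[OF J] by (simp add: zero_fun_def)
  next
    case (Suc M)
    have "(\<lambda>n. if n < M then 1 else 0) \<boxplus> single M \<in> J"
      using False by (intro gamma_idealD(4)[OF J Suc]) blast
    moreover have "(\<lambda>n. if n < M then 1 else 0) \<boxplus> single M = (\<lambda>n. if n < Suc M then 1 else 0)"
      by (auto simp: fun_eq_iff inf_real_def)
    ultimately show ?case by simp
  qed
  have "lim x = 0" if x: "x \<in> J" for x
  proof -
    have x': "x \<in> T" "\<And>n. 0 \<le> x n \<and> x n \<le> 1"
      using gamma_idealD(1)[OF J x] unfolding gamma_seq_iff by blast+
    obtain c where c: "\<forall>\<^sub>F n in sequentially. x n = of_int c" using x'(1) by (rule T_E)
    obtain N where N: "\<And>n. n \<ge> N \<Longrightarrow> x n = of_int c"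
      using c unfolding eventually_sequentially by blast
    have "0 \<le> c" "c \<le> 1" using x'(2)[of N] N[of N] by simp_all
    moreover have "c \<noteq> 1"
    proof
      assume "c = 1"
      have "(\<lambda>n. if n < N then 1 else 0) \<boxplus> x = 1"
        using N x'(2) \<open>c = 1\<close> by (auto simp: fun_eq_iff inf_real_def not_less)
      moreover have "(\<lambda>n. if n < N then 1 else 0) \<boxplus> x \<in> J" by (rule gamma_idealD(4)[OF J initial x])
      ultimately show False using gamma_idealD(3)[OF J] by simp
    qed
    ultimately have "c = 0" by linarith
    then show ?thesis using lim_eventually_const[OF c] by simp
  qed
  then show ?thesis using state_lim by blast
qed

lemma eval_range: "(\<lambda>x. x i) ` T = range (\<lambda>j::int. j / k i)"
proof (intro equalityI subsetI)
  fix c assume "c \<in> (\<lambda>x. x i) ` T"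
  then obtain x where "x \<in> T" "c = x i" by blast
  then have "real (k i) * c \<in> \<int>" by (auto simp: T_def)
  then obtain j :: int where "real (k i) * c = j" by (auto elim: Ints_cases)
  then have "c = j / k i" using k_pos[of i] by (simp add: field_simps)
  then show "c \<in> range (\<lambda>j::int. j / k i)" by blast
next
  fix c assume "c \<in> range (\<lambda>j::int. j / k i)"
  then obtain j :: int where "c = j / k i" by blast
  then have "(\<lambda>n. if n = i then c else 0) \<in> T" using k_pos[of i] by (intro point_mem) simp
  then show "c \<in> (\<lambda>x. x i) ` T" by (rule rev_image_eqI) simp
qed

lemma lim_range: "lim ` T = range (\<lambda>j::int. j / real 1)"
proof (intro equalityI subsetI)
  fix c assume "c \<in> lim ` T"
  then obtain x where x: "x \<in> T" "c = lim x" by blast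
  obtain j where "\<forall>\<^sub>F n in sequentially. x n = of_int j" using x(1) by (rule T_E)
  then show "c \<in> range (\<lambda>j::int. j / real 1)" using lim_eventually_const x(2) by auto
next
  fix c assume "c \<in> range (\<lambda>j::int. j / real 1)"
  then obtain j :: int where c: "c = j" by auto
  have "(\<lambda>_. c) \<in> T" by (rule T_I[of _ j]) (auto simp: c)
  moreover have "lim (\<lambda>_::nat. c) = c" by (rule lim_eventually_const) simp
  ultimately show "c \<in> lim ` T" by (metis image_eqI)
qed

lemma dense: "mv_finite_rank_dense A" "ul_finite_rank_dense G"
proof -
  have rational: "\<exists>m::nat. m > 0 \<and> h ` T = range (\<lambda>j::int. j / m)"
    if "h \<in> insert lim (range (\<lambda>i x. x i))" for h :: "(nat \<Rightarrow> real) \<Rightarrow> real"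
    using that eval_range lim_range k_pos zero_less_one by blast
  show "mv_finite_rank_dense A" "ul_finite_rank_dense G"
    by - (rule finite_rank_denseI[OF gamma_ideal_cover rational]; assumption)+
qed

text \<open>The chain consists of the sequences constant from index \<open>N\<close> on; the unit
  vector at \<open>N\<close> shows that each stage is proper.\<close>

lemma not_finitely_generated: "\<not> mv_finitely_generated A" "\<not> ul_finitely_generated G"
proof -
  define C where "C N = {x \<in> T. \<forall>n\<ge>N. x n = x N}" for N
  have mono: "C M \<subseteq> C N" if MN: "M \<le> N" for M N
  proof
    fix x assume "x \<in> C M"
    then have x: "x \<in> T" "x n = x M" if "n \<ge> M" for n using that unfolding C_def by blast+
    have "x n = x N" if "n \<ge> N" for n
      by (rule trans[OF x(2)[of n] x(2)[OF MN, symmetric]]) (use that MN in simp)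
    then show "x \<in> C N" using x(1)[OF order_refl] unfolding C_def by blast
  qed
  have union: "T = (\<Union>n. C n)"
  proof (intro equalityI subsetI)
    fix x assume x: "x \<in> T"
    then obtain c where "\<forall>\<^sub>F n in sequentially. x n = of_int c" by (rule T_E)
    then obtain N where "\<And>n. n \<ge> N \<Longrightarrow> x n = of_int c" unfolding eventually_sequentially by blast
    then have "x \<in> C N" using x by (simp add: C_def)
    then show "x \<in> (\<Union>n. C n)" by blast
  qed (auto simp: C_def)
  have proper: "C N \<noteq> T" for N
  proof
    assume "C N = T"
    then have "single N \<in> C N" using single_mem by blast
    then have "\<forall>n\<ge>N. single N n = single N N" unfolding C_def mem_Collect_eq by (rule conjunct2)
    from this[rule_format, of "Suc N"] show False by simp
  qed
  have unit: "1 \<in> C N" for N by (simp add: C_def one)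
  have C_I: "z \<in> C N" if "z \<in> T" "\<And>n. n \<ge> N \<Longrightarrow> z n = z N" for z N
    using that unfolding C_def by blast
  have C_D: "z \<in> T" "n \<ge> N \<Longrightarrow> z n = z N" if "z \<in> C N" for z N n
    using that unfolding C_def by blast+
  have diff': "x - y \<in> C N" if xy: "x \<in> C N" "y \<in> C N" for x y N
  proof (rule C_I)
    show "x - y \<in> T" by (intro diff C_D(1)[OF xy(1)] C_D(1)[OF xy(2)])
    show "(x - y) n = (x - y) N" if "n \<ge> N" for n
      unfolding minus_apply C_D(2)[OF xy(1) that] C_D(2)[OF xy(2) that] ..
  qed
  have sup': "sup x y \<in> C N" if xy: "x \<in> C N" "y \<in> C N" for x y N
  proof (rule C_I)
    show "sup x y \<in> T" by (intro sup C_D(1)[OF xy(1)] C_D(1)[OF xy(2)])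
    show "sup x y n = sup x y N" if "n \<ge> N" for n
      unfolding sup_apply C_D(2)[OF xy(1) that] C_D(2)[OF xy(2) that] ..
  qed
  show "\<not> mv_finitely_generated A" "\<not> ul_finitely_generated G"
    by - (rule not_finitely_generatedI[OF mono union proper unit diff' sup']; assumption)+
qed

lemma constant_not_hopfian:
  assumes "\<And>n. k n = 1"
  shows "\<not> mv_hopfian A" "\<not> ul_hopfian G"
proof -
  have shift: "(\<lambda>n. x (Suc n)) \<in> T" if x: "x \<in> T" for x
  proof -
    obtain c where c: "\<forall>n. real (k n) * x n \<in> \<int>" "\<forall>\<^sub>F n in sequentially. x n = of_int c"
      using x by (rule T_E)
    from c(2) have "\<forall>\<^sub>F n in sequentially. x (Suc n) = of_int c"
      by (rule eventually_sequentially_Suc[THEN iffD2])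
    then show ?thesis by (rule T_I[rotated]) (use c(1) assms in simp)
  qed
  have unshift: "\<exists>y\<in>T. \<forall>n. y (Suc n) = x n" if x: "x \<in> T" for x
  proof -
    obtain c where c: "\<forall>n. real (k n) * x n \<in> \<int>" "\<forall>\<^sub>F n in sequentially. x n = of_int c"
      using x by (rule T_E)
    from c(2) have "\<forall>\<^sub>F n in sequentially. x (Suc n - 1) = of_int c" by simp
    then have "\<forall>\<^sub>F n in sequentially. x (n - 1) = of_int c"
      by (rule eventually_sequentially_Suc[THEN iffD1])
    then have "(\<lambda>n. x (n - 1)) \<in> T" by (rule T_I[rotated]) (use c(1) assms in simp)
    then show ?thesis by (intro bexI[of _ "\<lambda>n. x (n - 1)"]) auto
  qed
  show "\<not> mv_hopfian A" "\<not> ul_hopfian G"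
    by - (rule shift_not_hopfian[OF single_mem shift unshift]; assumption)+
qed

text \<open>The coordinates are the only homomorphisms to \<open>\<real>\<close> besides the limit, and their images tell them
  apart; so an endomorphism onto \<open>\<Gamma>\<close> preserves every coordinate.\<close>

lemma onto_gamma_endo_id:
  assumes inj: "inj k" and k2: "\<And>n. 2 \<le> k n"
    and F: "gamma_endo F" and onto: "F ` \<Gamma> = \<Gamma>" and x: "x \<in> \<Gamma>"
  shows "F x = x"
proof
  fix i
  have oplus: "\<And>x y. \<lbrakk>x \<in> \<Gamma>; y \<in> \<Gamma>\<rbrakk> \<Longrightarrow> F (x \<boxplus> y) = F x \<boxplus> F y"
    and neg: "\<And>x. x \<in> \<Gamma> \<Longrightarrow> F (1 - x) = 1 - F x" and F0: "F 0 = 0"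
    using F unfolding gamma_endo_def by blast+
  have Fmem: "F y \<in> \<Gamma>" if "y \<in> \<Gamma>" for y using F that unfolding gamma_endo_def by blast
  have Fbounds: "0 \<le> F y i" "F y i \<le> 1" if "y \<in> \<Gamma>" for y
    using Fmem[OF that] unfolding gamma_seq_iff by blast+
  have mono: "F y i \<le> F z i" if "y \<in> \<Gamma>" "z \<in> \<Gamma>" "y \<le> z" for y z
    using gamma_endo_mono[OF F that] by (simp add: le_fun_def)
  have point: "(\<lambda>n. if n = j then v else 0) \<in> \<Gamma>" if "real (k j) * v \<in> \<int>" "0 \<le> v" "v \<le> 1" for j v
    unfolding gamma_seq_iff using point_mem[OF that(1)] that by simp
  have single: "single j \<in> \<Gamma>" for j by (rule point) auto
  have inverse: "(\<lambda>n. if n = j then 1 / k j else 0) \<in> \<Gamma>" for j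
    by (rule point) (use k_pos[of j] in auto)
  have two_valued: "F (single j) i = 0 \<or> F (single j) i = 1" for j
  proof -
    \<comment> \<open>Unit vectors are idempotent, and \<open>min (2 * t) 1 = t\<close> has only the
      solutions 0 and 1.\<close>
    have "single j \<boxplus> single j = single j" by (auto simp: fun_eq_iff inf_real_def)
    then have "(F (single j) \<boxplus> F (single j)) i = F (single j) i" using oplus[OF single single, of j j] by simp
    then show ?thesis by (auto simp: inf_real_def min_def split: if_splits)
  qed
  \<comment> \<open>The entry \<open>1 / k i\<close> lies strictly between 0 and 1 because
    \<open>2 \<le> k i\<close>; a coordinate of \<open>F\<close> that factors through the limit
    cannot attain it.\<close>
  obtain w where w: "w \<in> \<Gamma>" "F w = (\<lambda>n. if n = i then 1 / k i else 0)"
    using inverse[of i] onto by (metis (no_types, lifting) imageE)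
  have "\<exists>j. F (single j) i = 1"
  proof (rule ccontr)
    assume "\<nexists>j. F (single j) i = 1"
    then have zero: "F (single j) i = 0" for j using two_valued by blast
    have initial: "(\<lambda>n. if n < M then 1 else 0) \<in> \<Gamma> \<and> F (\<lambda>n. if n < M then 1 else 0) i = 0" for M
    proof (induction M)
      case 0
      have "(\<lambda>n. if n < (0::nat) then 1 else 0) = (0 :: nat \<Rightarrow> real)" by auto
      then show ?case using F0 by (simp add: le_fun_def)
    next
      case (Suc M)
      have eq: "(\<lambda>n. if n < M then 1 else 0) \<boxplus> single M = (\<lambda>n. if n < Suc M then 1 else 0)"
        by (auto simp: fun_eq_iff inf_real_def)
      have "(\<lambda>n. if n < M then 1 else 0) \<boxplus> single M \<in> \<Gamma>" using Suc single by (intro oplus_mem) blast+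
      moreover have "F ((\<lambda>n. if n < M then 1 else 0) \<boxplus> single M) i = 0"
        using oplus[of "\<lambda>n. if n < M then 1 else 0" "single M"] Suc single zero[of M]
        by (simp add: inf_real_def del: Int_iff)
      ultimately show ?case unfolding eq by blast
    qed
    \<comment> \<open>Coordinate \<open>i\<close> of \<open>F\<close> would kill everything
      eventually zero and so depend on \<Gamma> only on the limit, which is 0 or 1.\<close>
    have vanish: "F y i = 0" if y: "y \<in> \<Gamma>" "\<forall>\<^sub>F n in sequentially. y n = 0" for y
    proof -
      obtain N where N: "\<And>n. n \<ge> N \<Longrightarrow> y n = 0" using y(2) unfolding eventually_sequentially by blast
      have "y \<le> (\<lambda>n. if n < N then 1 else 0)"
        using y(1) N unfolding gamma_seq_iff by (simp add: le_fun_def not_less)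
      then have "F y i \<le> 0" using mono[OF y(1)] initial[of N] by metis
      then show ?thesis using Fbounds(1)[OF y(1)] by simp
    qed
    have w': "w \<in> T" "\<And>n. 0 \<le> w n \<and> w n \<le> 1" using w(1) unfolding gamma_seq_iff by blast+
    obtain c where c: "\<forall>\<^sub>F n in sequentially. w n = of_int c" using w'(1) by (rule T_E)
    then obtain N where "w N = of_int c" unfolding eventually_sequentially by blast
    then have "0 \<le> c" "c \<le> 1" using w'(2)[of N] by simp_all
    then have "c = 0 \<or> c = 1" by linarith
    then have "F w i = 0 \<or> F w i = 1"
    proof
      assume "c = 0"
      then show ?thesis using vanish[OF w(1)] c by simp
    next
      assume "c = 1"
      have "1 - w \<in> \<Gamma>" using w(1) by simp
      moreover have "\<forall>\<^sub>F n in sequentially. (1 - w) n = 0" using c by eventually_elim (simp add: \<open>c = 1\<close>)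
      ultimately have "F (1 - w) i = 0" by (rule vanish)
      then show ?thesis using neg[OF w(1)] by simp
    qed
    then show False using k2[of i] by (simp add: w(2))
  qed
  then obtain j where j: "F (single j) i = 1" ..
  let ?v = "\<lambda>v n. if n = j then v else 0 :: real"
  have multiple: "F (?v (real m / k j)) i = real m * F (?v (1 / k j)) i" if "m \<le> k j" for m
    using that
  proof (induction m)
    case 0
    have "?v (real 0 / k j) = 0" by (auto simp: fun_eq_iff)
    then show ?case using F0 by simp
  next
    case (Suc m)
    have eq: "?v (real m / k j) + ?v (1 / k j) = ?v (real (Suc m) / k j)"
      by (auto simp: fun_eq_iff add_divide_distrib)
    have "F (?v (real m / k j) + ?v (1 / k j)) = F (?v (real m / k j)) + F (?v (1 / k j))"
    proof (rule gamma_endo_add[OF F point inverse])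
      show "?v (real m / k j) + ?v (1 / k j) \<le> 1"
        unfolding eq using Suc.prems k_pos[of j] by (auto simp: le_fun_def divide_le_eq)
    qed (use Suc.prems k_pos[of j] in \<open>auto simp: divide_le_eq\<close>)
    then show ?case unfolding eq using Suc by (simp add: algebra_simps)
  qed
  \<comment> \<open>The \<open>k j\<close>-fold sum of the entry \<open>1 / k j\<close> at
    \<open>j\<close> is the unit vector, whose image has entry 1 at \<open>i\<close>.\<close>
  have base: "F (?v (1 / k j)) i = 1 / k j"
  proof -
    have eq1: "real (k j) / k j = 1" using k_pos[of j] by simp
    have "real (k j) * F (?v (1 / k j)) i = 1"
      using multiple[OF order_refl, unfolded eq1] j by (simp only:)
    then show ?thesis using k_pos[of j] by (simp add: eq_divide_eq mult.commute)
  qed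
  \<comment> \<open>Split \<open>y\<close> into its entry at \<open>j\<close> and a rest below
    \<open>1 - single j\<close>; coordinate \<open>i\<close> of \<open>F\<close> kills the
    rest.\<close>
  have coordinate: "F y i = y j" if y: "y \<in> \<Gamma>" for y
  proof -
    have y': "y \<in> T" "\<And>n. 0 \<le> y n \<and> y n \<le> 1" using y unfolding gamma_seq_iff by blast+
    have "real (k j) * y j \<in> \<int>" using y'(1) unfolding T_def by blast
    then obtain m :: int where m: "real (k j) * y j = m" by (rule Ints_cases)
    have "y j = m / k j" using m k_pos[of j] by (simp add: field_simps)
    moreover have "0 \<le> m" "m \<le> int (k j)"
    proof -
      have "0 \<le> real_of_int m" "real_of_int m \<le> real (k j)"
        using y'(2)[of j] k_pos[of j] unfolding m[symmetric] by (simp_all add: mult_left_le)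
      then show "0 \<le> m" "m \<le> int (k j)" by linarith+
    qed
    ultimately have m': "y j = real (nat m) / k j" "nat m \<le> k j" by auto
    have yj: "?v (y j) \<in> \<Gamma>" using y' by (intro point) (auto simp: T_def)
    have rest: "y - ?v (y j) \<in> \<Gamma>"
      unfolding gamma_seq_iff using y' diff[OF y'(1), of "?v (y j)"] yj by auto
    have "y - ?v (y j) \<le> 1 - single j" using y'(2) by (auto simp: le_fun_def)
    moreover have co: "1 - single j \<in> \<Gamma>" using single[of j] by simp
    ultimately have "F (y - ?v (y j)) i \<le> F (1 - single j) i" by (intro mono rest)
    also have "\<dots> = 0" using neg[OF single, of j] j by simp
    finally have "F (y - ?v (y j)) i = 0" using Fbounds(1)[OF rest] by simp
    moreover have "F (?v (y j) + (y - ?v (y j))) = F (?v (y j)) + F (y - ?v (y j))"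
      by (rule gamma_endo_add[OF F yj rest]) (use y'(2) in \<open>auto simp: le_fun_def\<close>)
    ultimately have "F y i = F (?v (y j)) i" by simp
    also have "\<dots> = y j" unfolding m'(1) multiple[OF m'(2)] base by simp
    finally show ?thesis .
  qed
  \<comment> \<open>Since \<open>w\<close> has entry \<open>1 / k i\<close> at \<open>j\<close>,
    \<open>k i\<close> divides \<open>k j\<close>; conversely \<open>1 / k j\<close> occurs at
    coordinate \<open>i\<close> of an element of \<open>T\<close>, so \<open>k j\<close> divides
    \<open>k i\<close>. Injectivity of \<open>k\<close> then identifies \<open>j\<close> with
    \<open>i\<close>.\<close>
  have "w \<in> T" using w(1) by blast
  then have "real (k j) * w j \<in> \<int>" by (simp add: T_def)
  moreover have "w j = 1 / k i" using coordinate[OF w(1)] w(2) by simp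
  ultimately have "real (k j) / real (k i) \<in> \<int>" by simp
  then obtain a :: int where "real (k j) / real (k i) = a" by (rule Ints_cases)
  then have "real_of_int (int (k j)) = real_of_int (a * int (k i))" using k_pos[of i] by (simp add: field_simps)
  then have "int (k j) = a * int (k i)" by (simp only: of_int_eq_iff)
  then have "k i dvd k j" by (metis dvd_triv_right int_dvd_int_iff)
  have "F (?v (1 / k j)) \<in> T" using Fmem[OF inverse] by blast
  then have "real (k i) * F (?v (1 / k j)) i \<in> \<int>" unfolding T_def by blast
  then have "real (k i) / real (k j) \<in> \<int>" unfolding base by simp
  then obtain b :: int where "real (k i) / real (k j) = b" by (rule Ints_cases)
  then have "real_of_int (int (k i)) = real_of_int (b * int (k j))" using k_pos[of j] by (simp add: field_simps)
  then have "int (k i) = b * int (k j)" by (simp only: of_int_eq_iff)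
  then have "k j dvd k i" by (metis dvd_triv_right int_dvd_int_iff)
  then have "k j = k i" using \<open>k i dvd k j\<close> by (rule dvd_antisym)
  then have "j = i" by (rule injD[OF inj])
  then show "F x i = x i" using coordinate[OF x] by simp
qed

lemma injective_hopfian:
  assumes "inj k" "\<And>n. 2 \<le> k n"
  shows "mv_hopfian A" "ul_hopfian G"
proof -
  have *: "inj_on F \<Gamma>" if "gamma_endo F" "F ` \<Gamma> = \<Gamma>" for F
  proof (rule inj_onI)
    fix x y assume "x \<in> \<Gamma>" "y \<in> \<Gamma>" "F x = F y"
    then show "x = y" using onto_gamma_endo_id[OF assms that] by metis
  qed
  show "mv_hopfian A" "ul_hopfian G"
    by - (rule hopfianI, rule *, assumption+)+
qed

end

interpretation integer_seq: stationary_algebra "\<lambda>_. 1"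
  by unfold_locales simp

interpretation fraction_seq: stationary_algebra "\<lambda>n. n + 2"
  by unfold_locales simp

lemma integer_seq_not_hopfian: "\<not> mv_hopfian integer_seq.A" "\<not> ul_hopfian integer_seq.G"
  by - (rule integer_seq.constant_not_hopfian[OF refl])+

lemma fraction_seq_hopfian: "mv_hopfian fraction_seq.A" "ul_hopfian fraction_seq.G"
  by - (rule fraction_seq.injective_hopfian; simp add: inj_def)+

theorem corollary5p6:
  shows
    "(\<forall>\<C> \<in> {{A :: universe mv. mv_algebra A \<and>
                \<not> mv_semisimple A \<and> mv_finitely_generated A \<and> mv_finite_rank_dense A},
             {A :: universe mv. mv_algebra A \<and>
                mv_semisimple A \<and> \<not> mv_finitely_generated A \<and> mv_finite_rank_dense A},
             {A :: universe mv. mv_algebra A \<and>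
                mv_semisimple A \<and> mv_finitely_generated A \<and> \<not> mv_finite_rank_dense A}}.
        (\<exists>A\<in>\<C>. mv_hopfian A) \<and> (\<exists>A\<in>\<C>. \<not> mv_hopfian A)) \<and>
     (\<forall>\<C> \<in> {{G :: universe ulgroup. unital_lgroup G \<and>
                \<not> ul_semisimple G \<and> ul_finitely_generated G \<and> ul_finite_rank_dense G},
             {G :: universe ulgroup. unital_lgroup G \<and>
                ul_semisimple G \<and> \<not> ul_finitely_generated G \<and> ul_finite_rank_dense G},
             {G :: universe ulgroup. unital_lgroup G \<and>
                ul_semisimple G \<and> ul_finitely_generated G \<and> \<not> ul_finite_rank_dense G}}.
        (\<exists>G\<in>\<C>. ul_hopfian G) \<and> (\<exists>G\<in>\<C>. \<not> ul_hopfian G))"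
proof -
  have ex1: "\<exists>A :: universe mv. (mv_algebra A \<and> \<not> mv_semisimple A \<and>
      mv_finitely_generated A \<and> mv_finite_rank_dense A) \<and> mv_hopfian A"
    by (intro exI[of _ chang.A] conjI chang.mv_algebra_A chang_not_semisimple(1) chang_finitely_generated(1)
      chang.dense(1) chang_hopfian(1))
  have ex2: "\<exists>A :: universe mv. (mv_algebra A \<and> \<not> mv_semisimple A \<and>
      mv_finitely_generated A \<and> mv_finite_rank_dense A) \<and> \<not> mv_hopfian A"
    by (intro exI[of _ affine.A] conjI affine.mv_algebra_A affine_not_semisimple(1) affine_finitely_generated(1)
      affine.dense(1) affine_not_hopfian(1))
  have ex3: "\<exists>A :: universe mv. (mv_algebra A \<and> mv_semisimple A \<and>
      \<not> mv_finitely_generated A \<and> mv_finite_rank_dense A) \<and> mv_hopfian A"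
    by (intro exI[of _ fraction_seq.A] conjI fraction_seq.mv_algebra_A fraction_seq.semisimple(1) fraction_seq.not_finitely_generated(1)
      fraction_seq.dense(1) fraction_seq_hopfian(1))
  have ex4: "\<exists>A :: universe mv. (mv_algebra A \<and> mv_semisimple A \<and>
      \<not> mv_finitely_generated A \<and> mv_finite_rank_dense A) \<and> \<not> mv_hopfian A"
    by (intro exI[of _ integer_seq.A] conjI integer_seq.mv_algebra_A integer_seq.semisimple(1) integer_seq.not_finitely_generated(1)
      integer_seq.dense(1) integer_seq_not_hopfian(1))
  have ex5: "\<exists>A :: universe mv. (mv_algebra A \<and> mv_semisimple A \<and>
      mv_finitely_generated A \<and> \<not> mv_finite_rank_dense A) \<and> mv_hopfian A"
    by (intro exI[of _ const.A] conjI const.mv_algebra_A const_semisimple(1) const_finitely_generated(1)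
      const_not_dense(1) const_hopfian(1))
  have ex6: "\<exists>A :: universe mv. (mv_algebra A \<and> mv_semisimple A \<and>
      mv_finitely_generated A \<and> \<not> mv_finite_rank_dense A) \<and> \<not> mv_hopfian A"
    by (intro exI[of _ geometric.A] conjI geometric.mv_algebra_A geometric_semisimple(1) geometric_finitely_generated(1)
      geometric_not_dense(1) geometric_not_hopfian(1))
  have ex7: "\<exists>G :: universe ulgroup. (unital_lgroup G \<and> \<not> ul_semisimple G \<and>
      ul_finitely_generated G \<and> ul_finite_rank_dense G) \<and> ul_hopfian G"
    by (intro exI[of _ chang.G] conjI chang.unital_lgroup_G chang_not_semisimple(2) chang_finitely_generated(2)
      chang.dense(2) chang_hopfian(2))
  have ex8: "\<exists>G :: universe ulgroup. (unital_lgroup G \<and> \<not> ul_semisimple G \<and>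
      ul_finitely_generated G \<and> ul_finite_rank_dense G) \<and> \<not> ul_hopfian G"
    by (intro exI[of _ affine.G] conjI affine.unital_lgroup_G affine_not_semisimple(2) affine_finitely_generated(2)
      affine.dense(2) affine_not_hopfian(2))
  have ex9: "\<exists>G :: universe ulgroup. (unital_lgroup G \<and> ul_semisimple G \<and>
      \<not> ul_finitely_generated G \<and> ul_finite_rank_dense G) \<and> ul_hopfian G"
    by (intro exI[of _ fraction_seq.G] conjI fraction_seq.unital_lgroup_G fraction_seq.semisimple(2) fraction_seq.not_finitely_generated(2)
      fraction_seq.dense(2) fraction_seq_hopfian(2))
  have ex10: "\<exists>G :: universe ulgroup. (unital_lgroup G \<and> ul_semisimple G \<and>
      \<not> ul_finitely_generated G \<and> ul_finite_rank_dense G) \<and> \<not> ul_hopfian G"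
    by (intro exI[of _ integer_seq.G] conjI integer_seq.unital_lgroup_G integer_seq.semisimple(2) integer_seq.not_finitely_generated(2)
      integer_seq.dense(2) integer_seq_not_hopfian(2))
  have ex11: "\<exists>G :: universe ulgroup. (unital_lgroup G \<and> ul_semisimple G \<and>
      ul_finitely_generated G \<and> \<not> ul_finite_rank_dense G) \<and> ul_hopfian G"
    by (intro exI[of _ const.G] conjI const.unital_lgroup_G const_semisimple(2) const_finitely_generated(2)
      const_not_dense(2) const_hopfian(2))
  have ex12: "\<exists>G :: universe ulgroup. (unital_lgroup G \<and> ul_semisimple G \<and>
      ul_finitely_generated G \<and> \<not> ul_finite_rank_dense G) \<and> \<not> ul_hopfian G"
    by (intro exI[of _ geometric.G] conjI geometric.unital_lgroup_G geometric_semisimple(2) geometric_finitely_generated(2)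
      geometric_not_dense(2) geometric_not_hopfian(2))
  show ?thesis
    \<comment> \<open>This leaves the twelve existence statements; \<open>TrueI\<close> disposes of
      the empty set that ends each enumeration of classes.\<close>
    unfolding ball_simps bex_simps
    by (intro conjI TrueI ex1 ex2 ex3 ex4 ex5 ex6 ex7 ex8 ex9 ex10 ex11 ex12)
qed

end
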